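(* Let $R$ be a commutative ring, let $G',G$ be groups and let $\varphi:G'\to G$ be a map. The following assertions are equivalent: (a) $\varphi$ is a pseudomorphism of groups. (b) $1\in\mathrm{Im}(\varphi)$ and, for every $G$-graded $R$-algebra $B=\bigoplus_{g\in G}B_g$ with support contained in $\mathrm{Im}(\varphi)$, putting $\tilde{B}=B$ and $\tilde{B}_\sigma=B_{\varphi(\sigma)}$ for every $\sigma\in G'$, one obtains a $G'$-graded algebra $\tilde{B}$ coinciding with $B$ as an ungraded algebra. If $B$ and $\tilde{B}$ are $G$-graded and $G'$-graded algebras as in (b), then, for every element $g\in G$, there is an equivalence of (abelian) categories between: (1) the full subcategory $\Sigma_{g\mathrm{Im}(\varphi)}$ of $Gr_B$ with objects the graded $B$-modules $X$ such that $\mathrm{Supp}(X)\subseteq g\,\mathrm{Im}(\varphi)$; and (2) the full subcategory $\tilde{\Sigma}_{\mathrm{Im}(\varphi)}$ of $Gr_{\tilde{B}}$ with objects the graded $\tilde{B}$-modules $V$ such that $V_\sigma\tilde{B}_\tau=0$ whenever $\varphi(\sigma)\varphi(\tau)\notin\mathrm{Im}(\varphi)$ ($\sigma,\tau\in G'$).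
   Context: Algebras are associative with unit, modules are right modules. $Gr_B$ (resp. $Gr_{\tilde{B}}$) is the category of $G$-graded right $B$-modules (resp. $G'$-graded right $\tilde{B}$-modules) with degree-preserving morphisms; the support of a $G$-graded object $X$ is $\mathrm{Supp}(X)=\{g\in G:X_g\neq0\}$. A pseudomorphism of groups $\varphi:G'\to G$ is an injective map such that $\varphi(1)=1$ and, whenever $\sigma,\tau\in G'$ satisfy $\varphi(\sigma)\varphi(\tau)\in\mathrm{Im}(\varphi)$, one has $\varphi(\sigma\tau)=\varphi(\sigma)\varphi(\tau)$.
   Formalization: The commutative ring R is assumed nonzero: over R = 0 every R-algebra is zero, so (b) only says that 1 lies in Im(φ), and (b)⇒(a) fails, for example for the map swapping the two elements of Z/2. *)

theory Defs
  imports "HOL-Algebra.Module" "HOL-Algebra.AbelCoset"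
begin

section \<open>Pseudomorphisms of groups\<close>

definition pseudomorphism ::
    "('h, 'm) monoid_scheme \<Rightarrow> ('g, 'n) monoid_scheme \<Rightarrow> ('h \<Rightarrow> 'g) \<Rightarrow> bool" where
  "pseudomorphism G' G \<phi> \<longleftrightarrow>
     \<phi> \<in> carrier G' \<rightarrow> carrier G \<and>
     inj_on \<phi> (carrier G') \<and>
     \<phi> \<one>\<^bsub>G'\<^esub> = \<one>\<^bsub>G\<^esub> \<and>
     (\<forall>\<sigma>\<in>carrier G'. \<forall>\<tau>\<in>carrier G'.
        \<phi> \<sigma> \<otimes>\<^bsub>G\<^esub> \<phi> \<tau> \<in> \<phi> ` carrier G' \<longrightarrow>
        \<phi> (\<sigma> \<otimes>\<^bsub>G'\<^esub> \<tau>) = \<phi> \<sigma> \<otimes>\<^bsub>G\<^esub> \<phi> \<tau>)"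


section \<open>Graded algebras\<close>

text \<open>The library locale \<open>algebra\<close> only covers commutative algebras; here the ring
  \<open>B\<close> is arbitrary (associative with unit).\<close>

locale r_algebra = module R B + ring B for R (structure) and B (structure) +
  assumes smult_mult_left:
      "\<lbrakk>a \<in> carrier R; x \<in> carrier B; y \<in> carrier B\<rbrakk> \<Longrightarrow>
       (a \<odot>\<^bsub>B\<^esub> x) \<otimes>\<^bsub>B\<^esub> y = a \<odot>\<^bsub>B\<^esub> (x \<otimes>\<^bsub>B\<^esub> y)"
    and smult_mult_right:
      "\<lbrakk>a \<in> carrier R; x \<in> carrier B; y \<in> carrier B\<rbrakk> \<Longrightarrow>
       x \<otimes>\<^bsub>B\<^esub> (a \<odot>\<^bsub>B\<^esub> y) = a \<odot>\<^bsub>B\<^esub> (x \<otimes>\<^bsub>B\<^esub> y)"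

text \<open>\<open>M\<close> is the internal direct sum of the family \<open>(A i)\<close> with \<open>i \<in> I\<close> of additive
  subgroups: every element has exactly one finitely supported decomposition.\<close>

definition internal_direct_sum ::
    "('a, 'm) ring_scheme \<Rightarrow> 'i set \<Rightarrow> ('i \<Rightarrow> 'a set) \<Rightarrow> bool" where
  "internal_direct_sum M I A \<longleftrightarrow>
     (\<forall>i\<in>I. additive_subgroup (A i) M) \<and>
     (\<forall>x\<in>carrier M. \<exists>!c. c \<in> (\<Pi>\<^sub>E i\<in>I. A i) \<and> finite {i \<in> I. c i \<noteq> \<zero>\<^bsub>M\<^esub>} \<and>
        x = (\<Oplus>\<^bsub>M\<^esub> i\<in>{i \<in> I. c i \<noteq> \<zero>\<^bsub>M\<^esub>}. c i))"

text \<open>For a group \<open>G\<close>, the condition that the unit of \<open>B\<close> is homogeneous of degree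
  \<open>\<one>\<close> follows from the conditions below.\<close>

definition graded_algebra ::
    "('r, 'k) ring_scheme \<Rightarrow> ('g, 'n) monoid_scheme \<Rightarrow> ('r, 'b) module \<Rightarrow> ('g \<Rightarrow> 'b set) \<Rightarrow> bool" where
  "graded_algebra R G B \<B> \<longleftrightarrow>
     r_algebra R B \<and>
     (\<forall>g\<in>carrier G. submodule (\<B> g) R B) \<and>
     internal_direct_sum B (carrier G) \<B> \<and>
     (\<forall>g\<in>carrier G. \<forall>h\<in>carrier G. \<forall>x\<in>\<B> g. \<forall>y\<in>\<B> h. x \<otimes>\<^bsub>B\<^esub> y \<in> \<B> (g \<otimes>\<^bsub>G\<^esub> h))"

definition Supp :: "('g, 'n) monoid_scheme \<Rightarrow> ('a, 'm) ring_scheme \<Rightarrow> ('g \<Rightarrow> 'a set) \<Rightarrow> 'g set" where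
  "Supp G M A = {g \<in> carrier G. A g \<noteq> {\<zero>\<^bsub>M\<^esub>}}"


section \<open>Graded right modules\<close>

text \<open>As for the library record \<open>module\<close>, the multiplicative fields inherited from
  \<open>ring\<close> carry no information.\<close>

record ('x, 'b, 'g) graded_module = "'x ring" +
  ract :: "'x \<Rightarrow> 'b \<Rightarrow> 'x" (infixl \<open>\<bullet>\<index>\<close> 70)
  homog :: "'g \<Rightarrow> 'x set"

locale right_module = B?: ring B + X?: abelian_group X
  for B :: "('b, 'k) ring_scheme" (structure) and X :: "('x, 'b, 'g) graded_module" (structure) +
  assumes ract_closed:
      "\<lbrakk>x \<in> carrier X; b \<in> carrier B\<rbrakk> \<Longrightarrow> x \<bullet>\<^bsub>X\<^esub> b \<in> carrier X"
    and ract_l_distr: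
      "\<lbrakk>x \<in> carrier X; y \<in> carrier X; b \<in> carrier B\<rbrakk> \<Longrightarrow>
       (x \<oplus>\<^bsub>X\<^esub> y) \<bullet>\<^bsub>X\<^esub> b = x \<bullet>\<^bsub>X\<^esub> b \<oplus>\<^bsub>X\<^esub> y \<bullet>\<^bsub>X\<^esub> b"
    and ract_r_distr:
      "\<lbrakk>x \<in> carrier X; b \<in> carrier B; c \<in> carrier B\<rbrakk> \<Longrightarrow>
       x \<bullet>\<^bsub>X\<^esub> (b \<oplus>\<^bsub>B\<^esub> c) = x \<bullet>\<^bsub>X\<^esub> b \<oplus>\<^bsub>X\<^esub> x \<bullet>\<^bsub>X\<^esub> c"
    and ract_assoc:
      "\<lbrakk>x \<in> carrier X; b \<in> carrier B; c \<in> carrier B\<rbrakk> \<Longrightarrow>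
       x \<bullet>\<^bsub>X\<^esub> (b \<otimes>\<^bsub>B\<^esub> c) = (x \<bullet>\<^bsub>X\<^esub> b) \<bullet>\<^bsub>X\<^esub> c"
    and ract_one:
      "x \<in> carrier X \<Longrightarrow> x \<bullet>\<^bsub>X\<^esub> \<one>\<^bsub>B\<^esub> = x"

definition graded_right_module ::
    "('g, 'n) monoid_scheme \<Rightarrow> ('b, 'k) ring_scheme \<Rightarrow> ('g \<Rightarrow> 'b set) \<Rightarrow>
     ('x, 'b, 'g) graded_module \<Rightarrow> bool" where
  "graded_right_module G B \<B> X \<longleftrightarrow>
     right_module B X \<and>
     internal_direct_sum X (carrier G) (homog X) \<and>
     (\<forall>g\<in>carrier G. \<forall>h\<in>carrier G. \<forall>x\<in>homog X g. \<forall>b\<in>\<B> h.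
        x \<bullet>\<^bsub>X\<^esub> b \<in> homog X (g \<otimes>\<^bsub>G\<^esub> h))"

text \<open>Morphisms are extensional functions, so that two of them are equal iff they agree
  on the carrier of the domain.\<close>

definition graded_hom ::
    "('g, 'n) monoid_scheme \<Rightarrow> ('b, 'k) ring_scheme \<Rightarrow>
     ('x, 'b, 'g) graded_module \<Rightarrow> ('x, 'b, 'g) graded_module \<Rightarrow> ('x \<Rightarrow> 'x) set" where
  "graded_hom G B X Y =
     {f \<in> carrier X \<rightarrow>\<^sub>E carrier Y.
        (\<forall>x\<in>carrier X. \<forall>y\<in>carrier X. f (x \<oplus>\<^bsub>X\<^esub> y) = f x \<oplus>\<^bsub>Y\<^esub> f y) \<and>
        (\<forall>x\<in>carrier X. \<forall>b\<in>carrier B. f (x \<bullet>\<^bsub>X\<^esub> b) = f x \<bullet>\<^bsub>Y\<^esub> b) \<and>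
        (\<forall>g\<in>carrier G. \<forall>x\<in>homog X g. f x \<in> homog Y g)}"


section \<open>Abelian categories and their equivalences\<close>

text \<open>\<open>Hom C X Y\<close> is the set of morphisms from \<open>X\<close> to \<open>Y\<close>; hom-sets need not be
  disjoint, so every operation on morphisms also takes the objects involved.
  \<open>Comp C X Y Z g f\<close> is \<open>g\<close> after \<open>f\<close>, for \<open>f\<close> from \<open>X\<close> to \<open>Y\<close> and \<open>g\<close> from \<open>Y\<close> to \<open>Z\<close>.\<close>

record ('o, 'm) precategory =
  Obj :: "'o set"
  Hom :: "'o \<Rightarrow> 'o \<Rightarrow> 'm set"
  Comp :: "'o \<Rightarrow> 'o \<Rightarrow> 'o \<Rightarrow> 'm \<Rightarrow> 'm \<Rightarrow> 'm"
  Ident :: "'o \<Rightarrow> 'm"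
  AddHom :: "'o \<Rightarrow> 'o \<Rightarrow> 'm \<Rightarrow> 'm \<Rightarrow> 'm"
  ZeroHom :: "'o \<Rightarrow> 'o \<Rightarrow> 'm"

definition full_subcategory :: "('o, 'm) precategory \<Rightarrow> 'o set \<Rightarrow> ('o, 'm) precategory" where
  "full_subcategory C S = C\<lparr>Obj := Obj C \<inter> S\<rparr>"

locale preadditive_category =
  fixes C :: "('o, 'm) precategory"
  assumes comp_closed:
      "\<lbrakk>X \<in> Obj C; Y \<in> Obj C; Z \<in> Obj C; f \<in> Hom C X Y; g \<in> Hom C Y Z\<rbrakk> \<Longrightarrow>
       Comp C X Y Z g f \<in> Hom C X Z"
    and comp_assoc:
      "\<lbrakk>W \<in> Obj C; X \<in> Obj C; Y \<in> Obj C; Z \<in> Obj C;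
        f \<in> Hom C W X; g \<in> Hom C X Y; h \<in> Hom C Y Z\<rbrakk> \<Longrightarrow>
       Comp C W X Z (Comp C X Y Z h g) f = Comp C W Y Z h (Comp C W X Y g f)"
    and ident_closed: "X \<in> Obj C \<Longrightarrow> Ident C X \<in> Hom C X X"
    and comp_ident_right:
      "\<lbrakk>X \<in> Obj C; Y \<in> Obj C; f \<in> Hom C X Y\<rbrakk> \<Longrightarrow> Comp C X X Y f (Ident C X) = f"
    and comp_ident_left:
      "\<lbrakk>X \<in> Obj C; Y \<in> Obj C; f \<in> Hom C X Y\<rbrakk> \<Longrightarrow> Comp C X Y Y (Ident C Y) f = f"
    and hom_comm_group:
      "\<lbrakk>X \<in> Obj C; Y \<in> Obj C\<rbrakk> \<Longrightarrow>
       comm_group \<lparr>carrier = Hom C X Y, mult = AddHom C X Y, one = ZeroHom C X Y\<rparr>"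
    and comp_add_left:
      "\<lbrakk>X \<in> Obj C; Y \<in> Obj C; Z \<in> Obj C; f \<in> Hom C X Y; g \<in> Hom C Y Z; h \<in> Hom C Y Z\<rbrakk> \<Longrightarrow>
       Comp C X Y Z (AddHom C Y Z g h) f = AddHom C X Z (Comp C X Y Z g f) (Comp C X Y Z h f)"
    and comp_add_right:
      "\<lbrakk>X \<in> Obj C; Y \<in> Obj C; Z \<in> Obj C; f \<in> Hom C X Y; g \<in> Hom C X Y; h \<in> Hom C Y Z\<rbrakk> \<Longrightarrow>
       Comp C X Y Z h (AddHom C X Y f g) = AddHom C X Z (Comp C X Y Z h f) (Comp C X Y Z h g)"

definition is_zero_object :: "('o, 'm) precategory \<Rightarrow> 'o \<Rightarrow> bool" where
  "is_zero_object C Z \<longleftrightarrow>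
     Z \<in> Obj C \<and> (\<forall>X\<in>Obj C. (\<exists>!f. f \<in> Hom C X Z) \<and> (\<exists>!f. f \<in> Hom C Z X))"

definition is_biproduct ::
    "('o, 'm) precategory \<Rightarrow> 'o \<Rightarrow> 'o \<Rightarrow> 'o \<Rightarrow> 'm \<Rightarrow> 'm \<Rightarrow> 'm \<Rightarrow> 'm \<Rightarrow> bool" where
  "is_biproduct C X Y P i j p q \<longleftrightarrow>
     P \<in> Obj C \<and>
     i \<in> Hom C X P \<and> j \<in> Hom C Y P \<and> p \<in> Hom C P X \<and> q \<in> Hom C P Y \<and>
     Comp C X P X p i = Ident C X \<and> Comp C Y P Y q j = Ident C Y \<and>
     Comp C X P Y q i = ZeroHom C X Y \<and> Comp C Y P X p j = ZeroHom C Y X \<and>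
     AddHom C P P (Comp C P X P i p) (Comp C P Y P j q) = Ident C P"

text \<open>\<open>k\<close> from \<open>K\<close> to \<open>X\<close> is a kernel of \<open>f\<close> from \<open>X\<close> to \<open>Y\<close>; dually
  \<open>q\<close> from \<open>Y\<close> to \<open>Q\<close> is a cokernel of \<open>f\<close>.\<close>

definition is_kernel :: "('o, 'm) precategory \<Rightarrow> 'o \<Rightarrow> 'o \<Rightarrow> 'm \<Rightarrow> 'o \<Rightarrow> 'm \<Rightarrow> bool" where
  "is_kernel C X Y f K k \<longleftrightarrow>
     K \<in> Obj C \<and> k \<in> Hom C K X \<and> Comp C K X Y f k = ZeroHom C K Y \<and>
     (\<forall>T\<in>Obj C. \<forall>t\<in>Hom C T X. Comp C T X Y f t = ZeroHom C T Y \<longrightarrow>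
        (\<exists>!u. u \<in> Hom C T K \<and> Comp C T K X k u = t))"

definition is_cokernel :: "('o, 'm) precategory \<Rightarrow> 'o \<Rightarrow> 'o \<Rightarrow> 'm \<Rightarrow> 'o \<Rightarrow> 'm \<Rightarrow> bool" where
  "is_cokernel C X Y f Q q \<longleftrightarrow>
     Q \<in> Obj C \<and> q \<in> Hom C Y Q \<and> Comp C X Y Q q f = ZeroHom C X Q \<and>
     (\<forall>T\<in>Obj C. \<forall>t\<in>Hom C Y T. Comp C X Y T t f = ZeroHom C X T \<longrightarrow>
        (\<exists>!u. u \<in> Hom C Q T \<and> Comp C Y Q T u q = t))"

definition is_mono :: "('o, 'm) precategory \<Rightarrow> 'o \<Rightarrow> 'o \<Rightarrow> 'm \<Rightarrow> bool" where
  "is_mono C X Y f \<longleftrightarrow>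
     (\<forall>T\<in>Obj C. \<forall>u\<in>Hom C T X. \<forall>v\<in>Hom C T X. Comp C T X Y f u = Comp C T X Y f v \<longrightarrow> u = v)"

definition is_epi :: "('o, 'm) precategory \<Rightarrow> 'o \<Rightarrow> 'o \<Rightarrow> 'm \<Rightarrow> bool" where
  "is_epi C X Y f \<longleftrightarrow>
     (\<forall>T\<in>Obj C. \<forall>u\<in>Hom C Y T. \<forall>v\<in>Hom C Y T. Comp C X Y T u f = Comp C X Y T v f \<longrightarrow> u = v)"

locale abelian_category = preadditive_category C for C :: "('o, 'm) precategory" +
  assumes zero_object: "\<exists>Z. is_zero_object C Z"
    and biproducts:
      "\<lbrakk>X \<in> Obj C; Y \<in> Obj C\<rbrakk> \<Longrightarrow> \<exists>P i j p q. is_biproduct C X Y P i j p q"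
    and kernels:
      "\<lbrakk>X \<in> Obj C; Y \<in> Obj C; f \<in> Hom C X Y\<rbrakk> \<Longrightarrow> \<exists>K k. is_kernel C X Y f K k"
    and cokernels:
      "\<lbrakk>X \<in> Obj C; Y \<in> Obj C; f \<in> Hom C X Y\<rbrakk> \<Longrightarrow> \<exists>Q q. is_cokernel C X Y f Q q"
    and mono_is_kernel:
      "\<lbrakk>X \<in> Obj C; Y \<in> Obj C; f \<in> Hom C X Y; is_mono C X Y f\<rbrakk> \<Longrightarrow>
       \<exists>Z\<in>Obj C. \<exists>h\<in>Hom C Y Z. is_kernel C Y Z h X f"
    and epi_is_cokernel:
      "\<lbrakk>X \<in> Obj C; Y \<in> Obj C; f \<in> Hom C X Y; is_epi C X Y f\<rbrakk> \<Longrightarrow>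
       \<exists>W\<in>Obj C. \<exists>h\<in>Hom C W X. is_cokernel C W X h Y f"

locale additive_functor =
  C: preadditive_category C + D: preadditive_category D
  for C :: "('o, 'm) precategory" and D :: "('p, 'n) precategory" +
  fixes Fo :: "'o \<Rightarrow> 'p" and Fm :: "'o \<Rightarrow> 'o \<Rightarrow> 'm \<Rightarrow> 'n"
  assumes obj_closed: "X \<in> Obj C \<Longrightarrow> Fo X \<in> Obj D"
    and hom_closed:
      "\<lbrakk>X \<in> Obj C; Y \<in> Obj C; f \<in> Hom C X Y\<rbrakk> \<Longrightarrow> Fm X Y f \<in> Hom D (Fo X) (Fo Y)"
    and map_ident: "X \<in> Obj C \<Longrightarrow> Fm X X (Ident C X) = Ident D (Fo X)"
    and map_comp:
      "\<lbrakk>X \<in> Obj C; Y \<in> Obj C; Z \<in> Obj C; f \<in> Hom C X Y; g \<in> Hom C Y Z\<rbrakk> \<Longrightarrow>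
       Fm X Z (Comp C X Y Z g f) = Comp D (Fo X) (Fo Y) (Fo Z) (Fm Y Z g) (Fm X Y f)"
    and map_add:
      "\<lbrakk>X \<in> Obj C; Y \<in> Obj C; f \<in> Hom C X Y; g \<in> Hom C X Y\<rbrakk> \<Longrightarrow>
       Fm X Y (AddHom C X Y f g) = AddHom D (Fo X) (Fo Y) (Fm X Y f) (Fm X Y g)"

definition is_isomorphism :: "('o, 'm) precategory \<Rightarrow> 'o \<Rightarrow> 'o \<Rightarrow> 'm \<Rightarrow> bool" where
  "is_isomorphism C X Y f \<longleftrightarrow>
     f \<in> Hom C X Y \<and>
     (\<exists>g\<in>Hom C Y X. Comp C X Y X g f = Ident C X \<and> Comp C Y X Y f g = Ident C Y)"

text \<open>A natural isomorphism \<open>\<eta>\<close> from the identity functor of \<open>C\<close> to the endofunctor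
  \<open>(Eo, Em)\<close>.\<close>

definition natural_iso_from_identity ::
    "('o, 'm) precategory \<Rightarrow> ('o \<Rightarrow> 'o) \<Rightarrow> ('o \<Rightarrow> 'o \<Rightarrow> 'm \<Rightarrow> 'm) \<Rightarrow> ('o \<Rightarrow> 'm) \<Rightarrow> bool" where
  "natural_iso_from_identity C Eo Em \<eta> \<longleftrightarrow>
     (\<forall>X\<in>Obj C. is_isomorphism C X (Eo X) (\<eta> X)) \<and>
     (\<forall>X\<in>Obj C. \<forall>Y\<in>Obj C. \<forall>f\<in>Hom C X Y.
        Comp C X (Eo X) (Eo Y) (Em X Y f) (\<eta> X) = Comp C X Y (Eo Y) (\<eta> Y) f)"

definition additively_equivalent :: "('o, 'm) precategory \<Rightarrow> ('p, 'n) precategory \<Rightarrow> bool" where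
  "additively_equivalent C D \<longleftrightarrow>
     (\<exists>Fo Fm Ho Hm \<eta> \<theta>.
        additive_functor C D Fo Fm \<and> additive_functor D C Ho Hm \<and>
        natural_iso_from_identity C (\<lambda>X. Ho (Fo X)) (\<lambda>X Y f. Hm (Fo X) (Fo Y) (Fm X Y f)) \<eta> \<and>
        natural_iso_from_identity D (\<lambda>V. Fo (Ho V)) (\<lambda>V W f. Fm (Ho V) (Ho W) (Hm V W f)) \<theta>)"

definition equivalent_abelian_categories ::
    "('o, 'm) precategory \<Rightarrow> ('p, 'n) precategory \<Rightarrow> bool" where
  "equivalent_abelian_categories C D \<longleftrightarrow>
     abelian_category C \<and> abelian_category D \<and> additively_equivalent C D"


section \<open>Categories of graded modules\<close>

text \<open>The objects are the graded modules whose underlying set is a subset of the type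
  \<open>'x\<close>, which plays the role of the universe.\<close>

definition Gr ::
    "('g, 'n) monoid_scheme \<Rightarrow> ('b, 'k) ring_scheme \<Rightarrow> ('g \<Rightarrow> 'b set) \<Rightarrow>
     (('x, 'b, 'g) graded_module, 'x \<Rightarrow> 'x) precategory" where
  "Gr G B \<B> =
     \<lparr>Obj = {X. graded_right_module G B \<B> X},
      Hom = graded_hom G B,
      Comp = (\<lambda>X Y Z g f. compose (carrier X) g f),
      Ident = (\<lambda>X. \<lambda>x\<in>carrier X. x),
      AddHom = (\<lambda>X Y f g. \<lambda>x\<in>carrier X. f x \<oplus>\<^bsub>Y\<^esub> g x),
      ZeroHom = (\<lambda>X Y. \<lambda>x\<in>carrier X. \<zero>\<^bsub>Y\<^esub>)\<rparr>"

definition Sigma_supp ::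
    "('g, 'n) monoid_scheme \<Rightarrow> ('b, 'k) ring_scheme \<Rightarrow> ('g \<Rightarrow> 'b set) \<Rightarrow> 'g set \<Rightarrow>
     (('x, 'b, 'g) graded_module, 'x \<Rightarrow> 'x) precategory" where
  "Sigma_supp G B \<B> S = full_subcategory (Gr G B \<B>) {X. Supp G X (homog X) \<subseteq> S}"

text \<open>The full subcategory of the category of graded modules over \<open>B\<close> with the
  \<open>G'\<close>-grading \<open>\<lambda>\<sigma>. \<B> (\<phi> \<sigma>)\<close>.\<close>

definition Sigma_tilde ::
    "('h, 'm) monoid_scheme \<Rightarrow> ('g, 'n) monoid_scheme \<Rightarrow> ('h \<Rightarrow> 'g) \<Rightarrow>
     ('b, 'k) ring_scheme \<Rightarrow> ('g \<Rightarrow> 'b set) \<Rightarrow>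
     (('x, 'b, 'h) graded_module, 'x \<Rightarrow> 'x) precategory" where
  "Sigma_tilde G' G \<phi> B \<B> =
     full_subcategory (Gr G' B (\<lambda>\<sigma>. \<B> (\<phi> \<sigma>)))
       {V. \<forall>\<sigma>\<in>carrier G'. \<forall>\<tau>\<in>carrier G'. \<phi> \<sigma> \<otimes>\<^bsub>G\<^esub> \<phi> \<tau> \<notin> \<phi> ` carrier G' \<longrightarrow>
             (\<forall>v\<in>homog V \<sigma>. \<forall>b\<in>\<B> (\<phi> \<tau>). v \<bullet>\<^bsub>V\<^esub> b = \<zero>\<^bsub>V\<^esub>)}"

end

theory Submission
  imports Defs
begin

text \<open>A decomposition of an abelian group into a direct sum amounts to a separating family of
  additive projections. In this form sums, submodules, quotients and regradings of graded modules
  need no finite sums, and a full subcategory of graded modules that is closed under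
  finite products, subobjects and quotients is seen to be abelian.

  The equivalence is regrading: \<open>X\<close> goes to the same module with degree \<open>\<sigma>\<close> part
  \<open>X\<^bsub>g \<phi>(\<sigma>)\<^esub>\<close>, and back by padding with \<open>0\<close> outside of \<open>g Im(\<phi>)\<close>; morphisms do not change.

  For the implication from (b) to (a) no group algebra is needed, which would be too large for the
  type \<open>'b\<close>: if \<open>x\<close>, \<open>y\<close> have degrees \<open>\<phi>(\<sigma>)\<close>, \<open>\<phi>(\<tau>)\<close> in an algebra with basis
  \<open>1, x, y, xy\<close>, then the degree of \<open>xy\<close> forces \<open>\<phi>(\<sigma>\<tau>) = \<phi>(\<sigma>)\<phi>(\<tau>)\<close>, and
  \<open>x\<close> would have two degrees if \<open>\<phi>\<close> were not injective.\<close>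

section \<open>Direct sums through projections\<close>

text \<open>The annihilation condition on \<open>V\<close> is the trace of the support condition on
  \<open>X\<close>: if \<open>\<phi>(\<sigma>)\<phi>(\<tau>)\<close> lies outside of
  \<open>Im(\<phi>)\<close>, then elements of degree \<open>g \<phi>(\<sigma>)\<close> times
  elements of \<open>\<B> (\<phi> \<tau>)\<close> land in a degree outside of
  \<open>g Im(\<phi>)\<close>, where \<open>X\<close> is 0. Conversely, padding by 0 produces a
  graded module because these products vanish in \<open>V\<close>; for all other pairs the law of a
  pseudomorphism matches the degrees. The obstacle is the universe. Objects are modules carried by
  subsets of one type \<open>'x\<close>, and the algebras in (b) by subsets of \<open>'b\<close>.
  Zero objects, quotients and biproducts must therefore be realised inside \<open>'x\<close>:
  quotients on coset representatives, biproducts through an injection of pairs, which exists because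
  \<open>'x\<close> is infinite. The same device carries the test algebra into \<open>'b\<close>,
  given an embedding of \<open>R\<close>. In the test algebra \<open>xx\<close>, \<open>yy\<close>
  and \<open>yx\<close> have to vanish, because the products of degrees belonging to them need not
  lie in \<open>Im(\<phi>)\<close>, while the support of an algebra in (b) has to.\<close>

lemma (in abelian_group) additive_subgroup_iff:
  "additive_subgroup H G \<longleftrightarrow>
     H \<subseteq> carrier G \<and> \<zero> \<in> H \<and> (\<forall>x\<in>H. \<forall>y\<in>H. x \<oplus> y \<in> H) \<and> (\<forall>x\<in>H. \<exists>y\<in>H. y \<oplus> x = \<zero>)"
  (is "_ \<longleftrightarrow> ?rhs")
proof
  assume "additive_subgroup H G"
  then interpret H: additive_subgroup H G .
  show ?rhs
    using H.a_subset l_neg by (auto intro!: bexI[of _ "\<ominus> _"])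
next
  assume r: ?rhs
  \<comment> \<open>On the right-hand side inverses are asserted to exist instead of being written
    with \<open>\<ominus>\<close>: the condition then refers only to carrier, zero and addition, and
    passes easily between records that share these operations.\<close>
  have "\<ominus> x \<in> H" if "x \<in> H" for x
    using r that by (metis minus_equality subsetD)
  then show "additive_subgroup H G"
    using r unfolding additive_subgroup_def subgroup_def by (simp add: a_inv_def)
qed

lemma (in abelian_group) minus_eq_zero_iff:
  assumes "x \<in> carrier G" "y \<in> carrier G"
  shows "x \<ominus> y = \<zero> \<longleftrightarrow> x = y"
  using assms by (metis a_minus_def add.inv_closed add.inv_equality add.inv_inv add.r_inv a_inv_def)

lemma (in abelian_group) minus_zero: "x \<in> carrier G \<Longrightarrow> x \<ominus> \<zero> = x"
  using minus_equality[of "\<zero>" "\<zero>"] by (simp add: a_minus_def)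

text \<open>\<open>finite_proj\<close> distinguishes a direct sum from a product, and
  \<open>proj_separate\<close> replaces the statement that \<open>x\<close> is the sum of its
  components, which \<open>proj_decomp\<close> recovers. Nothing is required of \<open>p i\<close>
  outside of \<open>I\<close> and the carrier, so the projections of one structure can be reused for
  another one with the same operations.\<close>

locale direct_sum = M?: abelian_group M for M (structure) +
  fixes I :: "'i set" and A :: "'i \<Rightarrow> 'a set" and p :: "'i \<Rightarrow> 'a \<Rightarrow> 'a"
  assumes summand: "i \<in> I \<Longrightarrow> additive_subgroup (A i) M"
    and proj_in: "\<lbrakk>i \<in> I; x \<in> carrier M\<rbrakk> \<Longrightarrow> p i x \<in> A i"
    and proj_add:
      "\<lbrakk>i \<in> I; x \<in> carrier M; y \<in> carrier M\<rbrakk> \<Longrightarrow> p i (x \<oplus> y) = p i x \<oplus> p i y"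
    and proj_summand: "\<lbrakk>i \<in> I; j \<in> I; x \<in> A i\<rbrakk> \<Longrightarrow> p j x = (if j = i then x else \<zero>)"
    and finite_proj: "x \<in> carrier M \<Longrightarrow> finite {i \<in> I. p i x \<noteq> \<zero>}"
    and proj_separate: "\<lbrakk>x \<in> carrier M; \<And>i. i \<in> I \<Longrightarrow> p i x = \<zero>\<rbrakk> \<Longrightarrow> x = \<zero>"
begin

lemma summand_carrier: "\<lbrakk>i \<in> I; x \<in> A i\<rbrakk> \<Longrightarrow> x \<in> carrier M"
  using summand additive_subgroup.a_Hcarr by fast

lemma summand_zero: "i \<in> I \<Longrightarrow> \<zero> \<in> A i"
  using summand by (simp add: additive_subgroup.zero_closed)

lemma summand_add: "\<lbrakk>i \<in> I; x \<in> A i; y \<in> A i\<rbrakk> \<Longrightarrow> x \<oplus> y \<in> A i"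
  using summand by (simp add: additive_subgroup.a_closed)

lemma proj_closed: "\<lbrakk>i \<in> I; x \<in> carrier M\<rbrakk> \<Longrightarrow> p i x \<in> carrier M"
  using proj_in summand_carrier by blast

lemma proj_zero: "i \<in> I \<Longrightarrow> p i \<zero> = \<zero>"
  using proj_summand[OF _ _ summand_zero] by (simp split: if_splits)

lemma proj_minus: "\<lbrakk>i \<in> I; x \<in> carrier M; y \<in> carrier M\<rbrakk> \<Longrightarrow> p i (x \<ominus> y) = p i x \<ominus> p i y"
proof -
  assume i: "i \<in> I" and xy: "x \<in> carrier M" "y \<in> carrier M"
  have "p i (\<ominus> y) \<oplus> p i y = \<zero>"
    using i xy by (simp add: proj_add[symmetric] l_neg proj_zero)
  then have "p i (\<ominus> y) = \<ominus> p i y"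
    using i xy by (simp add: minus_equality proj_closed)
  then show ?thesis
    using i xy by (simp add: a_minus_def proj_add)
qed

lemma proj_finsum:
  assumes "finite F" "F \<subseteq> I" "\<And>i. i \<in> F \<Longrightarrow> c i \<in> A i" "j \<in> I"
  shows "p j (\<Oplus>i\<in>F. c i) = (if j \<in> F then c j else \<zero>)"
  using assms
proof (induction F rule: finite_induct)
  case (insert k F)
  then have c: "c \<in> F \<rightarrow> carrier M" and "c k \<in> carrier M"
    using summand_carrier by auto
  moreover have "c j \<in> carrier M" if "j \<in> F"
    using c that by auto
  ultimately show ?case
    using insert proj_summand[of k j "c k"]
    by (auto simp: proj_add)
qed (simp add: proj_zero)

text \<open>The difference of the two sides is killed by every projection, hence zero by
  \<open>proj_separate\<close>.\<close>

lemma proj_decomp: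
  assumes x: "x \<in> carrier M"
  shows "x = (\<Oplus>i\<in>{i \<in> I. p i x \<noteq> \<zero>}. p i x)" (is "x = ?y")
proof -
  have y: "?y \<in> carrier M"
    using x proj_closed by (intro finsum_closed) auto
  have "p j ?y = p j x" if j: "j \<in> I" for j
  proof -
    have "p j ?y = (if j \<in> {i \<in> I. p i x \<noteq> \<zero>} then p j x else \<zero>)"
      using j finite_proj[OF x] proj_in[OF _ x] by (intro proj_finsum) auto
    then show ?thesis
      using j by simp
  qed
  then have "p j (x \<ominus> ?y) = \<zero>" if "j \<in> I" for j
    using x y that proj_closed by (simp add: proj_minus) (simp add: a_minus_def r_neg)
  then have "x \<ominus> ?y = \<zero>"
    using x y by (intro proj_separate[OF minus_closed])
  then show ?thesis
    using x y by (simp add: minus_eq_zero_iff)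
qed

text \<open>Only the components of the given \<open>x\<close> have to satisfy \<open>P\<close>, not
  all homogeneous elements; this admits predicates that are known just for the components of one
  element.\<close>

lemma proj_induct [consumes 1, case_names zero proj add]:
  assumes x: "x \<in> carrier M"
    and zero: "P \<zero>"
    and proj: "\<And>i. i \<in> I \<Longrightarrow> P (p i x)"
    and add: "\<And>y z. \<lbrakk>y \<in> carrier M; z \<in> carrier M; P y; P z\<rbrakk> \<Longrightarrow> P (y \<oplus> z)"
  shows "P x"
proof -
  have "P (\<Oplus>i\<in>F. p i x)" if "finite F" "F \<subseteq> I" for F
    using that
  proof (induction F rule: finite_induct)
    case (insert k F)
    then have "(\<lambda>i. p i x) \<in> F \<rightarrow> carrier M" "p k x \<in> carrier M"
      using x proj_closed by auto
    moreover have "P (p k x)" "P (\<Oplus>i\<in>F. p i x)"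
      using insert proj by auto
    ultimately show ?case
      using insert.hyps by (simp add: add)
  qed (simp add: zero)
  from this[of "{i \<in> I. p i x \<noteq> \<zero>}"] show ?thesis
    using proj_decomp[OF x] finite_proj[OF x] by auto
qed

lemma internal_direct_sum: "internal_direct_sum M I A"
  unfolding internal_direct_sum_def
proof (intro conjI ballI)
  fix x assume x: "x \<in> carrier M"
  show "\<exists>!c. c \<in> (\<Pi>\<^sub>E i\<in>I. A i) \<and> finite {i \<in> I. c i \<noteq> \<zero>} \<and>
      x = (\<Oplus>i\<in>{i \<in> I. c i \<noteq> \<zero>}. c i)"
  proof (rule ex1I)
  let ?c = "\<lambda>i\<in>I. p i x"
  have *: "{i \<in> I. ?c i \<noteq> \<zero>} = {i \<in> I. p i x \<noteq> \<zero>}" by auto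
  have "(\<Oplus>i\<in>{i \<in> I. p i x \<noteq> \<zero>}. ?c i) = (\<Oplus>i\<in>{i \<in> I. p i x \<noteq> \<zero>}. p i x)"
    using x proj_closed by (intro finsum_cong') auto
  then show "?c \<in> (\<Pi>\<^sub>E i\<in>I. A i) \<and> finite {i \<in> I. ?c i \<noteq> \<zero>} \<and>
      x = (\<Oplus>i\<in>{i \<in> I. ?c i \<noteq> \<zero>}. ?c i)"
    unfolding * using x proj_in finite_proj proj_decomp by auto
  next
  fix c
  assume c: "c \<in> (\<Pi>\<^sub>E i\<in>I. A i) \<and> finite {i \<in> I. c i \<noteq> \<zero>} \<and>
      x = (\<Oplus>i\<in>{i \<in> I. c i \<noteq> \<zero>}. c i)"
  have "p j x = c j" if "j \<in> I" for j
    using that c proj_finsum[of "{i \<in> I. c i \<noteq> \<zero>}" c j] PiE_mem[of c I A] by auto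
  then show "c = (\<lambda>i\<in>I. p i x)"
    using c by (intro PiE_ext[of c I A]) (auto simp: x proj_in)
  qed
qed (rule summand)

end

text \<open>From left to right, \<open>p i x\<close> is the coefficient at \<open>i\<close> of the
  unique decomposition of \<open>x\<close>. Additivity and the values on summands follow by
  exhibiting some decomposition and appealing to uniqueness.\<close>

lemma internal_direct_sum_iff:
  assumes "abelian_group M"
  shows "internal_direct_sum M I A \<longleftrightarrow> (\<exists>p. direct_sum M I A p)"
proof
  show "\<exists>p. direct_sum M I A p \<Longrightarrow> internal_direct_sum M I A"
    by (auto dest: direct_sum.internal_direct_sum)
next
  interpret abelian_group M by fact
  assume ds: "internal_direct_sum M I A"
  then have A: "additive_subgroup (A i) M" if "i \<in> I" for i
    using that by (auto simp: internal_direct_sum_def)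
  note A_carrier = additive_subgroup.a_Hcarr[OF A]
    and A_zero = additive_subgroup.zero_closed[OF A]
    and A_add = additive_subgroup.a_closed[OF A]
  define D where "D x c \<longleftrightarrow> c \<in> (\<Pi>\<^sub>E i\<in>I. A i) \<and> finite {i \<in> I. c i \<noteq> \<zero>\<^bsub>M\<^esub>} \<and>
      x = (\<Oplus>\<^bsub>M\<^esub>i\<in>{i \<in> I. c i \<noteq> \<zero>\<^bsub>M\<^esub>}. c i)" for x c
  have D: "\<exists>!c. D x c" if "x \<in> carrier M" for x
    using ds that by (auto simp: internal_direct_sum_def D_def)
  \<comment> \<open>A finite sum of members of the summands is decomposed by its own terms: terms
    that happen to vanish drop out of the support, and indices in \<open>I\<close> outside of
    \<open>F\<close> are filled with zero.\<close>
  have sum_D: "D (\<Oplus>\<^bsub>M\<^esub>i\<in>F. c i) (\<lambda>i\<in>I. if i \<in> F then c i else \<zero>\<^bsub>M\<^esub>)"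
    if F: "finite F" "F \<subseteq> I" and c: "\<And>i. i \<in> F \<Longrightarrow> c i \<in> A i" for F c
  proof -
    let ?c = "\<lambda>i\<in>I. if i \<in> F then c i else \<zero>\<^bsub>M\<^esub>"
    have "{i \<in> I. ?c i \<noteq> \<zero>\<^bsub>M\<^esub>} \<subseteq> F" by auto
    moreover have "(\<Oplus>\<^bsub>M\<^esub>i\<in>{i \<in> I. ?c i \<noteq> \<zero>\<^bsub>M\<^esub>}. ?c i) = (\<Oplus>\<^bsub>M\<^esub>i\<in>F. c i)"
      using F c A_carrier
      by (intro add.finprod_mono_neutral_cong_left) (auto split: if_splits)
    moreover have "?c \<in> (\<Pi>\<^sub>E i\<in>I. A i)"
      using c A_zero by auto
    ultimately show ?thesis
      unfolding D_def using F(1) finite_subset by metis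
  qed
  define p where "p i x = (THE c. D x c) i" for i x
  have p_eq: "p i x = c i" if "x \<in> carrier M" "D x c" for x c i
    using the1_equality[of "D x" c] D that by (simp add: p_def)
  have D_p: "D x (\<lambda>i. p i x)" if "x \<in> carrier M" for x
    using theI'[OF D[OF that]] by (simp add: p_def)
  have p_in: "p i x \<in> A i" if "i \<in> I" "x \<in> carrier M" for i x
    using D_p[OF that(2)] that(1) by (auto simp: D_def)
  have fin: "finite {i \<in> I. p i x \<noteq> \<zero>\<^bsub>M\<^esub>}" if "x \<in> carrier M" for x
    using D_p[OF that] by (auto simp: D_def)
  have decomp: "x = (\<Oplus>\<^bsub>M\<^esub>i\<in>{i \<in> I. p i x \<noteq> \<zero>\<^bsub>M\<^esub>}. p i x)" if "x \<in> carrier M" for x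
    using D_p[OF that] by (auto simp: D_def)
  have "direct_sum M I A p"
  proof (intro direct_sum.intro direct_sum_axioms.intro)
    fix i x y assume i: "i \<in> I" and x: "x \<in> carrier M" and y: "y \<in> carrier M"
    \<comment> \<open>A common finite index set for both elements: over it the two decompositions
      can be added term by term, even if some terms cancel.\<close>
    let ?F = "{i \<in> I. p i x \<noteq> \<zero>\<^bsub>M\<^esub>} \<union> {i \<in> I. p i y \<noteq> \<zero>\<^bsub>M\<^esub>}"
    have c: "p i x \<in> carrier M" "p i y \<in> carrier M" if "i \<in> I" for i
      using that x y p_in A_carrier by blast+
    have F: "finite ?F" using fin x y by simp
    have "x = (\<Oplus>\<^bsub>M\<^esub>i\<in>?F. p i x)" "y = (\<Oplus>\<^bsub>M\<^esub>i\<in>?F. p i y)"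
      by (subst decomp[OF x] decomp[OF y],
          intro add.finprod_mono_neutral_cong_left, use F c in auto)+
    then have "x \<oplus>\<^bsub>M\<^esub> y = (\<Oplus>\<^bsub>M\<^esub>i\<in>?F. p i x \<oplus>\<^bsub>M\<^esub> p i y)"
      using c by (subst finsum_addf) auto
    moreover have "D (\<Oplus>\<^bsub>M\<^esub>i\<in>?F. p i x \<oplus>\<^bsub>M\<^esub> p i y)
        (\<lambda>i\<in>I. if i \<in> ?F then p i x \<oplus>\<^bsub>M\<^esub> p i y else \<zero>\<^bsub>M\<^esub>)"
      using F p_in x y A_add by (intro sum_D) auto
    ultimately have "D (x \<oplus>\<^bsub>M\<^esub> y) (\<lambda>i\<in>I. if i \<in> ?F then p i x \<oplus>\<^bsub>M\<^esub> p i y else \<zero>\<^bsub>M\<^esub>)"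
      by (simp only:)
    from p_eq[OF add.m_closed[OF x y] this, of i] show "p i (x \<oplus>\<^bsub>M\<^esub> y) = p i x \<oplus>\<^bsub>M\<^esub> p i y"
      using i by auto
  next
    fix i j x assume ij: "i \<in> I" "j \<in> I" and x: "x \<in> A i"
    have "D (\<Oplus>\<^bsub>M\<^esub>j\<in>{i}. x) (\<lambda>j\<in>I. if j \<in> {i} then x else \<zero>\<^bsub>M\<^esub>)"
      using ij x by (intro sum_D) auto
    then have "D x (\<lambda>j\<in>I. if j \<in> {i} then x else \<zero>\<^bsub>M\<^esub>)"
      using A_carrier[OF ij(1) x] by simp
    from p_eq[OF A_carrier[OF ij(1) x] this, of j]
    show "p j x = (if j = i then x else \<zero>\<^bsub>M\<^esub>)"
      using ij by simp
  next
    fix x assume "x \<in> carrier M" "\<And>i. i \<in> I \<Longrightarrow> p i x = \<zero>\<^bsub>M\<^esub>"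
    then have "x = (\<Oplus>\<^bsub>M\<^esub>i\<in>{}. p i x)"
      using decomp[of x] by (auto simp: Collect_conv_if cong: conj_cong)
    then show "x = \<zero>\<^bsub>M\<^esub>" by simp
  qed (use assms A p_in fin in auto)
  then show "\<exists>p. direct_sum M I A p" by blast
qed

text \<open>Both sides are additive in \<open>x\<close>, and on a component of \<open>x\<close> each
  is either the image of this component or zero; induction over components does the rest.\<close>

lemma additive_proj:
  assumes "direct_sum M I A p" "direct_sum N I A' p'"
    and f: "\<And>x. x \<in> carrier M \<Longrightarrow> f x \<in> carrier N"
      "\<And>x y. \<lbrakk>x \<in> carrier M; y \<in> carrier M\<rbrakk> \<Longrightarrow> f (x \<oplus>\<^bsub>M\<^esub> y) = f x \<oplus>\<^bsub>N\<^esub> f y"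
      "\<And>i x. \<lbrakk>i \<in> I; x \<in> A i\<rbrakk> \<Longrightarrow> f x \<in> A' i"
    and i: "i \<in> I" and x: "x \<in> carrier M"
  shows "f (p i x) = p' i (f x)"
proof -
  interpret M: direct_sum M I A p by fact
  interpret N: direct_sum N I A' p' by fact
  have f0: "f \<zero>\<^bsub>M\<^esub> = \<zero>\<^bsub>N\<^esub>"
    using f(2)[of "\<zero>\<^bsub>M\<^esub>" "\<zero>\<^bsub>M\<^esub>"] f(1) N.add.l_cancel_one[of "f \<zero>\<^bsub>M\<^esub>" "f \<zero>\<^bsub>M\<^esub>"] by simp
  show ?thesis
    using x
  proof (rule M.proj_induct)
    show "f (p i \<zero>\<^bsub>M\<^esub>) = p' i (f \<zero>\<^bsub>M\<^esub>)"
      using i by (simp add: M.proj_zero N.proj_zero f0)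
  next
    fix j assume j: "j \<in> I"
    have "p j x \<in> A j" using j x by (rule M.proj_in)
    then show "f (p i (p j x)) = p' i (f (p j x))"
      using i j M.proj_summand[of j i "p j x"] N.proj_summand[of j i "f (p j x)"] f(3)
      by (simp add: f0)
  next
    fix y z assume "y \<in> carrier M" "z \<in> carrier M"
      "f (p i y) = p' i (f y)" "f (p i z) = p' i (f z)"
    then show "f (p i (y \<oplus>\<^bsub>M\<^esub> z)) = p' i (f (y \<oplus>\<^bsub>M\<^esub> z))"
      using i by (simp add: f(1,2) M.proj_add N.proj_add M.proj_closed)
  qed
qed

lemma direct_sum_reindex:
  assumes M: "abelian_group M" and inj: "inj_on \<psi> J" and sub: "\<psi> ` J \<subseteq> I"
    and zero: "\<And>i. i \<in> I - \<psi> ` J \<Longrightarrow> A i = {\<zero>\<^bsub>M\<^esub>}"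
    and eq: "\<And>j. j \<in> J \<Longrightarrow> A' j = A (\<psi> j)"
  shows "internal_direct_sum M I A \<longleftrightarrow> internal_direct_sum M J A'"
  unfolding internal_direct_sum_iff[OF M]
proof safe
  fix p assume "direct_sum M I A p"
  then interpret direct_sum M I A p .
  have *: "p i x = \<zero>\<^bsub>M\<^esub>" if "i \<in> I - \<psi> ` J" "x \<in> carrier M" for i x
    using proj_in[of i x] zero that by auto
  have I: "\<psi> j \<in> I" if "j \<in> J" for j using sub that by auto
  have "direct_sum M J A' (\<lambda>j. p (\<psi> j))"
  proof (intro direct_sum.intro direct_sum_axioms.intro)
    fix x assume x: "x \<in> carrier M"
    have "\<psi> ` {j \<in> J. p (\<psi> j) x \<noteq> \<zero>\<^bsub>M\<^esub>} \<subseteq> {i \<in> I. p i x \<noteq> \<zero>\<^bsub>M\<^esub>}"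
      using sub by auto
    then have "finite (\<psi> ` {j \<in> J. p (\<psi> j) x \<noteq> \<zero>\<^bsub>M\<^esub>})"
      using finite_proj[OF x] by (rule finite_subset)
    then show "finite {j \<in> J. p (\<psi> j) x \<noteq> \<zero>\<^bsub>M\<^esub>}"
      by (rule finite_imageD) (rule inj_on_subset[OF inj], auto)
  next
    fix x assume x: "x \<in> carrier M" and "\<And>j. j \<in> J \<Longrightarrow> p (\<psi> j) x = \<zero>\<^bsub>M\<^esub>"
    then have "p i x = \<zero>\<^bsub>M\<^esub>" if "i \<in> I" for i
      using * that by blast
    then show "x = \<zero>\<^bsub>M\<^esub>"
      by (rule proj_separate[OF x])
  next
    fix i j x assume "i \<in> J" "j \<in> J" "x \<in> A' i"
    then show "p (\<psi> j) x = (if j = i then x else \<zero>\<^bsub>M\<^esub>)"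
      using I eq proj_summand[of "\<psi> i" "\<psi> j" x] inj by (auto simp: inj_on_def)
  qed (use M I eq summand proj_in proj_add in auto)
  then show "\<exists>p. direct_sum M J A' p" by blast
next
  fix p assume "direct_sum M J A' p"
  then interpret direct_sum M J A' p .
  \<comment> \<open>Zero outside of the image; inside, the index is pulled back, unambiguously
    because \<open>\<psi>\<close> is injective.\<close>
  let ?q = "\<lambda>i x. if i \<in> \<psi> ` J then p (inv_into J \<psi> i) x else \<zero>\<^bsub>M\<^esub>"
  have inv: "inv_into J \<psi> (\<psi> j) = j" if "j \<in> J" for j
    using inj that by simp
  have "additive_subgroup {\<zero>\<^bsub>M\<^esub>} M"
    by (subst additive_subgroup_iff) auto
  then have A: "additive_subgroup (A i) M" if "i \<in> I" for i
    using that zero[of i] summand eq by (cases "i \<in> \<psi> ` J") auto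
  have "direct_sum M I A ?q"
  proof (intro direct_sum.intro direct_sum_axioms.intro)
    fix x assume x: "x \<in> carrier M"
    have "{i \<in> I. ?q i x \<noteq> \<zero>\<^bsub>M\<^esub>} \<subseteq> \<psi> ` {j \<in> J. p j x \<noteq> \<zero>\<^bsub>M\<^esub>}"
      by (auto simp: inv)
    then show "finite {i \<in> I. ?q i x \<noteq> \<zero>\<^bsub>M\<^esub>}"
      by (rule finite_subset) (simp add: finite_proj[OF x])
  next
    fix x assume x: "x \<in> carrier M" and q: "\<And>i. i \<in> I \<Longrightarrow> ?q i x = \<zero>\<^bsub>M\<^esub>"
    have "p j x = \<zero>\<^bsub>M\<^esub>" if "j \<in> J" for j
      using q[of "\<psi> j"] that sub by (auto simp: inv)
    then show "x = \<zero>\<^bsub>M\<^esub>"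
      using x by (rule proj_separate[rotated])
  next
    fix i j x assume "i \<in> I" "j \<in> I" "x \<in> A i"
    then show "?q j x = (if j = i then x else \<zero>\<^bsub>M\<^esub>)"
      using zero[of i] inj proj_summand
      by (cases "i \<in> \<psi> ` J") (auto simp: inv proj_zero eq inj_on_def)
  qed (use M A zero in \<open>auto simp: inv eq[symmetric] proj_in proj_add\<close>)
  then show "\<exists>p. direct_sum M I A p" by blast
qed

section \<open>Constructions on graded modules\<close>

lemma graded_right_moduleD:
  assumes "graded_right_module G B \<B> X"
  shows "right_module B X" "abelian_group X"
    and "\<lbrakk>g \<in> carrier G; h \<in> carrier G; x \<in> homog X g; b \<in> \<B> h\<rbrakk> \<Longrightarrow>
      x \<bullet>\<^bsub>X\<^esub> b \<in> homog X (g \<otimes>\<^bsub>G\<^esub> h)"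
  using assms by (auto simp: graded_right_module_def right_module_def)

lemma graded_right_moduleI:
  assumes "right_module B X" "direct_sum X (carrier G) (homog X) p"
    and "\<And>g h x b. \<lbrakk>g \<in> carrier G; h \<in> carrier G; x \<in> homog X g; b \<in> \<B> h\<rbrakk> \<Longrightarrow>
      x \<bullet>\<^bsub>X\<^esub> b \<in> homog X (g \<otimes>\<^bsub>G\<^esub> h)"
  shows "graded_right_module G B \<B> X"
  using assms by (auto simp: graded_right_module_def dest: direct_sum.internal_direct_sum)

text \<open>By uniqueness of decompositions the projections are determined at degrees in
  \<open>G\<close> and elements of \<open>X\<close>; the choice only fixes their values
  elsewhere.\<close>

definition hproj :: "('g, 'n) monoid_scheme \<Rightarrow> ('x, 'b, 'g) graded_module \<Rightarrow> 'g \<Rightarrow> 'x \<Rightarrow> 'x" where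
  "hproj G X = (SOME p. direct_sum X (carrier G) (homog X) p)"

lemma direct_sum_hproj:
  assumes "graded_right_module G B \<B> X"
  shows "direct_sum X (carrier G) (homog X) (hproj G X)"
proof -
  have "\<exists>p. direct_sum X (carrier G) (homog X) p"
    using assms graded_right_moduleD(2)[OF assms]
    by (simp add: graded_right_module_def internal_direct_sum_iff)
  then show ?thesis
    unfolding hproj_def by (rule someI_ex)
qed

context right_module
begin

lemma zero_ract: "b \<in> carrier B \<Longrightarrow> \<zero>\<^bsub>X\<^esub> \<bullet>\<^bsub>X\<^esub> b = \<zero>\<^bsub>X\<^esub>"
  using ract_l_distr[of "\<zero>\<^bsub>X\<^esub>" "\<zero>\<^bsub>X\<^esub>" b] ract_closed[of "\<zero>\<^bsub>X\<^esub>" b]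
  by simp

lemma minus_ract:
  assumes "x \<in> carrier X" "y \<in> carrier X" "b \<in> carrier B"
  shows "(x \<ominus>\<^bsub>X\<^esub> y) \<bullet>\<^bsub>X\<^esub> b = x \<bullet>\<^bsub>X\<^esub> b \<ominus>\<^bsub>X\<^esub> y \<bullet>\<^bsub>X\<^esub> b"
proof -
  have "(\<ominus>\<^bsub>X\<^esub> y) \<bullet>\<^bsub>X\<^esub> b \<oplus>\<^bsub>X\<^esub> y \<bullet>\<^bsub>X\<^esub> b = \<zero>\<^bsub>X\<^esub>"
    using assms by (simp add: ract_l_distr[symmetric] X.l_neg zero_ract)
  then have "(\<ominus>\<^bsub>X\<^esub> y) \<bullet>\<^bsub>X\<^esub> b = \<ominus>\<^bsub>X\<^esub> (y \<bullet>\<^bsub>X\<^esub> b)"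
    using assms by (simp add: X.minus_equality ract_closed)
  then show ?thesis
    using assms by (simp add: a_minus_def ract_l_distr)
qed

end

section \<open>Graded homomorphisms and graded submodules\<close>

lemma graded_homD:
  assumes "f \<in> graded_hom G B X Y"
  shows "f \<in> carrier X \<rightarrow>\<^sub>E carrier Y"
    and "x \<in> carrier X \<Longrightarrow> f x \<in> carrier Y"
    and "\<lbrakk>x \<in> carrier X; y \<in> carrier X\<rbrakk> \<Longrightarrow> f (x \<oplus>\<^bsub>X\<^esub> y) = f x \<oplus>\<^bsub>Y\<^esub> f y"
    and "\<lbrakk>x \<in> carrier X; b \<in> carrier B\<rbrakk> \<Longrightarrow> f (x \<bullet>\<^bsub>X\<^esub> b) = f x \<bullet>\<^bsub>Y\<^esub> b"
    and "\<lbrakk>g \<in> carrier G; x \<in> homog X g\<rbrakk> \<Longrightarrow> f x \<in> homog Y g"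
  using assms by (auto simp: graded_hom_def)

lemma graded_homI:
  assumes "f \<in> carrier X \<rightarrow>\<^sub>E carrier Y"
    and "\<And>x y. \<lbrakk>x \<in> carrier X; y \<in> carrier X\<rbrakk> \<Longrightarrow> f (x \<oplus>\<^bsub>X\<^esub> y) = f x \<oplus>\<^bsub>Y\<^esub> f y"
    and "\<And>x b. \<lbrakk>x \<in> carrier X; b \<in> carrier B\<rbrakk> \<Longrightarrow> f (x \<bullet>\<^bsub>X\<^esub> b) = f x \<bullet>\<^bsub>Y\<^esub> b"
    and "\<And>g x. \<lbrakk>g \<in> carrier G; x \<in> homog X g\<rbrakk> \<Longrightarrow> f x \<in> homog Y g"
  shows "f \<in> graded_hom G B X Y"
  using assms by (auto simp: graded_hom_def)

lemma graded_hom_eqI: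
  assumes "f \<in> graded_hom G B X Y" "f' \<in> graded_hom G B X Y"
    and "\<And>x. x \<in> carrier X \<Longrightarrow> f x = f' x"
  shows "f = f'"
  using assms(1,2)[THEN graded_homD(1)] assms(3) by (rule PiE_ext)

lemma graded_hom_zero:
  assumes "abelian_group X" "abelian_group Y" "f \<in> graded_hom G B X Y"
  shows "f \<zero>\<^bsub>X\<^esub> = \<zero>\<^bsub>Y\<^esub>"
proof -
  interpret X: abelian_group X by fact
  interpret Y: abelian_group Y by fact
  show ?thesis
    using graded_homD(3)[OF assms(3), of "\<zero>\<^bsub>X\<^esub>" "\<zero>\<^bsub>X\<^esub>"]
      graded_homD(2)[OF assms(3), of "\<zero>\<^bsub>X\<^esub>"] by simp
qed

lemma graded_hom_minus:
  assumes X: "abelian_group X" and Y: "abelian_group Y" and f: "f \<in> graded_hom G B X Y"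
    and x: "x \<in> carrier X" and y: "y \<in> carrier X"
  shows "f (x \<ominus>\<^bsub>X\<^esub> y) = f x \<ominus>\<^bsub>Y\<^esub> f y"
proof -
  interpret X: abelian_group X by fact
  interpret Y: abelian_group Y by fact
  note [simp] = graded_homD[OF f] graded_hom_zero[OF X Y f]
  have "f (\<ominus>\<^bsub>X\<^esub> y) \<oplus>\<^bsub>Y\<^esub> f y = \<zero>\<^bsub>Y\<^esub>"
    using y by (simp add: X.l_neg flip: graded_homD(3)[OF f])
  then have "f (\<ominus>\<^bsub>X\<^esub> y) = \<ominus>\<^bsub>Y\<^esub> f y"
    using y by (simp add: Y.minus_equality)
  then show ?thesis
    using x y by (simp add: a_minus_def)
qed

lemma graded_hom_proj:
  assumes X: "graded_right_module G B \<B> X" and Y: "graded_right_module G B \<B> Y"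
    and f: "f \<in> graded_hom G B X Y" and "g \<in> carrier G" "x \<in> carrier X"
  shows "f (hproj G X g x) = hproj G Y g (f x)"
  using direct_sum_hproj[OF X] direct_sum_hproj[OF Y] graded_homD(2,3,5)[OF f] assms(4,5)
  by (rule additive_proj)

text \<open>Homogeneity of \<open>N\<close> is expressed as stability under the projections. This is
  equivalent to \<open>N\<close> being the sum of its intersections with the
  \<open>homog X g\<close>, but involves no sums.\<close>

definition graded_submodule ::
    "('g, 'n) monoid_scheme \<Rightarrow> ('b, 'k) ring_scheme \<Rightarrow> ('x, 'b, 'g) graded_module \<Rightarrow> 'x set \<Rightarrow> bool" where
  "graded_submodule G B X N \<longleftrightarrow>
     additive_subgroup N X \<and> (\<forall>x\<in>N. \<forall>b\<in>carrier B. x \<bullet>\<^bsub>X\<^esub> b \<in> N) \<and>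
     (\<forall>g\<in>carrier G. \<forall>x\<in>N. hproj G X g x \<in> N)"

text \<open>Since \<open>f\<close> commutes with the projections, its kernel is stable under them;
  the same reason serves for the image below.\<close>

lemma graded_submodule_kernel:
  assumes X: "graded_right_module G B \<B> X" and Y: "graded_right_module G B \<B> Y"
    and f: "f \<in> graded_hom G B X Y"
  shows "graded_submodule G B X {x \<in> carrier X. f x = \<zero>\<^bsub>Y\<^esub>}"
proof -
  interpret X: right_module B X by (rule graded_right_moduleD[OF X])
  interpret Y: right_module B Y by (rule graded_right_moduleD[OF Y])
  interpret pX: direct_sum X "carrier G" "homog X" "hproj G X" by (rule direct_sum_hproj[OF X])
  interpret pY: direct_sum Y "carrier G" "homog Y" "hproj G Y" by (rule direct_sum_hproj[OF Y])
  note f0 = graded_hom_zero[OF X.X.abelian_group_axioms Y.X.abelian_group_axioms f]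
  note fm = graded_hom_minus[OF X.X.abelian_group_axioms Y.X.abelian_group_axioms f]
  note fp = graded_hom_proj[OF X Y f]
  have "\<exists>y\<in>carrier X. f y = \<zero>\<^bsub>Y\<^esub> \<and> y \<oplus>\<^bsub>X\<^esub> x = \<zero>\<^bsub>X\<^esub>"
    if "x \<in> carrier X" "f x = \<zero>\<^bsub>Y\<^esub>" for x
    using that fm[of "\<zero>\<^bsub>X\<^esub>" x] by (intro bexI[of _ "\<ominus>\<^bsub>X\<^esub> x"]) (auto simp: f0 a_minus_def X.X.l_neg)
  then have "additive_subgroup {x \<in> carrier X. f x = \<zero>\<^bsub>Y\<^esub>} X"
    by (subst X.X.additive_subgroup_iff) (auto simp: f0 graded_homD[OF f])
  then show ?thesis
    by (auto simp: graded_submodule_def X.ract_closed graded_homD[OF f] Y.zero_ract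
        pX.proj_closed pY.proj_zero fp)
qed

lemma graded_submodule_image:
  assumes X: "graded_right_module G B \<B> X" and Y: "graded_right_module G B \<B> Y"
    and f: "f \<in> graded_hom G B X Y"
  shows "graded_submodule G B Y (f ` carrier X)"
proof -
  interpret X: right_module B X by (rule graded_right_moduleD[OF X])
  interpret Y: right_module B Y by (rule graded_right_moduleD[OF Y])
  interpret pX: direct_sum X "carrier G" "homog X" "hproj G X" by (rule direct_sum_hproj[OF X])
  note f0 = graded_hom_zero[OF X.X.abelian_group_axioms Y.X.abelian_group_axioms f]
  note fp = graded_hom_proj[OF X Y f]
  have "\<exists>y\<in>carrier X. f y \<oplus>\<^bsub>Y\<^esub> f x = \<zero>\<^bsub>Y\<^esub>" if "x \<in> carrier X" for x
    using that
    by (intro bexI[of _ "\<ominus>\<^bsub>X\<^esub> x"]) (auto simp: f0 X.X.l_neg simp flip: graded_homD(3)[OF f])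
  then have "additive_subgroup (f ` carrier X) Y"
    by (subst Y.X.additive_subgroup_iff)
      (auto simp: graded_homD(2)[OF f] f0 simp flip: graded_homD(3)[OF f]
        intro!: image_eqI[of _ f "\<zero>\<^bsub>X\<^esub>"])
  then show ?thesis
    by (auto simp: graded_submodule_def X.ract_closed pX.proj_closed
        simp flip: graded_homD(4)[OF f] fp)
qed

section \<open>Submodules, images and products as graded modules\<close>

definition restrict_module ::
    "('x, 'b, 'g) graded_module \<Rightarrow> 'x set \<Rightarrow> ('x, 'b, 'g) graded_module" where
  "restrict_module X N = X\<lparr>carrier := N, homog := \<lambda>g. homog X g \<inter> N\<rparr>"

lemma restrict_module_simps [simp]:
  "carrier (restrict_module X N) = N" "add (restrict_module X N) = add X"
  "zero (restrict_module X N) = zero X" "ract (restrict_module X N) = ract X"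
  "homog (restrict_module X N) g = homog X g \<inter> N"
  by (simp_all add: restrict_module_def)

lemma graded_restrict_module:
  assumes X: "graded_right_module G B \<B> X" and N: "graded_submodule G B X N"
    and \<B>: "\<forall>g\<in>carrier G. \<B> g \<subseteq> carrier B"
  shows "graded_right_module G B \<B> (restrict_module X N)" (is "graded_right_module _ _ _ ?N")
proof -
  interpret X: right_module B X by (rule graded_right_moduleD[OF X])
  interpret p: direct_sum X "carrier G" "homog X" "hproj G X" by (rule direct_sum_hproj[OF X])
  have N_iff: "N \<subseteq> carrier X \<and> \<zero>\<^bsub>X\<^esub> \<in> N \<and> (\<forall>x\<in>N. \<forall>y\<in>N. x \<oplus>\<^bsub>X\<^esub> y \<in> N) \<and>
      (\<forall>x\<in>N. \<exists>y\<in>N. y \<oplus>\<^bsub>X\<^esub> x = \<zero>\<^bsub>X\<^esub>)"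
    using N X.X.additive_subgroup_iff by (auto simp: graded_submodule_def)
  have carr: "x \<in> carrier X" if "x \<in> N" for x using N_iff that by blast
  have ract: "x \<bullet>\<^bsub>X\<^esub> b \<in> N" if "x \<in> N" "b \<in> carrier B" for x b
    using N that by (auto simp: graded_submodule_def)
  have proj: "hproj G X g x \<in> N" if "g \<in> carrier G" "x \<in> N" for g x
    using N that by (auto simp: graded_submodule_def)
  have ab: "abelian_group ?N"
    using N_iff by (intro abelian_groupI) (auto simp: carr X.X.a_ac)
  interpret N: abelian_group ?N by (rule ab)
  have "right_module B ?N"
    by (intro right_module.intro ab X.B.ring_axioms right_module_axioms.intro)
      (auto simp: carr ract X.ract_l_distr X.ract_r_distr X.ract_assoc X.ract_one)
  \<comment> \<open>The projections of \<open>X\<close> serve for \<open>N\<close> as well, since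
    they map \<open>N\<close> to itself.\<close>
  moreover have "direct_sum ?N (carrier G) (homog ?N) (hproj G X)"
  proof (intro direct_sum.intro ab direct_sum_axioms.intro)
    fix g assume g: "g \<in> carrier G"
    have "\<exists>y\<in>homog X g \<inter> N. y \<oplus>\<^bsub>X\<^esub> x = \<zero>\<^bsub>X\<^esub>" if x: "x \<in> homog X g \<inter> N" for x
    proof -
      obtain y where y: "y \<in> N" "y \<oplus>\<^bsub>X\<^esub> x = \<zero>\<^bsub>X\<^esub>"
        using N_iff x by blast
      obtain z where z: "z \<in> homog X g" "z \<oplus>\<^bsub>X\<^esub> x = \<zero>\<^bsub>X\<^esub>"
        using p.summand[OF g] x by (auto simp: X.X.additive_subgroup_iff)
      \<comment> \<open>The inverse found in \<open>N\<close> and the one found in degree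
        \<open>g\<close> agree by uniqueness of inverses in \<open>X\<close>, so it lies in the
        intersection.\<close>
      have "y = z"
        using y z x g carr p.summand_carrier X.X.add.inv_equality by (metis IntD2)
      then show ?thesis using y z by auto
    qed
    then show "additive_subgroup (homog ?N g) ?N"
      using N_iff g by (subst N.additive_subgroup_iff) (auto simp: p.summand_zero p.summand_add)
  next
    fix x assume "x \<in> carrier ?N" "\<And>g. g \<in> carrier G \<Longrightarrow> hproj G X g x = \<zero>\<^bsub>?N\<^esub>"
    then show "x = \<zero>\<^bsub>?N\<^esub>"
      using p.proj_separate[of x] carr by simp
  qed (auto simp: carr proj p.proj_in p.proj_add p.proj_summand p.finite_proj)
  ultimately show ?thesis
  proof (rule graded_right_moduleI)
    fix g h x b assume "g \<in> carrier G" "h \<in> carrier G" "x \<in> homog ?N g" "b \<in> \<B> h"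
    then show "x \<bullet>\<^bsub>?N\<^esub> b \<in> homog ?N (g \<otimes>\<^bsub>G\<^esub> h)"
      using graded_right_moduleD(3)[OF X] ract \<B> by (auto simp: subset_iff)
  qed
qed

text \<open>Operations on the image are computed on preimages picked by \<open>inv_into\<close>;
  independence of this choice is a property of the fibres of \<open>q\<close> and has to be
  proved.\<close>

definition image_module ::
    "('x \<Rightarrow> 'y) \<Rightarrow> ('x, 'b, 'g) graded_module \<Rightarrow> ('y, 'b, 'g) graded_module" where
  "image_module q X =
     \<lparr>carrier = q ` carrier X, mult = undefined, one = undefined, zero = q \<zero>\<^bsub>X\<^esub>,
      add = (\<lambda>y z. q (inv_into (carrier X) q y \<oplus>\<^bsub>X\<^esub> inv_into (carrier X) q z)),
      ract = (\<lambda>y b. q (inv_into (carrier X) q y \<bullet>\<^bsub>X\<^esub> b)), homog = (\<lambda>g. q ` homog X g)\<rparr>"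

text \<open>The fibres of \<open>q\<close> are the cosets of \<open>N\<close>: this covers quotients as well as
  transport along an injection.\<close>

lemma graded_image_module:
  fixes q :: "'x \<Rightarrow> 'y"
  assumes X: "graded_right_module G B \<B> X" and N: "graded_submodule G B X N"
    and \<B>: "\<forall>g\<in>carrier G. \<B> g \<subseteq> carrier B"
    and q_iff: "\<forall>x\<in>carrier X. \<forall>y\<in>carrier X. q x = q y \<longleftrightarrow> x \<ominus>\<^bsub>X\<^esub> y \<in> N"
  defines "Q \<equiv> image_module q X"
  shows "\<lbrakk>x \<in> carrier X; y \<in> carrier X\<rbrakk> \<Longrightarrow> q x \<oplus>\<^bsub>Q\<^esub> q y = q (x \<oplus>\<^bsub>X\<^esub> y)"
    and "\<lbrakk>x \<in> carrier X; b \<in> carrier B\<rbrakk> \<Longrightarrow> q x \<bullet>\<^bsub>Q\<^esub> b = q (x \<bullet>\<^bsub>X\<^esub> b)"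
    and "carrier Q = q ` carrier X" "\<zero>\<^bsub>Q\<^esub> = q \<zero>\<^bsub>X\<^esub>" "homog Q g = q ` homog X g"
    and "graded_right_module G B \<B> Q"
proof -
  interpret X: right_module B X by (rule graded_right_moduleD[OF X])
  interpret p: direct_sum X "carrier G" "homog X" "hproj G X" by (rule direct_sum_hproj[OF X])
  have N_iff: "N \<subseteq> carrier X" "\<zero>\<^bsub>X\<^esub> \<in> N" "\<forall>x\<in>N. \<forall>y\<in>N. x \<oplus>\<^bsub>X\<^esub> y \<in> N"
    using N X.X.additive_subgroup_iff by (auto simp: graded_submodule_def)
  have q: "q x = q y \<longleftrightarrow> x \<ominus>\<^bsub>X\<^esub> y \<in> N" if "x \<in> carrier X" "y \<in> carrier X" for x y
    using that q_iff by blast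
  let ?r = "inv_into (carrier X) q"
  have r: "?r (q x) \<in> carrier X" "q (?r (q x)) = q x" if "x \<in> carrier X" for x
    using that by (auto simp: inv_into_into f_inv_into_f)
  \<comment> \<open>Well-definedness is reduced to closure of \<open>N\<close>: under addition for
    sums, under the action of \<open>B\<close> for \<open>q_ract\<close>, under projections for
    \<open>q_proj\<close>.\<close>
  have q_add: "q (x \<oplus>\<^bsub>X\<^esub> y) = q (x' \<oplus>\<^bsub>X\<^esub> y')" if "q x = q x'" "q y = q y'"
    "x \<in> carrier X" "y \<in> carrier X" "x' \<in> carrier X" "y' \<in> carrier X" for x y x' y'
  proof -
    have "(x \<oplus>\<^bsub>X\<^esub> y) \<ominus>\<^bsub>X\<^esub> (x' \<oplus>\<^bsub>X\<^esub> y') = (x \<ominus>\<^bsub>X\<^esub> x') \<oplus>\<^bsub>X\<^esub> (y \<ominus>\<^bsub>X\<^esub> y')"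
      using that by (simp add: a_minus_def X.X.minus_add X.X.a_ac)
    moreover have "x \<ominus>\<^bsub>X\<^esub> x' \<in> N" "y \<ominus>\<^bsub>X\<^esub> y' \<in> N"
      using that q by auto
    ultimately show ?thesis
      using that N_iff by (subst q) auto
  qed
  have q_ract: "q (x \<bullet>\<^bsub>X\<^esub> b) = q (x' \<bullet>\<^bsub>X\<^esub> b)" if "q x = q x'"
    "x \<in> carrier X" "x' \<in> carrier X" "b \<in> carrier B" for x x' b
    using that N q[of x x'] X.minus_ract[of x x' b]
    by (subst q) (auto simp: X.ract_closed graded_submodule_def simp flip: X.minus_ract)
  have q_proj: "q (hproj G X g x) = q (hproj G X g x')" if "q x = q x'"
    "x \<in> carrier X" "x' \<in> carrier X" "g \<in> carrier G" for x x' g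
    using that N q[of x x'] p.proj_minus[of g x x']
    by (subst q) (auto simp: p.proj_closed graded_submodule_def simp flip: p.proj_minus)
  have add: "q x \<oplus>\<^bsub>Q\<^esub> q y = q (x \<oplus>\<^bsub>X\<^esub> y)" if "x \<in> carrier X" "y \<in> carrier X" for x y
    using that r by (auto simp: Q_def image_module_def intro!: q_add)
  have ract: "q x \<bullet>\<^bsub>Q\<^esub> b = q (x \<bullet>\<^bsub>X\<^esub> b)" if "x \<in> carrier X" "b \<in> carrier B" for x b
    using that r by (auto simp: Q_def image_module_def intro!: q_ract)
  have Q: "carrier Q = q ` carrier X" "\<zero>\<^bsub>Q\<^esub> = q \<zero>\<^bsub>X\<^esub>" "homog Q g = q ` homog X g" for g
    by (simp_all add: Q_def image_module_def)
  have ab: "abelian_group Q"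
  proof (rule abelian_groupI)
    fix y assume "y \<in> carrier Q"
    then obtain x where x: "x \<in> carrier X" "y = q x" by (auto simp: Q)
    then have "q (\<ominus>\<^bsub>X\<^esub> x) \<oplus>\<^bsub>Q\<^esub> y = \<zero>\<^bsub>Q\<^esub>"
      by (simp add: add X.X.l_neg Q)
    then show "\<exists>z\<in>carrier Q. z \<oplus>\<^bsub>Q\<^esub> y = \<zero>\<^bsub>Q\<^esub>"
      using x by (auto simp: Q)
  qed (auto simp: Q add X.X.a_ac)
  interpret Q: abelian_group Q by (rule ab)
  have "right_module B Q"
    by (intro right_module.intro ab X.B.ring_axioms right_module_axioms.intro)
      (auto simp: Q add ract X.ract_closed X.ract_l_distr X.ract_r_distr X.ract_assoc X.ract_one)
  \<comment> \<open>The projection in degree \<open>g\<close> lifts an element, projects the lift in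
    \<open>X\<close> and maps back; \<open>q_proj\<close> allows any other lift in place of the
    chosen one.\<close>
  moreover have "direct_sum Q (carrier G) (homog Q) (\<lambda>g y. q (hproj G X g (?r y)))"
  proof (intro direct_sum.intro ab direct_sum_axioms.intro)
    fix g assume g: "g \<in> carrier G"
    have "\<exists>z\<in>homog X g. q z \<oplus>\<^bsub>Q\<^esub> q x = \<zero>\<^bsub>Q\<^esub>" if x: "x \<in> homog X g" for x
    proof -
      obtain z where z: "z \<in> homog X g" "z \<oplus>\<^bsub>X\<^esub> x = \<zero>\<^bsub>X\<^esub>"
        using p.summand[OF g] x by (auto simp: X.X.additive_subgroup_iff)
      then show ?thesis
        using p.summand_carrier[OF g] x by (auto simp: add Q intro!: bexI[of _ z])
    qed
    then show "additive_subgroup (homog Q g) Q"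
      using g by (subst Q.additive_subgroup_iff)
        (auto simp: Q p.summand_zero p.summand_carrier add p.summand_add)
  next
    fix g h y assume gh: "g \<in> carrier G" "h \<in> carrier G" and "y \<in> homog Q g"
    then obtain x where x: "x \<in> homog X g" "y = q x" by (auto simp: Q)
    then have "q (hproj G X h (?r y)) = q (hproj G X h x)"
      using gh r p.summand_carrier by (intro q_proj) auto
    then show "q (hproj G X h (?r y)) = (if h = g then y else \<zero>\<^bsub>Q\<^esub>)"
      using gh x by (simp add: p.proj_summand Q)
  next
    fix g y z assume g: "g \<in> carrier G" and "y \<in> carrier Q" "z \<in> carrier Q"
    then obtain x x' where x: "x \<in> carrier X" "y = q x" "x' \<in> carrier X" "z = q x'"
      by (auto simp: Q)
    then have "q (hproj G X g (?r (y \<oplus>\<^bsub>Q\<^esub> z))) = q (hproj G X g (x \<oplus>\<^bsub>X\<^esub> x'))"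
      using g r by (intro q_proj) (auto simp: add)
    also have "\<dots> = q (hproj G X g x) \<oplus>\<^bsub>Q\<^esub> q (hproj G X g x')"
      using g x by (simp add: add p.proj_add p.proj_closed)
    also have "q (hproj G X g x) = q (hproj G X g (?r y))"
      using g x r by (intro q_proj) auto
    also have "q (hproj G X g x') = q (hproj G X g (?r z))"
      using g x r by (intro q_proj) auto
    finally show "q (hproj G X g (?r (y \<oplus>\<^bsub>Q\<^esub> z))) =
        q (hproj G X g (?r y)) \<oplus>\<^bsub>Q\<^esub> q (hproj G X g (?r z))" .
  next
    fix y assume "y \<in> carrier Q"
    then have y: "?r y \<in> carrier X" by (auto simp: Q r)
    show "finite {g \<in> carrier G. q (hproj G X g (?r y)) \<noteq> \<zero>\<^bsub>Q\<^esub>}"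
      by (rule finite_subset[OF _ p.finite_proj[OF y]]) (auto simp: Q)
  next
    fix y assume y: "y \<in> carrier Q" "\<And>g. g \<in> carrier G \<Longrightarrow> q (hproj G X g (?r y)) = \<zero>\<^bsub>Q\<^esub>"
    then have "?r y \<in> carrier X" and y_eq: "y = q (?r y)" by (auto simp: Q r)
    \<comment> \<open>The components of the lift lie in \<open>N\<close> but need not vanish, so
      separation in \<open>X\<close> does not apply. Instead, being mapped to zero by
      \<open>q\<close> is carried from the components to the lift by induction.\<close>
    from this(1) have "q (?r y) = \<zero>\<^bsub>Q\<^esub>"
    proof (rule p.proj_induct)
      fix x x' assume "x \<in> carrier X" "x' \<in> carrier X" "q x = \<zero>\<^bsub>Q\<^esub>" "q x' = \<zero>\<^bsub>Q\<^esub>"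
      then show "q (x \<oplus>\<^bsub>X\<^esub> x') = \<zero>\<^bsub>Q\<^esub>"
        by (simp flip: add)
    qed (use y(2) Q in auto)
    then show "y = \<zero>\<^bsub>Q\<^esub>" using y_eq by simp
  qed (auto simp: Q r p.proj_in)
  ultimately show "graded_right_module G B \<B> Q"
  proof (rule graded_right_moduleI)
    fix g h x b assume gh: "g \<in> carrier G" "h \<in> carrier G" "x \<in> homog Q g" and b: "b \<in> \<B> h"
    then show "x \<bullet>\<^bsub>Q\<^esub> b \<in> homog Q (g \<otimes>\<^bsub>G\<^esub> h)"
      using graded_right_moduleD(3)[OF X gh(1,2) _ b] p.summand_carrier[OF gh(1)] bspec[OF \<B> gh(2)]
      by (auto simp: Q ract subset_iff)
  qed
  show "\<lbrakk>x \<in> carrier X; y \<in> carrier X\<rbrakk> \<Longrightarrow> q x \<oplus>\<^bsub>Q\<^esub> q y = q (x \<oplus>\<^bsub>X\<^esub> y)"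
    and "\<lbrakk>x \<in> carrier X; b \<in> carrier B\<rbrakk> \<Longrightarrow> q x \<bullet>\<^bsub>Q\<^esub> b = q (x \<bullet>\<^bsub>X\<^esub> b)"
    and "carrier Q = q ` carrier X" "\<zero>\<^bsub>Q\<^esub> = q \<zero>\<^bsub>X\<^esub>" "homog Q g = q ` homog X g"
    by (fact add ract Q)+
qed

text \<open>The carrier consists of pairs, so for \<open>X\<close> and \<open>Y\<close> over
  \<open>'x\<close> this is not yet an object of the category; it is moved back into
  \<open>'x\<close> along an injection later.\<close>

definition product_module ::
    "('x, 'b, 'g) graded_module \<Rightarrow> ('y, 'b, 'g) graded_module \<Rightarrow> ('x \<times> 'y, 'b, 'g) graded_module" where
  "product_module X Y =
     \<lparr>carrier = carrier X \<times> carrier Y, mult = undefined, one = undefined,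
      zero = (\<zero>\<^bsub>X\<^esub>, \<zero>\<^bsub>Y\<^esub>),
      add = (\<lambda>(x, y) (x', y'). (x \<oplus>\<^bsub>X\<^esub> x', y \<oplus>\<^bsub>Y\<^esub> y')),
      ract = (\<lambda>(x, y) b. (x \<bullet>\<^bsub>X\<^esub> b, y \<bullet>\<^bsub>Y\<^esub> b)), homog = (\<lambda>g. homog X g \<times> homog Y g)\<rparr>"

lemma product_module_simps [simp]:
  "carrier (product_module X Y) = carrier X \<times> carrier Y"
  "\<zero>\<^bsub>product_module X Y\<^esub> = (\<zero>\<^bsub>X\<^esub>, \<zero>\<^bsub>Y\<^esub>)"
  "(x, y) \<oplus>\<^bsub>product_module X Y\<^esub> (x', y') = (x \<oplus>\<^bsub>X\<^esub> x', y \<oplus>\<^bsub>Y\<^esub> y')"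
  "(x, y) \<bullet>\<^bsub>product_module X Y\<^esub> b = (x \<bullet>\<^bsub>X\<^esub> b, y \<bullet>\<^bsub>Y\<^esub> b)"
  "homog (product_module X Y) g = homog X g \<times> homog Y g"
  by (simp_all add: product_module_def)

lemma graded_product_module:
  assumes X: "graded_right_module G B \<B> X" and Y: "graded_right_module G B \<B> Y"
  shows "graded_right_module G B \<B> (product_module X Y)" (is "graded_right_module _ _ _ ?P")
proof -
  interpret X: right_module B X by (rule graded_right_moduleD[OF X])
  interpret Y: right_module B Y by (rule graded_right_moduleD[OF Y])
  interpret p: direct_sum X "carrier G" "homog X" "hproj G X" by (rule direct_sum_hproj[OF X])
  interpret r: direct_sum Y "carrier G" "homog Y" "hproj G Y" by (rule direct_sum_hproj[OF Y])
  have ab: "abelian_group ?P"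
  proof (rule abelian_groupI)
    fix z assume "z \<in> carrier ?P"
    then obtain x y where "x \<in> carrier X" "y \<in> carrier Y" "z = (x, y)" by auto
    then show "\<exists>w\<in>carrier ?P. w \<oplus>\<^bsub>?P\<^esub> z = \<zero>\<^bsub>?P\<^esub>"
      by (intro bexI[of _ "(\<ominus>\<^bsub>X\<^esub> x, \<ominus>\<^bsub>Y\<^esub> y)"]) (auto simp: X.X.l_neg Y.X.l_neg)
  qed (auto simp: X.X.a_ac Y.X.a_ac)
  interpret P: abelian_group ?P by (rule ab)
  have "right_module B ?P"
    by (intro right_module.intro ab X.B.ring_axioms right_module_axioms.intro)
      (auto simp: X.ract_closed X.ract_l_distr X.ract_r_distr X.ract_assoc X.ract_one
        Y.ract_closed Y.ract_l_distr Y.ract_r_distr Y.ract_assoc Y.ract_one)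
  moreover have "direct_sum ?P (carrier G) (homog ?P) (\<lambda>g (x, y). (hproj G X g x, hproj G Y g y))"
  proof (intro direct_sum.intro ab direct_sum_axioms.intro)
    fix g assume g: "g \<in> carrier G"
    show "additive_subgroup (homog ?P g) ?P"
    proof (subst P.additive_subgroup_iff, intro conjI ballI)
      fix z assume "z \<in> homog ?P g"
      then obtain x y where z: "z = (x, y)" "x \<in> homog X g" "y \<in> homog Y g" by auto
      obtain x' y' where "x' \<in> homog X g" "x' \<oplus>\<^bsub>X\<^esub> x = \<zero>\<^bsub>X\<^esub>"
          "y' \<in> homog Y g" "y' \<oplus>\<^bsub>Y\<^esub> y = \<zero>\<^bsub>Y\<^esub>"
        using p.summand[OF g] r.summand[OF g] z
        unfolding X.X.additive_subgroup_iff Y.X.additive_subgroup_iff by meson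
      then show "\<exists>w\<in>homog ?P g. w \<oplus>\<^bsub>?P\<^esub> z = \<zero>\<^bsub>?P\<^esub>"
        by (intro bexI[of _ "(x', y')"]) (auto simp: z)
    qed (use g in \<open>auto simp: p.summand_zero r.summand_zero p.summand_add r.summand_add
        p.summand_carrier r.summand_carrier\<close>)
  next
    fix z assume "z \<in> carrier ?P"
    then obtain x y where z: "x \<in> carrier X" "y \<in> carrier Y" "z = (x, y)" by auto
    have "{g \<in> carrier G. (case z of (x, y) \<Rightarrow> (hproj G X g x, hproj G Y g y)) \<noteq> \<zero>\<^bsub>?P\<^esub>} \<subseteq>
        {g \<in> carrier G. hproj G X g x \<noteq> \<zero>\<^bsub>X\<^esub>} \<union> {g \<in> carrier G. hproj G Y g y \<noteq> \<zero>\<^bsub>Y\<^esub>}"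
      using z by auto
    then show "finite {g \<in> carrier G. (case z of (x, y) \<Rightarrow> (hproj G X g x, hproj G Y g y)) \<noteq> \<zero>\<^bsub>?P\<^esub>}"
      using p.finite_proj[of x] r.finite_proj[of y] z by (meson finite_UnI finite_subset)
  next
    fix z assume "z \<in> carrier ?P"
      "\<And>g. g \<in> carrier G \<Longrightarrow> (case z of (x, y) \<Rightarrow> (hproj G X g x, hproj G Y g y)) = \<zero>\<^bsub>?P\<^esub>"
    then show "z = \<zero>\<^bsub>?P\<^esub>"
      using p.proj_separate[of "fst z"] r.proj_separate[of "snd z"] by (cases z) auto
  qed (auto simp: p.proj_in r.proj_in p.proj_add r.proj_add p.proj_summand r.proj_summand)
  ultimately show ?thesis
  proof (rule graded_right_moduleI)
    fix g h z b assume "g \<in> carrier G" "h \<in> carrier G" "z \<in> homog ?P g" "b \<in> \<B> h"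
    then show "z \<bullet>\<^bsub>?P\<^esub> b \<in> homog ?P (g \<otimes>\<^bsub>G\<^esub> h)"
      using graded_right_moduleD(3)[OF X, of g h] graded_right_moduleD(3)[OF Y, of g h] by auto
  qed
qed

section \<open>Composition, identities and the groups of morphisms\<close>

lemma (in right_module) a_inv_ract:
  "\<lbrakk>x \<in> carrier X; b \<in> carrier B\<rbrakk> \<Longrightarrow> (\<ominus>\<^bsub>X\<^esub> x) \<bullet>\<^bsub>X\<^esub> b = \<ominus>\<^bsub>X\<^esub> (x \<bullet>\<^bsub>X\<^esub> b)"
  using minus_ract[of "\<zero>\<^bsub>X\<^esub>" x b] by (simp add: a_minus_def zero_ract ract_closed)

lemma homog_carrier:
  assumes "graded_right_module G B \<B> X" "g \<in> carrier G" "x \<in> homog X g"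
  shows "x \<in> carrier X"
  using direct_sum.summand_carrier[OF direct_sum_hproj[OF assms(1)] assms(2,3)] .

lemma graded_hom_compose:
  assumes X: "graded_right_module G B \<B> X"
    and f: "f \<in> graded_hom G B X Y" and f': "f' \<in> graded_hom G B Y Z"
  shows "compose (carrier X) f' f \<in> graded_hom G B X Z"
proof -
  interpret X: right_module B X by (rule graded_right_moduleD[OF X])
  show ?thesis
    by (rule graded_homI)
      (auto simp: compose_def X.ract_closed graded_homD[OF f] graded_homD[OF f'] homog_carrier[OF X])
qed

lemma graded_hom_ident:
  assumes X: "graded_right_module G B \<B> X"
  shows "(\<lambda>x\<in>carrier X. x) \<in> graded_hom G B X X"
proof -
  interpret X: right_module B X by (rule graded_right_moduleD[OF X])
  show ?thesis
    by (rule graded_homI) (auto simp: X.ract_closed homog_carrier[OF X])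
qed

lemma graded_hom_restrict_module:
  assumes X: "graded_right_module G B \<B> X" and N: "graded_submodule G B X N"
  shows "(\<lambda>x\<in>N. x) \<in> graded_hom G B (restrict_module X N) X"
proof -
  have "N \<subseteq> carrier X" "\<And>x y. \<lbrakk>x \<in> N; y \<in> N\<rbrakk> \<Longrightarrow> x \<oplus>\<^bsub>X\<^esub> y \<in> N"
    using N additive_subgroup.a_subset[of N X] additive_subgroup.a_closed[of N X]
    by (auto simp: graded_submodule_def)
  then show ?thesis
    using N by (intro graded_homI) (auto simp: graded_submodule_def)
qed

lemma graded_hom_comm_group:
  assumes X: "graded_right_module G B \<B> X" and Y: "graded_right_module G B \<B> Y"
  shows "comm_group \<lparr>carrier = graded_hom G B X Y,
    mult = (\<lambda>f f'. \<lambda>x\<in>carrier X. f x \<oplus>\<^bsub>Y\<^esub> f' x), one = (\<lambda>x\<in>carrier X. \<zero>\<^bsub>Y\<^esub>)\<rparr>"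
proof -
  interpret X: right_module B X by (rule graded_right_moduleD[OF X])
  interpret Y: right_module B Y by (rule graded_right_moduleD[OF Y])
  interpret p: direct_sum Y "carrier G" "homog Y" "hproj G Y" by (rule direct_sum_hproj[OF Y])
  have add: "(\<lambda>x\<in>carrier X. f x \<oplus>\<^bsub>Y\<^esub> f' x) \<in> graded_hom G B X Y"
    if f: "f \<in> graded_hom G B X Y" "f' \<in> graded_hom G B X Y" for f f'
    by (rule graded_homI)
      (auto simp: graded_homD[OF f(1)] graded_homD[OF f(2)] X.ract_closed Y.ract_closed
        Y.ract_l_distr Y.X.a_ac homog_carrier[OF X] p.summand_add)
  have zero: "(\<lambda>x\<in>carrier X. \<zero>\<^bsub>Y\<^esub>) \<in> graded_hom G B X Y"
    by (rule graded_homI) (auto simp: X.ract_closed Y.zero_ract homog_carrier[OF X] p.summand_zero)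
  have neg: "(\<lambda>x\<in>carrier X. \<ominus>\<^bsub>Y\<^esub> f x) \<in> graded_hom G B X Y"
    if f: "f \<in> graded_hom G B X Y" for f
    by (rule graded_homI)
      (auto simp: graded_homD[OF f] X.ract_closed Y.a_inv_ract Y.X.minus_add homog_carrier[OF X]
        additive_subgroup.a_inv_closed[OF p.summand])
  show ?thesis (is "comm_group ?H")
  proof (rule comm_groupI)
    fix f f' f'' assume "f \<in> carrier ?H" "f' \<in> carrier ?H" "f'' \<in> carrier ?H"
    then show "f \<otimes>\<^bsub>?H\<^esub> f' \<otimes>\<^bsub>?H\<^esub> f'' = f \<otimes>\<^bsub>?H\<^esub> (f' \<otimes>\<^bsub>?H\<^esub> f'')"
      by (auto simp: graded_homD Y.X.a_assoc intro!: restrict_ext)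
  next
    fix f f' assume f: "f \<in> carrier ?H" "f' \<in> carrier ?H"
    then show "f \<otimes>\<^bsub>?H\<^esub> f' \<in> carrier ?H"
      by (simp add: add)
    show "f \<otimes>\<^bsub>?H\<^esub> f' = f' \<otimes>\<^bsub>?H\<^esub> f"
      using f by (auto simp: graded_homD Y.X.a_comm intro!: restrict_ext)
  next
    show "\<one>\<^bsub>?H\<^esub> \<in> carrier ?H"
      by (simp add: zero)
  next
    fix f assume "f \<in> carrier ?H"
    then have f: "f \<in> graded_hom G B X Y" by simp
    show "\<one>\<^bsub>?H\<^esub> \<otimes>\<^bsub>?H\<^esub> f = f"
      using add[OF zero f] by (simp, intro graded_hom_eqI[OF _ f]) (auto simp: graded_homD[OF f])
    show "\<exists>f'\<in>carrier ?H. f' \<otimes>\<^bsub>?H\<^esub> f = \<one>\<^bsub>?H\<^esub>"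
      using neg[OF f]
      by (intro bexI[of _ "\<lambda>x\<in>carrier X. \<ominus>\<^bsub>Y\<^esub> f x"])
        (auto simp: Y.X.l_neg graded_homD[OF f] intro!: restrict_ext)
  qed
qed

section \<open>Quotients, biproducts and a zero object inside the type of the objects\<close>

lemma quotient_exists:
  fixes X :: "('x, 'b, 'g) graded_module"
  assumes X: "graded_right_module G B \<B> X" and N: "graded_submodule G B X N"
    and \<B>: "\<forall>g\<in>carrier G. \<B> g \<subseteq> carrier B"
  obtains Q :: "('x, 'b, 'g) graded_module" and q where
    "graded_right_module G B \<B> Q" "q \<in> graded_hom G B X Q" "q ` carrier X = carrier Q"
    "{x \<in> carrier X. q x = \<zero>\<^bsub>Q\<^esub>} = N"
proof -
  interpret X: right_module B X by (rule graded_right_moduleD[OF X])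
  interpret N: additive_subgroup N X using N by (simp add: graded_submodule_def)
  \<comment> \<open>Each coset is represented by one of its own members, so the quotient lives on a
    subset of \<open>carrier X\<close>. Congruent elements give equivalent predicates, hence the
    same choice.\<close>
  define q where "q x = (SOME y. y \<in> carrier X \<and> x \<ominus>\<^bsub>X\<^esub> y \<in> N)" for x
  have trans: "x \<ominus>\<^bsub>X\<^esub> z \<in> N"
    if "x \<ominus>\<^bsub>X\<^esub> y \<in> N" "y \<ominus>\<^bsub>X\<^esub> z \<in> N" "x \<in> carrier X" "y \<in> carrier X" "z \<in> carrier X" for x y z
  proof -
    have "x \<ominus>\<^bsub>X\<^esub> z = (x \<ominus>\<^bsub>X\<^esub> y) \<oplus>\<^bsub>X\<^esub> (y \<ominus>\<^bsub>X\<^esub> z)"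
      using that by (simp add: a_minus_def X.X.a_assoc X.X.r_neg1)
    then show ?thesis using that by simp
  qed
  have sym: "y \<ominus>\<^bsub>X\<^esub> x \<in> N" if "x \<ominus>\<^bsub>X\<^esub> y \<in> N" "x \<in> carrier X" "y \<in> carrier X" for x y
  proof -
    have "y \<ominus>\<^bsub>X\<^esub> x = \<ominus>\<^bsub>X\<^esub> (x \<ominus>\<^bsub>X\<^esub> y)"
      using that by (simp add: a_minus_def X.X.minus_add X.X.a_comm)
    then show ?thesis using that by simp
  qed
  have q: "q x \<in> carrier X \<and> x \<ominus>\<^bsub>X\<^esub> q x \<in> N" if "x \<in> carrier X" for x
    unfolding q_def using that by (rule_tac someI[of _ x]) (simp add: a_minus_def X.X.r_neg)
  have q_iff: "q x = q y \<longleftrightarrow> x \<ominus>\<^bsub>X\<^esub> y \<in> N" if xy: "x \<in> carrier X" "y \<in> carrier X" for x y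
  proof
    assume "q x = q y"
    then show "x \<ominus>\<^bsub>X\<^esub> y \<in> N"
      using q[OF xy(1)] q[OF xy(2)] xy trans[of x "q x" y] sym[of y "q y"] by simp
  next
    assume "x \<ominus>\<^bsub>X\<^esub> y \<in> N"
    then have "z \<in> carrier X \<and> x \<ominus>\<^bsub>X\<^esub> z \<in> N \<longleftrightarrow> z \<in> carrier X \<and> y \<ominus>\<^bsub>X\<^esub> z \<in> N" for z
      using xy trans sym by blast
    then show "q x = q y"
      by (simp add: q_def)
  qed
  have "\<forall>x\<in>carrier X. \<forall>y\<in>carrier X. q x = q y \<longleftrightarrow> x \<ominus>\<^bsub>X\<^esub> y \<in> N"
    using q_iff by blast
  note Q = graded_image_module[OF X N \<B> this]
  show thesis
  proof (rule that[of "image_module q X" "\<lambda>x\<in>carrier X. q x"])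
    show "(\<lambda>x\<in>carrier X. q x) \<in> graded_hom G B X (image_module q X)"
      by (rule graded_homI) (auto simp: Q X.ract_closed homog_carrier[OF X])
    show "{x \<in> carrier X. (\<lambda>x\<in>carrier X. q x) x = \<zero>\<^bsub>image_module q X\<^esub>} = N"
      using N.a_subset X.X.minus_zero by (auto simp: Q q_iff)
  qed (auto simp: Q)
qed

text \<open>The product module is transported along an injection \<open>e\<close> of pairs, and
  \<open>p\<close> and \<open>q\<close> are the coordinates after undoing \<open>e\<close>. The
  equations are stated on elements, ready to be turned into equations between composites.\<close>

lemma biproduct_exists:
  fixes X Y :: "('x, 'b, 'g) graded_module"
  assumes X: "graded_right_module G B \<B> X" and Y: "graded_right_module G B \<B> Y"
    and \<B>: "\<forall>g\<in>carrier G. \<B> g \<subseteq> carrier B" and inf: "infinite (UNIV :: 'x set)"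
  obtains P :: "('x, 'b, 'g) graded_module" and i j p q where
    "graded_right_module G B \<B> P"
    "i \<in> graded_hom G B X P" "j \<in> graded_hom G B Y P"
    "p \<in> graded_hom G B P X" "q \<in> graded_hom G B P Y"
    "\<forall>x\<in>carrier X. p (i x) = x" "\<forall>y\<in>carrier Y. q (j y) = y"
    "\<forall>x\<in>carrier X. q (i x) = \<zero>\<^bsub>Y\<^esub>" "\<forall>y\<in>carrier Y. p (j y) = \<zero>\<^bsub>X\<^esub>"
    "\<forall>z\<in>carrier P. i (p z) \<oplus>\<^bsub>P\<^esub> j (q z) = z"
proof -
  interpret X: right_module B X by (rule graded_right_moduleD[OF X])
  interpret Y: right_module B Y by (rule graded_right_moduleD[OF Y])
  interpret pX: direct_sum X "carrier G" "homog X" "hproj G X" by (rule direct_sum_hproj[OF X])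
  interpret pY: direct_sum Y "carrier G" "homog Y" "hproj G Y" by (rule direct_sum_hproj[OF Y])
  let ?XY = "product_module X Y"
  have XY: "graded_right_module G B \<B> ?XY" by (rule graded_product_module[OF X Y])
  interpret XY: right_module B ?XY by (rule graded_right_moduleD[OF XY])
  interpret pXY: direct_sum ?XY "carrier G" "homog ?XY" "hproj G ?XY"
    by (rule direct_sum_hproj[OF XY])
  \<comment> \<open>An infinite set has the same cardinality as its square.\<close>
  obtain e :: "'x \<times> 'x \<Rightarrow> 'x" where e: "inj e"
    using card_of_Times_same_infinite[OF inf, THEN ordIso_imp_ordLeq, folded card_of_ordLeq]
    by auto
  have "additive_subgroup {\<zero>\<^bsub>?XY\<^esub>} ?XY"
    by (subst XY.X.additive_subgroup_iff) auto
  then have N: "graded_submodule G B ?XY {\<zero>\<^bsub>?XY\<^esub>}"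
    using pXY.proj_zero XY.zero_ract by (auto simp: graded_submodule_def)
  \<comment> \<open>Injectivity says that the fibres of \<open>e\<close> are the cosets of the zero
    submodule, so the construction for quotients applies.\<close>
  have e_iff: "\<forall>x\<in>carrier ?XY. \<forall>y\<in>carrier ?XY. e x = e y \<longleftrightarrow> x \<ominus>\<^bsub>?XY\<^esub> y \<in> {\<zero>\<^bsub>?XY\<^esub>}"
    using XY.X.minus_eq_zero_iff inj_eq[OF e] by blast
  note P = graded_image_module[OF XY N \<B> e_iff]
  note [simp] = inv_f_f[OF e] inj_eq[OF e]
  let ?P = "image_module e ?XY"
  show thesis
  proof (rule that[of ?P "\<lambda>x\<in>carrier X. e (x, \<zero>\<^bsub>Y\<^esub>)" "\<lambda>y\<in>carrier Y. e (\<zero>\<^bsub>X\<^esub>, y)"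
        "\<lambda>z\<in>carrier ?P. fst (inv_into UNIV e z)" "\<lambda>z\<in>carrier ?P. snd (inv_into UNIV e z)"])
    show "graded_right_module G B \<B> ?P" by (rule P)
    show "(\<lambda>x\<in>carrier X. e (x, \<zero>\<^bsub>Y\<^esub>)) \<in> graded_hom G B X ?P"
      by (rule graded_homI)
        (auto simp: P X.ract_closed Y.zero_ract homog_carrier[OF X] pY.summand_zero)
    show "(\<lambda>y\<in>carrier Y. e (\<zero>\<^bsub>X\<^esub>, y)) \<in> graded_hom G B Y ?P"
      by (rule graded_homI)
        (auto simp: P Y.ract_closed X.zero_ract homog_carrier[OF Y] pX.summand_zero)
    show "(\<lambda>z\<in>carrier ?P. fst (inv_into UNIV e z)) \<in> graded_hom G B ?P X"
      by (rule graded_homI)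
        (auto simp: P Y.ract_closed X.ract_closed homog_carrier[OF X] homog_carrier[OF Y])
    show "(\<lambda>z\<in>carrier ?P. snd (inv_into UNIV e z)) \<in> graded_hom G B ?P Y"
      by (rule graded_homI)
        (auto simp: P Y.ract_closed X.ract_closed homog_carrier[OF X] homog_carrier[OF Y])
  qed (auto simp: P)
qed

text \<open>\<open>undefined\<close> is an element that can be named in an arbitrary type
  \<open>'x\<close>.\<close>

definition zero_module :: "('x, 'b, 'g) graded_module" where
  "zero_module = \<lparr>carrier = {undefined}, mult = undefined, one = undefined, zero = undefined,
     add = (\<lambda>_ _. undefined), ract = (\<lambda>_ _. undefined), homog = (\<lambda>_. {undefined})\<rparr>"

lemma graded_zero_module:
  assumes "ring B"
  shows "graded_right_module G B \<B> zero_module"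
proof -
  have ab: "abelian_group zero_module"
    by (rule abelian_groupI) (auto simp: zero_module_def)
  have "right_module B zero_module"
    by (intro right_module.intro ab assms right_module_axioms.intro) (auto simp: zero_module_def)
  moreover have "direct_sum zero_module (carrier G) (homog zero_module) (\<lambda>_ _. undefined)"
    by (intro direct_sum.intro ab direct_sum_axioms.intro, subst abelian_group.additive_subgroup_iff[OF ab])
      (auto simp: zero_module_def)
  ultimately show ?thesis
    by (rule graded_right_moduleI) (auto simp: zero_module_def)
qed

section \<open>Abelian categories of graded modules\<close>

lemma Gr_subcategory_simps [simp]:
  "Obj (full_subcategory (Gr G B \<B>) S) = {X. graded_right_module G B \<B> X} \<inter> S"
  "Hom (full_subcategory (Gr G B \<B>) S) = graded_hom G B"
  "Comp (full_subcategory (Gr G B \<B>) S) X Y Z f' f = compose (carrier X) f' f"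
  "Ident (full_subcategory (Gr G B \<B>) S) X = (\<lambda>x\<in>carrier X. x)"
  "AddHom (full_subcategory (Gr G B \<B>) S) X Y = (\<lambda>f f'. \<lambda>x\<in>carrier X. f x \<oplus>\<^bsub>Y\<^esub> f' x)"
  "ZeroHom (full_subcategory (Gr G B \<B>) S) X Y = (\<lambda>x\<in>carrier X. \<zero>\<^bsub>Y\<^esub>)"
  by (simp_all add: full_subcategory_def Gr_def)

lemma restrict_eq_iff: "restrict f A = restrict g A \<longleftrightarrow> (\<forall>x\<in>A. f x = g x)"
  by (auto simp: fun_eq_iff restrict_def)

lemma compose_eq_restrict_iff: "compose A f g = restrict h A \<longleftrightarrow> (\<forall>x\<in>A. f (g x) = h x)"
  by (simp add: compose_def restrict_eq_iff)

lemma graded_hom_restrict: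
  "f \<in> graded_hom G B X Y \<Longrightarrow> restrict f (carrier X) = f"
  by (rule PiE_restrict[OF graded_homD(1)])

text \<open>The axioms concern morphisms between given objects only, so they pass to every full
  subcategory and \<open>S\<close> remains arbitrary.\<close>

lemma preadditive_Gr_subcategory:
  fixes S :: "('x, 'b, 'g) graded_module set"
  shows "preadditive_category (full_subcategory (Gr G B \<B>) S)"
proof (rule preadditive_category.intro, unfold Gr_subcategory_simps)
  fix X Y :: "('x, 'b, 'g) graded_module"
  assume "X \<in> {X. graded_right_module G B \<B> X} \<inter> S" "Y \<in> {X. graded_right_module G B \<B> X} \<inter> S"
  then show "comm_group \<lparr>carrier = graded_hom G B X Y,
      mult = \<lambda>f f'. \<lambda>x\<in>carrier X. f x \<oplus>\<^bsub>Y\<^esub> f' x, one = \<lambda>x\<in>carrier X. \<zero>\<^bsub>Y\<^esub>\<rparr>"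
    by (intro graded_hom_comm_group) auto
next
  fix X Y Z :: "('x, 'b, 'g) graded_module" and f g
  assume "X \<in> {X. graded_right_module G B \<B> X} \<inter> S" "f \<in> graded_hom G B X Y" "g \<in> graded_hom G B Y Z"
  then show "compose (carrier X) g f \<in> graded_hom G B X Z"
    by (intro graded_hom_compose) auto
next
  fix W X Y Z :: "('x, 'b, 'g) graded_module" and f g h
  assume "f \<in> graded_hom G B W X" "g \<in> graded_hom G B X Y" "h \<in> graded_hom G B Y Z"
  then show "compose (carrier W) (compose (carrier X) h g) f =
      compose (carrier W) h (compose (carrier W) g f)"
    by (intro compose_assoc[symmetric] funcsetI) (rule graded_homD)
qed (auto simp: graded_hom_ident compose_def graded_homD graded_hom_restrict
    restrict_eq_iff cong: restrict_cong)

text \<open>\<open>class_joint_inj\<close> covers two closure properties at once: a subobject is the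
  case \<open>X = Y\<close> with the same injection twice, a biproduct the case of its two
  projections. With \<open>class_surj\<close> for quotients and \<open>class_zero\<close> for the
  zero object, all constructions demanded of an abelian category stay in \<open>S\<close>.\<close>

locale graded_module_class =
  fixes G :: "('g, 'n) monoid_scheme" and B :: "('b, 'k) ring_scheme" and \<B> :: "'g \<Rightarrow> 'b set"
    and S :: "('x, 'b, 'g) graded_module set"
  assumes ring: "ring B"
    and comp_carrier: "\<forall>g\<in>carrier G. \<B> g \<subseteq> carrier B"
    and infinite: "infinite (UNIV :: 'x set)"
    and class_zero:
      "\<lbrakk>graded_right_module G B \<B> X; carrier X = {\<zero>\<^bsub>X\<^esub>}\<rbrakk> \<Longrightarrow> X \<in> S"
    and class_joint_inj:
      "\<lbrakk>graded_right_module G B \<B> P; graded_right_module G B \<B> X; graded_right_module G B \<B> Y;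
        X \<in> S; Y \<in> S; p \<in> graded_hom G B P X; q \<in> graded_hom G B P Y;
        \<And>z. \<lbrakk>z \<in> carrier P; p z = \<zero>\<^bsub>X\<^esub>; q z = \<zero>\<^bsub>Y\<^esub>\<rbrakk> \<Longrightarrow> z = \<zero>\<^bsub>P\<^esub>\<rbrakk> \<Longrightarrow> P \<in> S"
    and class_surj:
      "\<lbrakk>graded_right_module G B \<B> X; graded_right_module G B \<B> Y; X \<in> S;
        f \<in> graded_hom G B X Y; f ` carrier X = carrier Y\<rbrakk> \<Longrightarrow> Y \<in> S"
begin

abbreviation "cat \<equiv> full_subcategory (Gr G B \<B>) S"

section \<open>Kernels and cokernels recognised on elements\<close>

lemma kernelI:
  assumes K: "K \<in> Obj cat" and X: "X \<in> Obj cat" and k: "k \<in> graded_hom G B K X"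
    and inj: "inj_on k (carrier K)" and im: "k ` carrier K = {x \<in> carrier X. f x = \<zero>\<^bsub>Y\<^esub>}"
  shows "is_kernel cat X Y f K k"
  unfolding is_kernel_def
proof (intro conjI ballI impI)
  show "Comp cat K X Y f k = ZeroHom cat K Y"
    using im by (auto simp: compose_eq_restrict_iff)
next
  fix T t assume T: "T \<in> Obj cat" and t: "t \<in> Hom cat T X" and eq: "Comp cat T X Y f t = ZeroHom cat T Y"
  from K X T t have gr: "graded_right_module G B \<B> K" "graded_right_module G B \<B> X"
    "graded_right_module G B \<B> T" and t: "t \<in> graded_hom G B T X" by auto
  interpret K: right_module B K by (rule graded_right_moduleD[OF gr(1)])
  interpret T: right_module B T by (rule graded_right_moduleD[OF gr(3)])
  interpret pK: direct_sum K "carrier G" "homog K" "hproj G K" by (rule direct_sum_hproj[OF gr(1)])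
  interpret pX: direct_sum X "carrier G" "homog X" "hproj G X" by (rule direct_sum_hproj[OF gr(2)])
  have "t x \<in> k ` carrier K" if "x \<in> carrier T" for x
    using eq that graded_homD(2)[OF t] by (auto simp: compose_eq_restrict_iff im)
  then have "\<forall>x\<in>carrier T. \<exists>y\<in>carrier K. k y = t x"
    by (metis imageE)
  then obtain u where u: "\<And>x. x \<in> carrier T \<Longrightarrow> u x \<in> carrier K \<and> k (u x) = t x"
    by metis
  note kD = graded_homD[OF k] and tD = graded_homD[OF t]
  have u_eq: "u x = y" if "x \<in> carrier T" "y \<in> carrier K" "k y = t x" for x y
    using u inj that by (auto simp: inj_on_def)
  have "restrict u (carrier T) \<in> graded_hom G B T K"
  proof (rule graded_homI)
    fix g x assume g: "g \<in> carrier G" and x: "x \<in> homog T g"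
    have x': "x \<in> carrier T" using g x by (rule homog_carrier[OF gr(3)])
    \<comment> \<open>To see that \<open>u\<close> preserves degrees, \<open>k\<close> is applied to
      the component of \<open>u x\<close> in degree \<open>g\<close>: the result is
      \<open>t x\<close> again, so injectivity identifies \<open>u x\<close> with this
      component.\<close>
    have "k (hproj G K g (u x)) = hproj G X g (k (u x))"
      using g x' u by (intro graded_hom_proj[OF gr(1,2) k]) auto
    also have "\<dots> = t x"
      using g x x' u tD(5) pX.proj_summand[of g g "t x"] by simp
    finally have "u x = hproj G K g (u x)"
      using g u x' by (intro u_eq) (auto intro: pK.proj_closed)
    then have "u x \<in> homog K g"
      using pK.proj_in[OF g, of "u x"] u[OF x'] by simp
    then show "restrict u (carrier T) x \<in> homog K g"
      using x' by simp
  qed (auto simp: u kD tD K.ract_closed T.ract_closed intro!: u_eq)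
  then show "\<exists>!u. u \<in> Hom cat T K \<and> Comp cat T K X k u = t"
  proof (intro ex1I[of _ "restrict u (carrier T)"] conjI; clarsimp)
    show "compose (carrier T) k (restrict u (carrier T)) = t"
      using u tD(1) by (intro PiE_ext[of _ "carrier T" "\<lambda>_. carrier X"]) (auto simp: compose_def kD)
  next
    fix v assume v: "v \<in> graded_hom G B T K" "t = compose (carrier T) k v"
    show "v = restrict u (carrier T)"
      using v(1) \<open>restrict u (carrier T) \<in> graded_hom G B T K\<close>
    proof (rule graded_hom_eqI)
      fix x assume "x \<in> carrier T"
      then show "v x = restrict u (carrier T) x"
        using v graded_homD(2)[OF v(1)] u_eq[of x "v x"] by (simp add: compose_eq)
    qed
  qed
qed (use K k in auto)

lemma cokernelI:
  assumes Q: "Q \<in> Obj cat" and X: "X \<in> Obj cat" and Y: "Y \<in> Obj cat"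
    and f: "f \<in> graded_hom G B X Y" and q: "q \<in> graded_hom G B Y Q"
    and surj: "q ` carrier Y = carrier Q" and ker: "{y \<in> carrier Y. q y = \<zero>\<^bsub>Q\<^esub>} = f ` carrier X"
  shows "is_cokernel cat X Y f Q q"
  unfolding is_cokernel_def
proof (intro conjI ballI impI)
  show "Comp cat X Y Q q f = ZeroHom cat X Q"
    using ker by (auto simp: compose_eq_restrict_iff)
next
  fix T t assume T: "T \<in> Obj cat" and "t \<in> Hom cat Y T" and eq: "Comp cat X Y T t f = ZeroHom cat X T"
  with Q Y have gr: "graded_right_module G B \<B> Q" "graded_right_module G B \<B> Y"
    "graded_right_module G B \<B> T" and t: "t \<in> graded_hom G B Y T" by auto
  interpret Q: right_module B Q by (rule graded_right_moduleD[OF gr(1)])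
  interpret Y: right_module B Y by (rule graded_right_moduleD[OF gr(2)])
  interpret T: right_module B T by (rule graded_right_moduleD[OF gr(3)])
  interpret pQ: direct_sum Q "carrier G" "homog Q" "hproj G Q" by (rule direct_sum_hproj[OF gr(1)])
  interpret pY: direct_sum Y "carrier G" "homog Y" "hproj G Y" by (rule direct_sum_hproj[OF gr(2)])
  note qD = graded_homD[OF q] and tD = graded_homD[OF t]
  \<comment> \<open>\<open>t\<close> kills the image of \<open>f\<close>, which is the kernel of
    \<open>q\<close>; hence \<open>t\<close> is constant on the fibres of \<open>q\<close> and
    descends to \<open>Q\<close>.\<close>
  have t_eq: "t y = t y'" if y: "y \<in> carrier Y" "y' \<in> carrier Y" "q y = q y'" for y y'
  proof -
    have "q (y \<ominus>\<^bsub>Y\<^esub> y') = \<zero>\<^bsub>Q\<^esub>"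
      using y graded_hom_minus[OF Y.X.abelian_group_axioms Q.X.abelian_group_axioms q]
      by (simp add: Q.X.minus_eq_zero_iff qD)
    then have "y \<ominus>\<^bsub>Y\<^esub> y' \<in> f ` carrier X"
      using y by (auto simp flip: ker)
    then have "t (y \<ominus>\<^bsub>Y\<^esub> y') = \<zero>\<^bsub>T\<^esub>"
      using eq by (auto simp: compose_eq_restrict_iff)
    then show ?thesis
      using y graded_hom_minus[OF Y.X.abelian_group_axioms T.X.abelian_group_axioms t]
      by (simp add: T.X.minus_eq_zero_iff tD)
  qed
  define u where "u = (\<lambda>z\<in>carrier Q. t (inv_into (carrier Y) q z))"
  have u: "u (q y) = t y" if "y \<in> carrier Y" for y
    using that qD(2) by (auto simp: u_def inv_into_into f_inv_into_f intro!: t_eq)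
  have carrQ: "\<exists>y\<in>carrier Y. z = q y" if "z \<in> carrier Q" for z
    using that surj by auto
  have u_hom: "u \<in> graded_hom G B Q T"
  proof (rule graded_homI)
    show "u \<in> carrier Q \<rightarrow>\<^sub>E carrier T"
      using surj tD(2) by (auto simp: u_def inv_into_into)
  next
    fix z z' assume "z \<in> carrier Q" "z' \<in> carrier Q"
    then obtain y y' where "y \<in> carrier Y" "z = q y" "y' \<in> carrier Y" "z' = q y'"
      using carrQ by metis
    then show "u (z \<oplus>\<^bsub>Q\<^esub> z') = u z \<oplus>\<^bsub>T\<^esub> u z'"
      by (simp add: u tD(3) flip: qD(3))
  next
    fix z b assume "z \<in> carrier Q" "b \<in> carrier B"
    moreover from this obtain y where "y \<in> carrier Y" "z = q y"
      using carrQ by metis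
    ultimately show "u (z \<bullet>\<^bsub>Q\<^esub> b) = u z \<bullet>\<^bsub>T\<^esub> b"
      by (simp add: u tD(4) Y.ract_closed flip: qD(4))
  next
    fix g z assume g: "g \<in> carrier G" and z: "z \<in> homog Q g"
    then obtain y where y: "y \<in> carrier Y" "z = q y"
      using carrQ homog_carrier[OF gr(1)] by metis
    \<comment> \<open>The lift \<open>y\<close> of the homogeneous element \<open>z\<close> may be
      inhomogeneous, but its component of degree \<open>g\<close> is a lift as well.\<close>
    have "z = q (hproj G Y g y)"
      using g y z pQ.proj_summand[of g g z] graded_hom_proj[OF gr(2,1) q g y(1)] by simp
    then show "u z \<in> homog T g"
      using g y tD(5) pY.proj_in pY.proj_closed by (simp add: u)
  qed
  show "\<exists>!u. u \<in> Hom cat Q T \<and> Comp cat Y Q T u q = t"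
  proof (intro ex1I[of _ u] conjI; clarsimp)
    show "u \<in> graded_hom G B Q T" by (rule u_hom)
    show "compose (carrier Y) u q = t"
      using u tD(1) by (intro PiE_ext[of _ "carrier Y" "\<lambda>_. carrier T"]) (auto simp: compose_def tD)
  next
    fix v assume v: "v \<in> graded_hom G B Q T" "t = compose (carrier Y) v q"
    show "v = u"
      using v(1) u_hom
    proof (rule graded_hom_eqI)
      fix z assume "z \<in> carrier Q"
      then obtain y where "y \<in> carrier Y" "z = q y" using carrQ by metis
      then show "v z = u z" using v(2) by (simp add: compose_eq u)
    qed
  qed
qed (use Q q in auto)

lemma kernel_object:
  assumes X: "X \<in> Obj cat" and Y: "Y \<in> Obj cat" and f: "f \<in> graded_hom G B X Y"
  obtains K k where "K \<in> Obj cat" "k \<in> graded_hom G B K X" "inj_on k (carrier K)"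
    "k ` carrier K = {x \<in> carrier X. f x = \<zero>\<^bsub>Y\<^esub>}"
proof -
  let ?N = "{x \<in> carrier X. f x = \<zero>\<^bsub>Y\<^esub>}"
  from X Y have gr: "graded_right_module G B \<B> X" "graded_right_module G B \<B> Y" by auto
  have N: "graded_submodule G B X ?N"
    by (rule graded_submodule_kernel[OF gr f])
  have K: "graded_right_module G B \<B> (restrict_module X ?N)"
    using comp_carrier by (rule graded_restrict_module[OF gr(1) N])
  have k: "(\<lambda>x\<in>?N. x) \<in> graded_hom G B (restrict_module X ?N) X"
    by (rule graded_hom_restrict_module[OF gr(1) N])
  \<comment> \<open>The inclusion plays both members of the jointly injective pair.\<close>
  have "restrict_module X ?N \<in> S"
    using X by (intro class_joint_inj[OF K gr(1,1) _ _ k k]) auto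
  then show thesis
    using K k by (intro that[of "restrict_module X ?N" "\<lambda>x\<in>?N. x"]) (auto simp: inj_on_def)
qed

lemma cokernel_object:
  assumes X: "X \<in> Obj cat" and Y: "Y \<in> Obj cat" and f: "f \<in> graded_hom G B X Y"
  obtains Q q where "Q \<in> Obj cat" "q \<in> graded_hom G B Y Q" "q ` carrier Y = carrier Q"
    "{y \<in> carrier Y. q y = \<zero>\<^bsub>Q\<^esub>} = f ` carrier X"
proof -
  from X Y have gr: "graded_right_module G B \<B> X" "graded_right_module G B \<B> Y" by auto
  obtain Q q where Q: "graded_right_module G B \<B> Q" and q: "q \<in> graded_hom G B Y Q"
    "q ` carrier Y = carrier Q" "{y \<in> carrier Y. q y = \<zero>\<^bsub>Q\<^esub>} = f ` carrier X"
    using comp_carrier by (rule quotient_exists[OF gr(2) graded_submodule_image[OF gr f]])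
  moreover have "Q \<in> S"
    using Y by (intro class_surj[OF gr(2) Q _ q(1,2)]) auto
  ultimately show thesis
    by (intro that) auto
qed

text \<open>The inclusion of the kernel and the zero map have the same composite with
  \<open>f\<close>, so cancelling \<open>f\<close> makes the kernel trivial.\<close>

lemma mono_imp_inj:
  assumes X: "X \<in> Obj cat" and Y: "Y \<in> Obj cat" and f: "f \<in> graded_hom G B X Y"
    and mono: "is_mono cat X Y f"
  shows "inj_on f (carrier X)"
proof (rule inj_onI)
  from X Y have gr: "graded_right_module G B \<B> X" "graded_right_module G B \<B> Y" by auto
  interpret X: right_module B X by (rule graded_right_moduleD[OF gr(1)])
  interpret Y: right_module B Y by (rule graded_right_moduleD[OF gr(2)])
  fix x y assume xy: "x \<in> carrier X" "y \<in> carrier X" "f x = f y"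
  obtain K k where K: "K \<in> Obj cat" and k: "k \<in> graded_hom G B K X"
    and "inj_on k (carrier K)" and im: "k ` carrier K = {x \<in> carrier X. f x = \<zero>\<^bsub>Y\<^esub>}"
    by (rule kernel_object[OF X Y f])
  let ?z = "\<lambda>x\<in>carrier K. \<zero>\<^bsub>X\<^esub>"
  interpret hom: comm_group "\<lparr>carrier = graded_hom G B K X,
    mult = (\<lambda>f f'. \<lambda>x\<in>carrier K. f x \<oplus>\<^bsub>X\<^esub> f' x), one = ?z\<rparr>"
    using K gr by (intro graded_hom_comm_group) auto
  have "f x \<ominus>\<^bsub>Y\<^esub> f y = \<zero>\<^bsub>Y\<^esub>"
    using xy by (simp add: Y.X.minus_eq_zero_iff graded_homD(2)[OF f])
  then have "x \<ominus>\<^bsub>X\<^esub> y \<in> k ` carrier K"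
    using xy graded_hom_minus[OF X.X.abelian_group_axioms Y.X.abelian_group_axioms f]
    by (simp add: im)
  moreover have "compose (carrier K) f k = compose (carrier K) f ?z"
    using im graded_hom_zero[OF X.X.abelian_group_axioms Y.X.abelian_group_axioms f]
    by (auto simp: compose_def restrict_eq_iff)
  then have "k = ?z"
    using mono K k hom.one_closed by (auto simp: is_mono_def)
  ultimately have "x \<ominus>\<^bsub>X\<^esub> y = \<zero>\<^bsub>X\<^esub>"
    by (metis imageE restrict_apply')
  then show "x = y"
    using xy by (simp add: X.X.minus_eq_zero_iff)
qed

text \<open>The projection onto the cokernel and the zero map agree after \<open>f\<close>. So the
  projection is zero, and the image of \<open>f\<close>, being its kernel, is everything.\<close>

lemma epi_imp_surj:
  assumes X: "X \<in> Obj cat" and Y: "Y \<in> Obj cat" and f: "f \<in> graded_hom G B X Y"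
    and epi: "is_epi cat X Y f"
  shows "f ` carrier X = carrier Y"
proof -
  obtain Q q where Q: "Q \<in> Obj cat" and q: "q \<in> graded_hom G B Y Q"
    and "q ` carrier Y = carrier Q"
    and ker: "{y \<in> carrier Y. q y = \<zero>\<^bsub>Q\<^esub>} = f ` carrier X"
    by (rule cokernel_object[OF X Y f])
  let ?z = "\<lambda>x\<in>carrier Y. \<zero>\<^bsub>Q\<^esub>"
  interpret hom: comm_group "\<lparr>carrier = graded_hom G B Y Q,
    mult = (\<lambda>f f'. \<lambda>x\<in>carrier Y. f x \<oplus>\<^bsub>Q\<^esub> f' x), one = ?z\<rparr>"
    using Q Y by (intro graded_hom_comm_group) auto
  have "compose (carrier X) q f = compose (carrier X) ?z f"
    using ker graded_homD(2)[OF f] by (auto simp: compose_def restrict_eq_iff)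
  then have "q = ?z"
    using epi Q q hom.one_closed by (auto simp: is_epi_def)
  then show ?thesis
    using ker by auto
qed

theorem abelian_category: "abelian_category cat"
proof (intro abelian_category.intro preadditive_Gr_subcategory abelian_category_axioms.intro)
  let ?Z = "zero_module :: ('x, 'b, 'g) graded_module"
  have Z: "graded_right_module G B \<B> ?Z" by (rule graded_zero_module[OF ring])
  interpret Z: abelian_group ?Z by (rule graded_right_moduleD[OF Z])
  have carrZ: "carrier ?Z = {\<zero>\<^bsub>?Z\<^esub>}" by (simp add: zero_module_def)
  have ZS: "?Z \<in> S" by (rule class_zero[OF Z carrZ])
  have "(\<exists>!f. f \<in> graded_hom G B X ?Z) \<and> (\<exists>!f. f \<in> graded_hom G B ?Z X)"
    if X: "graded_right_module G B \<B> X" for X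
  proof
    interpret X: abelian_group X by (rule graded_right_moduleD[OF X])
    interpret h: comm_group "\<lparr>carrier = graded_hom G B X ?Z,
      mult = (\<lambda>f f'. \<lambda>x\<in>carrier X. f x \<oplus>\<^bsub>?Z\<^esub> f' x), one = (\<lambda>x\<in>carrier X. \<zero>\<^bsub>?Z\<^esub>)\<rparr>"
      by (rule graded_hom_comm_group[OF X Z])
    show "\<exists>!f. f \<in> graded_hom G B X ?Z"
    proof (rule ex1I)
      show "(\<lambda>x\<in>carrier X. \<zero>\<^bsub>?Z\<^esub>) \<in> graded_hom G B X ?Z" using h.one_closed by simp
      fix f assume f: "f \<in> graded_hom G B X ?Z"
      then show "f = (\<lambda>x\<in>carrier X. \<zero>\<^bsub>?Z\<^esub>)"
        using h.one_closed graded_homD(2)[OF f] carrZ by (intro graded_hom_eqI[OF f]) auto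
    qed
    interpret k: comm_group "\<lparr>carrier = graded_hom G B ?Z X,
      mult = (\<lambda>f f'. \<lambda>x\<in>carrier ?Z. f x \<oplus>\<^bsub>X\<^esub> f' x), one = (\<lambda>x\<in>carrier ?Z. \<zero>\<^bsub>X\<^esub>)\<rparr>"
      by (rule graded_hom_comm_group[OF Z X])
    show "\<exists>!f. f \<in> graded_hom G B ?Z X"
    proof (rule ex1I)
      show "(\<lambda>x\<in>carrier ?Z. \<zero>\<^bsub>X\<^esub>) \<in> graded_hom G B ?Z X" using k.one_closed by simp
      fix f assume f: "f \<in> graded_hom G B ?Z X"
      then show "f = (\<lambda>x\<in>carrier ?Z. \<zero>\<^bsub>X\<^esub>)"
        using k.one_closed graded_hom_zero[OF Z.abelian_group_axioms X.abelian_group_axioms f] carrZ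
        by (intro graded_hom_eqI[OF f]) auto
    qed
  qed
  then show "\<exists>Z. is_zero_object cat Z"
    using Z ZS by (intro exI[of _ ?Z]) (auto simp: is_zero_object_def)
next
  fix X Y assume XY: "X \<in> Obj cat" "Y \<in> Obj cat"
  then have gr: "graded_right_module G B \<B> X" "graded_right_module G B \<B> Y" by auto
  obtain P i j p q where P: "graded_right_module G B \<B> P"
    "i \<in> graded_hom G B X P" "j \<in> graded_hom G B Y P"
    "p \<in> graded_hom G B P X" "q \<in> graded_hom G B P Y"
    "\<forall>x\<in>carrier X. p (i x) = x" "\<forall>y\<in>carrier Y. q (j y) = y"
    "\<forall>x\<in>carrier X. q (i x) = \<zero>\<^bsub>Y\<^esub>" "\<forall>y\<in>carrier Y. p (j y) = \<zero>\<^bsub>X\<^esub>"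
    "\<forall>z\<in>carrier P. i (p z) \<oplus>\<^bsub>P\<^esub> j (q z) = z"
    using comp_carrier infinite by (rule biproduct_exists[OF gr])
  have ab: "abelian_group X" "abelian_group Y" "abelian_group P"
    using gr P(1) by (auto dest: graded_right_moduleD)
  interpret P: abelian_group P by (rule ab)
  \<comment> \<open>By \<open>i p + j q = 1\<close> an element killed by both projections is
    zero.\<close>
  have "P \<in> S"
  proof (rule class_joint_inj[OF P(1) gr _ _ P(4,5)])
    fix z assume "z \<in> carrier P" "p z = \<zero>\<^bsub>X\<^esub>" "q z = \<zero>\<^bsub>Y\<^esub>"
    then show "z = \<zero>\<^bsub>P\<^esub>"
      using bspec[OF P(10), of z] graded_hom_zero[OF ab(1,3) P(2)] graded_hom_zero[OF ab(2,3) P(3)]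
      by simp
  qed (use XY in auto)
  then have "is_biproduct cat X Y P i j p q"
    using P by (auto simp: is_biproduct_def compose_def restrict_eq_iff)
  then show "\<exists>P i j p q. is_biproduct cat X Y P i j p q" by blast
next
  fix X Y f assume XY: "X \<in> Obj cat" "Y \<in> Obj cat" and "f \<in> Hom cat X Y"
  then have f: "f \<in> graded_hom G B X Y" by simp
  obtain K k where K: "K \<in> Obj cat" "k \<in> graded_hom G B K X" "inj_on k (carrier K)"
    "k ` carrier K = {x \<in> carrier X. f x = \<zero>\<^bsub>Y\<^esub>}"
    by (rule kernel_object[OF XY f])
  obtain Q q where Q: "Q \<in> Obj cat" "q \<in> graded_hom G B Y Q" "q ` carrier Y = carrier Q"
    "{y \<in> carrier Y. q y = \<zero>\<^bsub>Q\<^esub>} = f ` carrier X"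
    by (rule cokernel_object[OF XY f])
  show "\<exists>K k. is_kernel cat X Y f K k"
    using kernelI[OF K(1) XY(1) K(2-4)] by blast
  show "\<exists>Q q. is_cokernel cat X Y f Q q"
    using cokernelI[OF Q(1) XY f Q(2-4)] by blast
  \<comment> \<open>A monomorphism is injective and its image is the kernel of its cokernel map
    \<open>q\<close>, so \<open>kernelI\<close> applies to \<open>f\<close> itself in place of an
    inclusion. Dually, an epimorphism is a cokernel of its own kernel \<open>k\<close>.\<close>
  show "\<exists>Z\<in>Obj cat. \<exists>h\<in>Hom cat Y Z. is_kernel cat Y Z h X f" if "is_mono cat X Y f"
    using kernelI[OF XY f mono_imp_inj[OF XY f that] Q(4)[symmetric]] Q(1,2) by auto
  show "\<exists>W\<in>Obj cat. \<exists>h\<in>Hom cat W X. is_cokernel cat W X h Y f" if "is_epi cat X Y f"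
    using cokernelI[OF XY(2) K(1) XY(1) K(2) f epi_imp_surj[OF XY f that] K(4)[symmetric]] K(1,2)
    by auto
qed

end

section \<open>Regrading\<close>

lemma (in right_module) ract_zero: "x \<in> carrier X \<Longrightarrow> x \<bullet>\<^bsub>X\<^esub> \<zero>\<^bsub>B\<^esub> = \<zero>\<^bsub>X\<^esub>"
  using ract_r_distr[of x "\<zero>\<^bsub>B\<^esub>" "\<zero>\<^bsub>B\<^esub>"] ract_closed[of x "\<zero>\<^bsub>B\<^esub>"] by simp

text \<open>A record update cannot change the type of degrees from \<open>'g\<close> to
  \<open>'h\<close>, so the record is rebuilt field by field.\<close>

definition regrade ::
    "('h \<Rightarrow> 'x set) \<Rightarrow> ('x, 'b, 'g) graded_module \<Rightarrow> ('x, 'b, 'h) graded_module" where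
  "regrade A X = \<lparr>carrier = carrier X, mult = mult X, one = one X, zero = zero X, add = add X,
     ract = ract X, homog = A\<rparr>"

lemma regrade_simps [simp]:
  "carrier (regrade A X) = carrier X" "zero (regrade A X) = zero X" "add (regrade A X) = add X"
  "ract (regrade A X) = ract X" "homog (regrade A X) = A"
  by (simp_all add: regrade_def)

lemma right_module_regrade:
  assumes "right_module B X"
  shows "right_module B (regrade A X)"
proof -
  interpret right_module B X by fact
  have "abelian_group (regrade A X)"
    by (rule abelian_groupI) (auto simp: X.a_ac intro!: bexI[of _ "\<ominus>\<^bsub>X\<^esub> _"] X.l_neg)
  then show ?thesis
    by (intro right_module.intro B.ring_axioms right_module_axioms.intro)
      (auto simp: ract_closed ract_l_distr ract_r_distr ract_assoc ract_one)
qed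

text \<open>Summands and operations are untouched, but the finite sums are formed in records of
  different types. In terms of projections each condition carries over literally.\<close>

lemma internal_direct_sum_regrade:
  assumes "right_module B X" "internal_direct_sum X I A"
  shows "internal_direct_sum (regrade A' X) I A"
proof -
  interpret X: right_module B X by fact
  interpret Y: right_module B "regrade A' X" by (rule right_module_regrade) fact
  obtain p where "direct_sum X I A p"
    using assms(2) internal_direct_sum_iff[OF X.X.abelian_group_axioms] by blast
  then interpret direct_sum X I A p .
  have "direct_sum (regrade A' X) I A p"
    using summand
    by (intro direct_sum.intro Y.X.abelian_group_axioms direct_sum_axioms.intro)
      (auto simp: X.X.additive_subgroup_iff Y.X.additive_subgroup_iff
        proj_in proj_add proj_summand finite_proj proj_separate)
  then show ?thesis
    by (rule direct_sum.internal_direct_sum)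
qed

lemma graded_algebraD:
  assumes "graded_algebra R G B \<B>"
  shows "ring B" "\<forall>g\<in>carrier G. \<B> g \<subseteq> carrier B" "g \<in> carrier G \<Longrightarrow> \<zero>\<^bsub>B\<^esub> \<in> \<B> g"
    and "\<lbrakk>g \<in> carrier G; h \<in> carrier G; x \<in> \<B> g; y \<in> \<B> h\<rbrakk> \<Longrightarrow> x \<otimes>\<^bsub>B\<^esub> y \<in> \<B> (g \<otimes>\<^bsub>G\<^esub> h)"
  using assms
  by (auto simp: graded_algebra_def r_algebra_def submodule_def subgroup_def)

section \<open>Closure conditions for the two subcategories\<close>

lemma homog_surj:
  assumes X: "graded_right_module G B \<B> X" and Y: "graded_right_module G B \<B> Y"
    and f: "f \<in> graded_hom G B X Y" "f ` carrier X = carrier Y" and g: "g \<in> carrier G"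
  shows "homog Y g = f ` homog X g"
proof
  interpret X: direct_sum X "carrier G" "homog X" "hproj G X" by (rule direct_sum_hproj[OF X])
  interpret Y: direct_sum Y "carrier G" "homog Y" "hproj G Y" by (rule direct_sum_hproj[OF Y])
  show "homog Y g \<subseteq> f ` homog X g"
  proof
    fix y assume y: "y \<in> homog Y g"
    then obtain x where x: "x \<in> carrier X" "y = f x"
      using f(2) Y.summand_carrier[OF g] by auto
    \<comment> \<open>Projecting an arbitrary lift gives a lift in degree \<open>g\<close>, as
      \<open>f\<close> commutes with projections.\<close>
    then have "f (hproj G X g x) = y"
      using graded_hom_proj[OF X Y f(1) g x(1)] Y.proj_summand[OF g g y] by simp
    then show "y \<in> f ` homog X g"
      using X.proj_in[OF g x(1)] by blast
  qed
  show "f ` homog X g \<subseteq> homog Y g"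
    using graded_homD(5)[OF f(1) g] by blast
qed

text \<open>Degree-preserving maps into \<open>X\<close> and \<open>Y\<close> send an element of a
  degree outside of \<open>S\<close> to zero, so joint injectivity kills it. A surjection is
  surjective in each degree and hence transfers the vanishing of components.\<close>

lemma graded_module_class_Supp:
  fixes S :: "'g set"
  assumes B: "graded_algebra R G B \<B>" and "infinite (UNIV :: 'x set)"
  shows "graded_module_class G B \<B> {X :: ('x, 'b, 'g) graded_module. Supp G X (homog X) \<subseteq> S}"
proof (rule graded_module_class.intro, unfold mem_Collect_eq)
  fix P X Y :: "('x, 'b, 'g) graded_module" and p q
  assume gr: "graded_right_module G B \<B> P" "graded_right_module G B \<B> X" "graded_right_module G B \<B> Y"
    and S: "Supp G X (homog X) \<subseteq> S" "Supp G Y (homog Y) \<subseteq> S"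
    and pq: "p \<in> graded_hom G B P X" "q \<in> graded_hom G B P Y"
    and inj: "\<And>z. \<lbrakk>z \<in> carrier P; p z = \<zero>\<^bsub>X\<^esub>; q z = \<zero>\<^bsub>Y\<^esub>\<rbrakk> \<Longrightarrow> z = \<zero>\<^bsub>P\<^esub>"
  have "homog P g = {\<zero>\<^bsub>P\<^esub>}" if g: "g \<in> carrier G" "g \<notin> S" for g
  proof -
    have "z = \<zero>\<^bsub>P\<^esub>" if "z \<in> homog P g" for z
      using that g S homog_carrier[OF gr(1) g(1) that] graded_homD(5)[OF pq(1) g(1) that]
        graded_homD(5)[OF pq(2) g(1) that] inj[of z] by (auto simp: Supp_def)
    then show ?thesis
      using direct_sum.summand_zero[OF direct_sum_hproj[OF gr(1)] g(1)] by blast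
  qed
  then show "Supp G P (homog P) \<subseteq> S"
    by (auto simp: Supp_def)
next
  fix X Y :: "('x, 'b, 'g) graded_module" and f
  assume gr: "graded_right_module G B \<B> X" "graded_right_module G B \<B> Y"
    and S: "Supp G X (homog X) \<subseteq> S"
    and f: "f \<in> graded_hom G B X Y" "f ` carrier X = carrier Y"
  have f0: "f \<zero>\<^bsub>X\<^esub> = \<zero>\<^bsub>Y\<^esub>"
    using gr[THEN graded_right_moduleD(2)] f(1) by (rule graded_hom_zero)
  have "homog Y g = {\<zero>\<^bsub>Y\<^esub>}" if g: "g \<in> carrier G" "g \<notin> S" for g
    using homog_surj[OF gr f g(1)] S g f0 by (auto simp: Supp_def)
  then show "Supp G Y (homog Y) \<subseteq> S"
    by (auto simp: Supp_def)
next
  fix X :: "('x, 'b, 'g) graded_module"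
  assume gr: "graded_right_module G B \<B> X" and X: "carrier X = {\<zero>\<^bsub>X\<^esub>}"
  have "homog X g = {\<zero>\<^bsub>X\<^esub>}" if g: "g \<in> carrier G" for g
    using homog_carrier[OF gr g] X direct_sum.summand_zero[OF direct_sum_hproj[OF gr] g] by blast
  then show "Supp G X (homog X) \<subseteq> S"
    by (auto simp: Supp_def)
qed (use assms graded_algebraD[OF B] in auto)

text \<open>\<open>P\<close> is kept arbitrary; it is later the condition
  \<open>\<phi>(\<sigma>)\<phi>(\<tau>) \<notin> Im(\<phi>)\<close> over the group
  \<open>G'\<close>. Vanishing of a product can be tested after jointly injective maps, and passes
  along surjections because homogeneous elements have homogeneous lifts.\<close>

lemma graded_module_class_annihilated:
  assumes B: "graded_algebra R G B \<B>" and "infinite (UNIV :: 'x set)"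
  shows "graded_module_class G B \<B> {V :: ('x, 'b, 'g) graded_module.
    \<forall>g\<in>carrier G. \<forall>h\<in>carrier G. P g h \<longrightarrow> (\<forall>v\<in>homog V g. \<forall>b\<in>\<B> h. v \<bullet>\<^bsub>V\<^esub> b = \<zero>\<^bsub>V\<^esub>)}"
proof (rule graded_module_class.intro, unfold mem_Collect_eq)
  fix Q X Y :: "('x, 'b, 'g) graded_module" and p q
  assume gr: "graded_right_module G B \<B> Q" "graded_right_module G B \<B> X" "graded_right_module G B \<B> Y"
    and S: "\<forall>g\<in>carrier G. \<forall>h\<in>carrier G. P g h \<longrightarrow> (\<forall>v\<in>homog X g. \<forall>b\<in>\<B> h. v \<bullet>\<^bsub>X\<^esub> b = \<zero>\<^bsub>X\<^esub>)"
      "\<forall>g\<in>carrier G. \<forall>h\<in>carrier G. P g h \<longrightarrow> (\<forall>v\<in>homog Y g. \<forall>b\<in>\<B> h. v \<bullet>\<^bsub>Y\<^esub> b = \<zero>\<^bsub>Y\<^esub>)"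
    and p: "p \<in> graded_hom G B Q X" and q: "q \<in> graded_hom G B Q Y"
    and inj: "\<And>z. \<lbrakk>z \<in> carrier Q; p z = \<zero>\<^bsub>X\<^esub>; q z = \<zero>\<^bsub>Y\<^esub>\<rbrakk> \<Longrightarrow> z = \<zero>\<^bsub>Q\<^esub>"
  show "\<forall>g\<in>carrier G. \<forall>h\<in>carrier G. P g h \<longrightarrow> (\<forall>v\<in>homog Q g. \<forall>b\<in>\<B> h. v \<bullet>\<^bsub>Q\<^esub> b = \<zero>\<^bsub>Q\<^esub>)"
  proof (intro ballI impI)
    fix g h v b assume gh: "g \<in> carrier G" "h \<in> carrier G" "P g h" and v: "v \<in> homog Q g" and b: "b \<in> \<B> h"
    have v': "v \<in> carrier Q" using gr(1) gh(1) v by (rule homog_carrier)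
    have b': "b \<in> carrier B" using graded_algebraD(2)[OF B] gh(2) b by blast
    have "v \<bullet>\<^bsub>Q\<^esub> b \<in> carrier Q"
      using right_module.ract_closed[OF graded_right_moduleD(1)[OF gr(1)] v' b'] .
    moreover have "p (v \<bullet>\<^bsub>Q\<^esub> b) = \<zero>\<^bsub>X\<^esub>" "q (v \<bullet>\<^bsub>Q\<^esub> b) = \<zero>\<^bsub>Y\<^esub>"
      using graded_homD(4,5)[OF p] graded_homD(4,5)[OF q] S gh v b v' b' by simp_all
    ultimately show "v \<bullet>\<^bsub>Q\<^esub> b = \<zero>\<^bsub>Q\<^esub>" by (rule inj)
  qed
next
  fix X Y :: "('x, 'b, 'g) graded_module" and f
  assume gr: "graded_right_module G B \<B> X" "graded_right_module G B \<B> Y"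
    and S: "\<forall>g\<in>carrier G. \<forall>h\<in>carrier G. P g h \<longrightarrow> (\<forall>v\<in>homog X g. \<forall>b\<in>\<B> h. v \<bullet>\<^bsub>X\<^esub> b = \<zero>\<^bsub>X\<^esub>)"
    and f: "f \<in> graded_hom G B X Y" "f ` carrier X = carrier Y"
  have f0: "f \<zero>\<^bsub>X\<^esub> = \<zero>\<^bsub>Y\<^esub>"
    using gr[THEN graded_right_moduleD(2)] f(1) by (rule graded_hom_zero)
  show "\<forall>g\<in>carrier G. \<forall>h\<in>carrier G. P g h \<longrightarrow> (\<forall>v\<in>homog Y g. \<forall>b\<in>\<B> h. v \<bullet>\<^bsub>Y\<^esub> b = \<zero>\<^bsub>Y\<^esub>)"
  proof (intro ballI impI)
    fix g h v b assume gh: "g \<in> carrier G" "h \<in> carrier G" "P g h" and v: "v \<in> homog Y g" and b: "b \<in> \<B> h"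
    obtain x where x: "x \<in> homog X g" "v = f x"
      using homog_surj[OF gr f gh(1)] v by auto
    have x': "x \<in> carrier X" using gr(1) gh(1) x(1) by (rule homog_carrier)
    have b': "b \<in> carrier B" using graded_algebraD(2)[OF B] gh(2) b by blast
    have "v \<bullet>\<^bsub>Y\<^esub> b = f (x \<bullet>\<^bsub>X\<^esub> b)"
      using graded_homD(4)[OF f(1) x' b'] x(2) by simp
    then show "v \<bullet>\<^bsub>Y\<^esub> b = \<zero>\<^bsub>Y\<^esub>"
      using S gh x(1) b f0 by simp
  qed
next
  fix X :: "('x, 'b, 'g) graded_module"
  assume gr: "graded_right_module G B \<B> X" and X: "carrier X = {\<zero>\<^bsub>X\<^esub>}"
  interpret X: right_module B X by (rule graded_right_moduleD[OF gr])
  show "\<forall>g\<in>carrier G. \<forall>h\<in>carrier G. P g h \<longrightarrow> (\<forall>v\<in>homog X g. \<forall>b\<in>\<B> h. v \<bullet>\<^bsub>X\<^esub> b = \<zero>\<^bsub>X\<^esub>)"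
    using X.ract_closed homog_carrier[OF gr] graded_algebraD(2)[OF B] X by blast
qed (use assms graded_algebraD[OF B] in auto)

section \<open>Regrading an algebra and its modules along a pseudomorphism\<close>

locale pseudomorphism_graded_algebra =
  fixes R :: "('r, 'k) ring_scheme" and G' :: "('h, 'm) monoid_scheme" and G :: "('g, 'n) monoid_scheme"
    and \<phi> :: "'h \<Rightarrow> 'g" and B :: "('r, 'b) module" and \<B> :: "'g \<Rightarrow> 'b set"
  assumes group_G': "group G'" and group_G: "group G"
    and pseudo: "pseudomorphism G' G \<phi>"
    and graded: "graded_algebra R G B \<B>" and supp: "Supp G B \<B> \<subseteq> \<phi> ` carrier G'"
begin

interpretation G': group G' by (rule group_G')
interpretation G: group G by (rule group_G)

lemma \<phi>_closed: "\<sigma> \<in> carrier G' \<Longrightarrow> \<phi> \<sigma> \<in> carrier G"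
  using pseudo by (auto simp: pseudomorphism_def)

lemma \<phi>_inj: "inj_on \<phi> (carrier G')"
  using pseudo by (auto simp: pseudomorphism_def)

lemma \<phi>_mult:
  "\<lbrakk>\<sigma> \<in> carrier G'; \<tau> \<in> carrier G'; \<phi> \<sigma> \<otimes>\<^bsub>G\<^esub> \<phi> \<tau> \<in> \<phi> ` carrier G'\<rbrakk> \<Longrightarrow>
    \<phi> (\<sigma> \<otimes>\<^bsub>G'\<^esub> \<tau>) = \<phi> \<sigma> \<otimes>\<^bsub>G\<^esub> \<phi> \<tau>"
  using pseudo by (auto simp: pseudomorphism_def)

lemma comp_zero: "\<lbrakk>g \<in> carrier G; g \<notin> \<phi> ` carrier G'\<rbrakk> \<Longrightarrow> \<B> g = {\<zero>\<^bsub>B\<^esub>}"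
  using supp by (auto simp: Supp_def)

text \<open>If \<open>\<phi>(\<sigma>)\<phi>(\<tau>)\<close> is in the image, it equals
  \<open>\<phi>(\<sigma>\<tau>)\<close> and the product has the right degree already. Otherwise the
  product lies in a zero component of \<open>B\<close>, and zero belongs to every degree.\<close>

lemma graded_tilde: "graded_algebra R G' B (\<lambda>\<sigma>. \<B> (\<phi> \<sigma>))"
proof -
  have B: "r_algebra R B" "\<forall>g\<in>carrier G. submodule (\<B> g) R B" "internal_direct_sum B (carrier G) \<B>"
    using graded by (auto simp: graded_algebra_def)
  interpret r_algebra R B by fact
  have "internal_direct_sum B (carrier G') (\<lambda>\<sigma>. \<B> (\<phi> \<sigma>))"
    using B(3) comp_zero \<phi>_closed
    by (subst direct_sum_reindex[OF abelian_group_axioms \<phi>_inj, of "carrier G" \<B>, symmetric]) auto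
  moreover have "x \<otimes>\<^bsub>B\<^esub> y \<in> \<B> (\<phi> (\<sigma> \<otimes>\<^bsub>G'\<^esub> \<tau>))"
    if st: "\<sigma> \<in> carrier G'" "\<tau> \<in> carrier G'" and xy: "x \<in> \<B> (\<phi> \<sigma>)" "y \<in> \<B> (\<phi> \<tau>)" for \<sigma> \<tau> x y
  proof -
    have "x \<otimes>\<^bsub>B\<^esub> y \<in> \<B> (\<phi> \<sigma> \<otimes>\<^bsub>G\<^esub> \<phi> \<tau>)"
      using st xy by (intro graded_algebraD(4)[OF graded]) (auto simp: \<phi>_closed)
    then show ?thesis
      using st comp_zero[of "\<phi> \<sigma> \<otimes>\<^bsub>G\<^esub> \<phi> \<tau>"] \<phi>_mult[of \<sigma> \<tau>] graded_algebraD(3)[OF graded] \<phi>_closed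
      by (cases "\<phi> \<sigma> \<otimes>\<^bsub>G\<^esub> \<phi> \<tau> \<in> \<phi> ` carrier G'") auto
  qed
  ultimately show ?thesis
    using B \<phi>_closed by (auto simp: graded_algebra_def)
qed

section \<open>The equivalence for a fixed coset\<close>

context
  fixes g assumes g: "g \<in> carrier G"
begin

definition to_tilde :: "('x, 'b, 'g) graded_module \<Rightarrow> ('x, 'b, 'h) graded_module" where
  "to_tilde X = regrade (\<lambda>\<sigma>. homog X (g \<otimes>\<^bsub>G\<^esub> \<phi> \<sigma>)) X"

text \<open>The index \<open>\<sigma>\<close> behind a degree \<open>h\<close> of the coset is
  recovered with \<open>inv_into\<close>; it is unique because \<open>\<phi>\<close> and left
  translation by \<open>g\<close> are injective.\<close>

definition from_tilde :: "('x, 'b, 'h) graded_module \<Rightarrow> ('x, 'b, 'g) graded_module" where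
  "from_tilde V = regrade (\<lambda>h. if h \<in> (\<lambda>\<sigma>. g \<otimes>\<^bsub>G\<^esub> \<phi> \<sigma>) ` carrier G'
     then homog V (inv_into (carrier G') (\<lambda>\<sigma>. g \<otimes>\<^bsub>G\<^esub> \<phi> \<sigma>) h) else {\<zero>\<^bsub>V\<^esub>}) V"

lemma shift_inj: "inj_on (\<lambda>\<sigma>. g \<otimes>\<^bsub>G\<^esub> \<phi> \<sigma>) (carrier G')"
  using \<phi>_inj g \<phi>_closed by (auto simp: inj_on_def)

lemma l_coset_image: "g <#\<^bsub>G\<^esub> (\<phi> ` carrier G') = (\<lambda>\<sigma>. g \<otimes>\<^bsub>G\<^esub> \<phi> \<sigma>) ` carrier G'"
  by (auto simp: l_coset_def)

lemma shift_mem_iff: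
  "h \<in> carrier G \<Longrightarrow> g \<otimes>\<^bsub>G\<^esub> h \<in> (\<lambda>\<sigma>. g \<otimes>\<^bsub>G\<^esub> \<phi> \<sigma>) ` carrier G' \<longleftrightarrow> h \<in> \<phi> ` carrier G'"
  using g \<phi>_closed by (auto simp: image_iff)

lemma homog_from_tilde:
  "\<sigma> \<in> carrier G' \<Longrightarrow> homog (from_tilde V) (g \<otimes>\<^bsub>G\<^esub> \<phi> \<sigma>) = homog V \<sigma>"
  "h \<notin> (\<lambda>\<sigma>. g \<otimes>\<^bsub>G\<^esub> \<phi> \<sigma>) ` carrier G' \<Longrightarrow> homog (from_tilde V) h = {\<zero>\<^bsub>V\<^esub>}"
  using inv_into_f_f[OF shift_inj, of \<sigma>] by (auto simp: from_tilde_def)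

abbreviation "source \<equiv> Sigma_supp G B \<B> (g <#\<^bsub>G\<^esub> (\<phi> ` carrier G'))"
abbreviation "target \<equiv> Sigma_tilde G' G \<phi> B \<B>"

lemma to_tilde_obj:
  assumes X: "X \<in> Obj source"
  shows "to_tilde X \<in> Obj target"
proof -
  have gr: "graded_right_module G B \<B> X" and S: "Supp G X (homog X) \<subseteq> (\<lambda>\<sigma>. g \<otimes>\<^bsub>G\<^esub> \<phi> \<sigma>) ` carrier G'"
    using X by (auto simp: Sigma_supp_def l_coset_image)
  interpret X: right_module B X by (rule graded_right_moduleD[OF gr])
  have zero: "homog X h = {\<zero>\<^bsub>X\<^esub>}" if "h \<in> carrier G" "h \<notin> (\<lambda>\<sigma>. g \<otimes>\<^bsub>G\<^esub> \<phi> \<sigma>) ` carrier G'" for h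
    using that S by (auto simp: Supp_def)
  have act: "v \<bullet>\<^bsub>X\<^esub> b \<in> homog X (g \<otimes>\<^bsub>G\<^esub> (\<phi> \<sigma> \<otimes>\<^bsub>G\<^esub> \<phi> \<tau>))"
    if "\<sigma> \<in> carrier G'" "\<tau> \<in> carrier G'" "v \<in> homog X (g \<otimes>\<^bsub>G\<^esub> \<phi> \<sigma>)" "b \<in> \<B> (\<phi> \<tau>)" for \<sigma> \<tau> v b
    using graded_right_moduleD(3)[OF gr _ _ that(3,4)] that(1,2) g \<phi>_closed by (simp add: G.m_assoc)
  \<comment> \<open>Needed twice: for membership in \<open>Sigma_tilde\<close>, and for the grading
    itself, since for such pairs \<open>\<phi>(\<sigma>\<tau>)\<close> differs from
    \<open>\<phi>(\<sigma>)\<phi>(\<tau>)\<close> and only a zero product can have degree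
    \<open>\<sigma>\<tau>\<close>.\<close>
  have ann: "v \<bullet>\<^bsub>X\<^esub> b = \<zero>\<^bsub>X\<^esub>"
    if "\<sigma> \<in> carrier G'" "\<tau> \<in> carrier G'" "\<phi> \<sigma> \<otimes>\<^bsub>G\<^esub> \<phi> \<tau> \<notin> \<phi> ` carrier G'"
      "v \<in> homog X (g \<otimes>\<^bsub>G\<^esub> \<phi> \<sigma>)" "b \<in> \<B> (\<phi> \<tau>)" for \<sigma> \<tau> v b
    using act[OF that(1,2,4,5)] zero[of "g \<otimes>\<^bsub>G\<^esub> (\<phi> \<sigma> \<otimes>\<^bsub>G\<^esub> \<phi> \<tau>)"] that(1-3) g \<phi>_closed
    by (simp add: shift_mem_iff)
  have "internal_direct_sum X (carrier G) (homog X)"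
    using gr by (simp add: graded_right_module_def)
  then have "internal_direct_sum X (carrier G') (\<lambda>\<sigma>. homog X (g \<otimes>\<^bsub>G\<^esub> \<phi> \<sigma>))"
    using g \<phi>_closed zero
    by (subst direct_sum_reindex[OF X.X.abelian_group_axioms shift_inj, of "carrier G" "homog X", symmetric]) auto
  then have "internal_direct_sum (to_tilde X) (carrier G') (\<lambda>\<sigma>. homog X (g \<otimes>\<^bsub>G\<^esub> \<phi> \<sigma>))"
    unfolding to_tilde_def by (rule internal_direct_sum_regrade[OF X.right_module_axioms])
  moreover have "v \<bullet>\<^bsub>X\<^esub> b \<in> homog X (g \<otimes>\<^bsub>G\<^esub> \<phi> (\<sigma> \<otimes>\<^bsub>G'\<^esub> \<tau>))"
    if st: "\<sigma> \<in> carrier G'" "\<tau> \<in> carrier G'" and v: "v \<in> homog X (g \<otimes>\<^bsub>G\<^esub> \<phi> \<sigma>)" "b \<in> \<B> (\<phi> \<tau>)" for \<sigma> \<tau> v b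
  proof (cases "\<phi> \<sigma> \<otimes>\<^bsub>G\<^esub> \<phi> \<tau> \<in> \<phi> ` carrier G'")
    case True
    then show ?thesis using act[OF st v] \<phi>_mult[OF st] by simp
  next
    case False
    have "\<zero>\<^bsub>X\<^esub> \<in> homog X (g \<otimes>\<^bsub>G\<^esub> \<phi> (\<sigma> \<otimes>\<^bsub>G'\<^esub> \<tau>))"
      using st g \<phi>_closed by (intro direct_sum.summand_zero[OF direct_sum_hproj[OF gr]]) auto
    then show ?thesis using ann[OF st False v] by simp
  qed
  ultimately have "graded_right_module G' B (\<lambda>\<sigma>. \<B> (\<phi> \<sigma>)) (to_tilde X)"
    using right_module_regrade[OF X.right_module_axioms]
    by (auto simp: graded_right_module_def to_tilde_def)
  then show ?thesis
    using ann by (auto simp: Sigma_tilde_def to_tilde_def)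
qed

lemma from_tilde_obj:
  assumes V: "V \<in> Obj target"
  shows "from_tilde V \<in> Obj source"
proof -
  let ?\<psi> = "\<lambda>\<sigma>. g \<otimes>\<^bsub>G\<^esub> \<phi> \<sigma>"
  have gr: "graded_right_module G' B (\<lambda>\<sigma>. \<B> (\<phi> \<sigma>)) V"
    and ann: "\<And>\<sigma> \<tau> v b. \<lbrakk>\<sigma> \<in> carrier G'; \<tau> \<in> carrier G'; \<phi> \<sigma> \<otimes>\<^bsub>G\<^esub> \<phi> \<tau> \<notin> \<phi> ` carrier G';
      v \<in> homog V \<sigma>; b \<in> \<B> (\<phi> \<tau>)\<rbrakk> \<Longrightarrow> v \<bullet>\<^bsub>V\<^esub> b = \<zero>\<^bsub>V\<^esub>"
    using V by (auto simp: Sigma_tilde_def)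
  interpret V: right_module B V by (rule graded_right_moduleD[OF gr])
  have "internal_direct_sum V (carrier G') (homog V)"
    using gr by (simp add: graded_right_module_def)
  then have "internal_direct_sum V (carrier G) (homog (from_tilde V))"
    using g \<phi>_closed
    by (subst direct_sum_reindex[OF V.X.abelian_group_axioms shift_inj, where A' = "homog V"])
      (auto simp: homog_from_tilde)
  then have "internal_direct_sum (from_tilde V) (carrier G) (homog (from_tilde V))"
    using internal_direct_sum_regrade[OF V.right_module_axioms] by (simp add: from_tilde_def)
  moreover have zero: "\<zero>\<^bsub>V\<^esub> \<in> homog (from_tilde V) h" for h
    using direct_sum.summand_zero[OF direct_sum_hproj[OF gr]]
    by (cases "h \<in> ?\<psi> ` carrier G'") (auto simp: homog_from_tilde)
  have "v \<bullet>\<^bsub>V\<^esub> b \<in> homog (from_tilde V) (h \<otimes>\<^bsub>G\<^esub> k)"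
    if hk: "h \<in> carrier G" "k \<in> carrier G" and v: "v \<in> homog (from_tilde V) h" and b: "b \<in> \<B> k" for h k v b
  proof -
    \<comment> \<open>Outside of the coset \<open>v\<close> is zero, and outside of the image
      \<open>b\<close> is zero. Only in the third case can the product be nonzero, and there both
      degrees come from \<open>G'\<close>.\<close>
    consider "h \<notin> ?\<psi> ` carrier G'" | "k \<notin> \<phi> ` carrier G'"
      | \<sigma> \<tau> where "\<sigma> \<in> carrier G'" "\<tau> \<in> carrier G'" "h = ?\<psi> \<sigma>" "k = \<phi> \<tau>"
      by blast
    then show ?thesis
    proof cases
      case 1
      have "b \<in> carrier B" using b hk graded_algebraD(2)[OF graded] by auto
      then show ?thesis
        using v 1 zero by (simp add: homog_from_tilde V.zero_ract)
    next
      case 2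
      have "v \<in> carrier V"
        using v homog_carrier[OF gr]
        by (cases "h \<in> ?\<psi> ` carrier G'") (auto simp: homog_from_tilde)
      then show ?thesis
        using comp_zero[OF hk(2) 2] b zero by (simp add: V.ract_zero)
    next
      case 3
      then have v': "v \<in> homog V \<sigma>" and b': "b \<in> \<B> (\<phi> \<tau>)"
        using v b by (simp_all add: homog_from_tilde)
      show ?thesis
      proof (cases "\<phi> \<sigma> \<otimes>\<^bsub>G\<^esub> \<phi> \<tau> \<in> \<phi> ` carrier G'")
        case True
        have "h \<otimes>\<^bsub>G\<^esub> k = ?\<psi> (\<sigma> \<otimes>\<^bsub>G'\<^esub> \<tau>)"
          using 3 g \<phi>_closed \<phi>_mult[OF 3(1,2) True] by (simp add: G.m_assoc)
        then show ?thesis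
          using 3 graded_right_moduleD(3)[OF gr 3(1,2) v' b'] by (simp add: homog_from_tilde)
      next
        case False
        then show ?thesis
          using ann[OF 3(1,2) False v' b'] zero by simp
      qed
    qed
  qed
  ultimately have "graded_right_module G B \<B> (from_tilde V)"
    using right_module_regrade[OF V.right_module_axioms]
    by (auto simp: graded_right_module_def from_tilde_def)
  moreover have "Supp G (from_tilde V) (homog (from_tilde V)) \<subseteq> ?\<psi> ` carrier G'"
    using homog_from_tilde(2) by (auto simp: Supp_def from_tilde_def)
  ultimately show ?thesis
    by (auto simp: Sigma_supp_def l_coset_image)
qed

lemma to_tilde_hom:
  "f \<in> graded_hom G B X Y \<Longrightarrow> f \<in> graded_hom G' B (to_tilde X) (to_tilde Y)"
  using g \<phi>_closed by (auto simp: graded_hom_def to_tilde_def)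

text \<open>In the padded degrees the claim is that \<open>f\<close> sends zero to zero; this uses
  that \<open>V\<close> and \<open>W\<close> are abelian groups, which is why membership in the
  category enters the hypotheses.\<close>

lemma from_tilde_hom:
  assumes "V \<in> Obj target" "W \<in> Obj target" "f \<in> graded_hom G' B V W"
  shows "f \<in> graded_hom G B (from_tilde V) (from_tilde W)"
proof -
  have "abelian_group V" "abelian_group W"
    using assms by (auto simp: Sigma_tilde_def dest: graded_right_moduleD)
  then have "f \<zero>\<^bsub>V\<^esub> = \<zero>\<^bsub>W\<^esub>"
    using assms(3) by (rule graded_hom_zero)
  then have "f x \<in> homog (from_tilde W) h" if "x \<in> homog (from_tilde V) h" for h x
    using that graded_homD(5)[OF assms(3)]
    by (cases "h \<in> (\<lambda>\<sigma>. g \<otimes>\<^bsub>G\<^esub> \<phi> \<sigma>) ` carrier G'") (auto simp: homog_from_tilde)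
  then show ?thesis
    using assms(3) by (auto simp: graded_hom_def from_tilde_def)
qed

text \<open>The padding restores components that were zero by the support condition. Agreement is
  claimed for degrees in \<open>carrier G\<close> only: elsewhere the field \<open>homog X\<close>
  is arbitrary, so the two objects need not be equal and are compared by the identity map
  instead.\<close>

lemma homog_from_to_tilde:
  assumes "X \<in> Obj source" "h \<in> carrier G"
  shows "homog (from_tilde (to_tilde X)) h = homog X h"
proof (cases "h \<in> (\<lambda>\<sigma>. g \<otimes>\<^bsub>G\<^esub> \<phi> \<sigma>) ` carrier G'")
  case True
  then show ?thesis by (auto simp: homog_from_tilde to_tilde_def)
next
  case False
  then show ?thesis
    using assms by (auto simp: homog_from_tilde Sigma_supp_def l_coset_image Supp_def to_tilde_def)
qed

lemma homog_to_from_tilde: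
  "\<sigma> \<in> carrier G' \<Longrightarrow> homog (to_tilde (from_tilde V)) \<sigma> = homog V \<sigma>"
  using homog_from_tilde by (simp add: to_tilde_def)

lemma regrade_fields:
  "carrier (to_tilde X) = carrier X" "add (to_tilde X) = add X" "zero (to_tilde X) = zero X"
  "ract (to_tilde X) = ract X" "carrier (from_tilde V) = carrier V" "add (from_tilde V) = add V"
  "zero (from_tilde V) = zero V" "ract (from_tilde V) = ract V"
  by (simp_all add: to_tilde_def from_tilde_def)

theorem additively_equivalent_tilde:
  "additively_equivalent (source :: (('x, 'b, 'g) graded_module, 'x \<Rightarrow> 'x) precategory)
    (target :: (('x, 'b, 'h) graded_module, 'x \<Rightarrow> 'x) precategory)"
proof -
  let ?C = "source :: (('x, 'b, 'g) graded_module, 'x \<Rightarrow> 'x) precategory"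
  let ?D = "target :: (('x, 'b, 'h) graded_module, 'x \<Rightarrow> 'x) precategory"
  note cats = Sigma_supp_def Sigma_tilde_def
  have C: "preadditive_category ?C" and D: "preadditive_category ?D"
    unfolding cats by (rule preadditive_Gr_subcategory)+
  have F: "additive_functor ?C ?D to_tilde (\<lambda>X Y f. f)"
  proof (intro additive_functor.intro C D additive_functor_axioms.intro)
    show "to_tilde X \<in> Obj ?D" if "X \<in> Obj ?C" for X
      using that by (rule to_tilde_obj)
    show "f \<in> Hom ?D (to_tilde X) (to_tilde Y)" if "X \<in> Obj ?C" "Y \<in> Obj ?C" "f \<in> Hom ?C X Y" for X Y f
      using to_tilde_hom[of f] that by (simp add: cats)
  qed (simp_all add: cats regrade_fields)
  have H: "additive_functor ?D ?C from_tilde (\<lambda>V W f. f)"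
  proof (intro additive_functor.intro C D additive_functor_axioms.intro)
    show "from_tilde X \<in> Obj ?C" if "X \<in> Obj ?D" for X
      using that by (rule from_tilde_obj)
    show "f \<in> Hom ?C (from_tilde X) (from_tilde Y)" if "X \<in> Obj ?D" "Y \<in> Obj ?D" "f \<in> Hom ?D X Y" for X Y f
      using from_tilde_hom[of X Y f] that by (simp add: cats)
  qed (simp_all add: cats regrade_fields)
  \<comment> \<open>The restricted identity preserves degrees both ways because the two gradings
    agree on the group, and it is its own inverse.\<close>
  have "is_isomorphism ?C X (from_tilde (to_tilde X)) (\<lambda>x\<in>carrier X. x)" if X: "X \<in> Obj ?C" for X
  proof -
    have "graded_right_module G B \<B> X" using X by (simp add: Sigma_supp_def)
    then have "(\<lambda>x\<in>carrier X. x) \<in> graded_hom G B X X" by (rule graded_hom_ident)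
    then have "(\<lambda>x\<in>carrier X. x) \<in> graded_hom G B X (from_tilde (to_tilde X))"
      "(\<lambda>x\<in>carrier X. x) \<in> graded_hom G B (from_tilde (to_tilde X)) X"
      using homog_from_to_tilde[OF X] by (auto simp: graded_hom_def regrade_fields)
    then show ?thesis
      by (auto simp: is_isomorphism_def Sigma_supp_def regrade_fields compose_eq_restrict_iff
          intro!: bexI[of _ "\<lambda>x\<in>carrier X. x"])
  qed
  moreover have "is_isomorphism ?D V (to_tilde (from_tilde V)) (\<lambda>x\<in>carrier V. x)" if V: "V \<in> Obj ?D" for V
  proof -
    have "graded_right_module G' B (\<lambda>\<sigma>. \<B> (\<phi> \<sigma>)) V" using V by (simp add: Sigma_tilde_def)
    then have "(\<lambda>x\<in>carrier V. x) \<in> graded_hom G' B V V" by (rule graded_hom_ident)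
    then have "(\<lambda>x\<in>carrier V. x) \<in> graded_hom G' B V (to_tilde (from_tilde V))"
      "(\<lambda>x\<in>carrier V. x) \<in> graded_hom G' B (to_tilde (from_tilde V)) V"
      by (auto simp: homog_to_from_tilde graded_hom_def regrade_fields)
    then show ?thesis
      by (auto simp: is_isomorphism_def Sigma_tilde_def regrade_fields compose_eq_restrict_iff
          intro!: bexI[of _ "\<lambda>x\<in>carrier V. x"])
  qed
  \<comment> \<open>Stated over an arbitrary grading group \<open>K\<close>, so that naturality
    follows in both categories.\<close>
  moreover have "compose (carrier X) f (\<lambda>x\<in>carrier X. x) = compose (carrier X) (\<lambda>y\<in>carrier Y. y) f"
    if "f \<in> graded_hom K B X Y"
    for K :: "('i, 'l) monoid_scheme" and X Y :: "('x, 'b, 'i) graded_module" and f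
    using that by (auto simp: compose_def restrict_eq_iff dest: graded_homD)
  ultimately have "natural_iso_from_identity ?C (\<lambda>X. from_tilde (to_tilde X)) (\<lambda>X Y f. f) (\<lambda>X. \<lambda>x\<in>carrier X. x)"
    "natural_iso_from_identity ?D (\<lambda>V. to_tilde (from_tilde V)) (\<lambda>X Y f. f) (\<lambda>V. \<lambda>x\<in>carrier V. x)"
    unfolding natural_iso_from_identity_def by (auto simp: cats)
  with F H show ?thesis
    unfolding additively_equivalent_def by blast
qed

theorem equivalent_tilde:
  assumes inf: "infinite (UNIV :: 'x set)"
  shows "equivalent_abelian_categories
    (source :: (('x, 'b, 'g) graded_module, 'x \<Rightarrow> 'x) precategory)
    (target :: (('x, 'b, 'h) graded_module, 'x \<Rightarrow> 'x) precategory)"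
  unfolding equivalent_abelian_categories_def
proof (intro conjI additively_equivalent_tilde)
  show "abelian_category (source :: (('x, 'b, 'g) graded_module, 'x \<Rightarrow> 'x) precategory)"
    unfolding Sigma_supp_def
    by (rule graded_module_class.abelian_category[OF graded_module_class_Supp[OF graded inf]])
  \<comment> \<open>The target consists of modules over the regraded algebra, so the closure
    conditions are used over \<open>G'\<close>, with \<open>graded_tilde\<close> providing the
    grading.\<close>
  show "abelian_category (target :: (('x, 'b, 'h) graded_module, 'x \<Rightarrow> 'x) precategory)"
    unfolding Sigma_tilde_def
    by (rule graded_module_class.abelian_category[OF graded_module_class_annihilated[OF graded_tilde inf]])
qed

end

end

section \<open>A test algebra\<close>

text \<open>The \<open>R\<close>-algebra with basis \<open>1, x, y, xy\<close> in which all other products of \<open>x\<close> and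
  \<open>y\<close> vanish.\<close>

definition xy_algebra :: "('r, 'k) ring_scheme \<Rightarrow> ('r, 'r \<times> 'r \<times> 'r \<times> 'r) module" where
  "xy_algebra R =
     \<lparr>carrier = carrier R \<times> carrier R \<times> carrier R \<times> carrier R,
      mult = (\<lambda>(a, b, c, d) (a', b', c', d'). (a \<otimes>\<^bsub>R\<^esub> a', a \<otimes>\<^bsub>R\<^esub> b' \<oplus>\<^bsub>R\<^esub> b \<otimes>\<^bsub>R\<^esub> a',
        a \<otimes>\<^bsub>R\<^esub> c' \<oplus>\<^bsub>R\<^esub> c \<otimes>\<^bsub>R\<^esub> a', a \<otimes>\<^bsub>R\<^esub> d' \<oplus>\<^bsub>R\<^esub> d \<otimes>\<^bsub>R\<^esub> a' \<oplus>\<^bsub>R\<^esub> b \<otimes>\<^bsub>R\<^esub> c')),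
      one = (\<one>\<^bsub>R\<^esub>, \<zero>\<^bsub>R\<^esub>, \<zero>\<^bsub>R\<^esub>, \<zero>\<^bsub>R\<^esub>), zero = (\<zero>\<^bsub>R\<^esub>, \<zero>\<^bsub>R\<^esub>, \<zero>\<^bsub>R\<^esub>, \<zero>\<^bsub>R\<^esub>),
      add = (\<lambda>(a, b, c, d) (a', b', c', d').
        (a \<oplus>\<^bsub>R\<^esub> a', b \<oplus>\<^bsub>R\<^esub> b', c \<oplus>\<^bsub>R\<^esub> c', d \<oplus>\<^bsub>R\<^esub> d')),
      smult = (\<lambda>r (a, b, c, d). (r \<otimes>\<^bsub>R\<^esub> a, r \<otimes>\<^bsub>R\<^esub> b, r \<otimes>\<^bsub>R\<^esub> c, r \<otimes>\<^bsub>R\<^esub> d))\<rparr>"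

text \<open>The elements \<open>1, x, y, xy\<close> receive the degrees \<open>1, g, h, gh\<close>.
  Phrased as vanishing conditions on the coordinates, the definition stays correct when some of
  these degrees coincide.\<close>

definition xy_grading ::
    "('r, 'k) ring_scheme \<Rightarrow> ('g, 'n) monoid_scheme \<Rightarrow> 'g \<Rightarrow> 'g \<Rightarrow> 'g \<Rightarrow> ('r \<times> 'r \<times> 'r \<times> 'r) set" where
  "xy_grading R G g h k =
     {(a, b, c, d). a \<in> carrier R \<and> b \<in> carrier R \<and> c \<in> carrier R \<and> d \<in> carrier R \<and>
        (k \<noteq> \<one>\<^bsub>G\<^esub> \<longrightarrow> a = \<zero>\<^bsub>R\<^esub>) \<and> (k \<noteq> g \<longrightarrow> b = \<zero>\<^bsub>R\<^esub>) \<and>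
        (k \<noteq> h \<longrightarrow> c = \<zero>\<^bsub>R\<^esub>) \<and> (k \<noteq> g \<otimes>\<^bsub>G\<^esub> h \<longrightarrow> d = \<zero>\<^bsub>R\<^esub>)}"

lemma xy_algebra_simps [simp]:
  "carrier (xy_algebra R) = carrier R \<times> carrier R \<times> carrier R \<times> carrier R"
  "(a, b, c, d) \<otimes>\<^bsub>xy_algebra R\<^esub> (a', b', c', d') =
    (a \<otimes>\<^bsub>R\<^esub> a', a \<otimes>\<^bsub>R\<^esub> b' \<oplus>\<^bsub>R\<^esub> b \<otimes>\<^bsub>R\<^esub> a',
      a \<otimes>\<^bsub>R\<^esub> c' \<oplus>\<^bsub>R\<^esub> c \<otimes>\<^bsub>R\<^esub> a', a \<otimes>\<^bsub>R\<^esub> d' \<oplus>\<^bsub>R\<^esub> d \<otimes>\<^bsub>R\<^esub> a' \<oplus>\<^bsub>R\<^esub> b \<otimes>\<^bsub>R\<^esub> c')"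
  "\<one>\<^bsub>xy_algebra R\<^esub> = (\<one>\<^bsub>R\<^esub>, \<zero>\<^bsub>R\<^esub>, \<zero>\<^bsub>R\<^esub>, \<zero>\<^bsub>R\<^esub>)"
  "\<zero>\<^bsub>xy_algebra R\<^esub> = (\<zero>\<^bsub>R\<^esub>, \<zero>\<^bsub>R\<^esub>, \<zero>\<^bsub>R\<^esub>, \<zero>\<^bsub>R\<^esub>)"
  "(a, b, c, d) \<oplus>\<^bsub>xy_algebra R\<^esub> (a', b', c', d') =
    (a \<oplus>\<^bsub>R\<^esub> a', b \<oplus>\<^bsub>R\<^esub> b', c \<oplus>\<^bsub>R\<^esub> c', d \<oplus>\<^bsub>R\<^esub> d')"
  "r \<odot>\<^bsub>xy_algebra R\<^esub> (a, b, c, d) = (r \<otimes>\<^bsub>R\<^esub> a, r \<otimes>\<^bsub>R\<^esub> b, r \<otimes>\<^bsub>R\<^esub> c, r \<otimes>\<^bsub>R\<^esub> d)"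
  by (simp_all add: xy_algebra_def)

lemma r_algebraI:
  assumes "module R B" "ring B"
    and "\<And>a x y. \<lbrakk>a \<in> carrier R; x \<in> carrier B; y \<in> carrier B\<rbrakk> \<Longrightarrow>
      (a \<odot>\<^bsub>B\<^esub> x) \<otimes>\<^bsub>B\<^esub> y = a \<odot>\<^bsub>B\<^esub> (x \<otimes>\<^bsub>B\<^esub> y)"
    and "\<And>a x y. \<lbrakk>a \<in> carrier R; x \<in> carrier B; y \<in> carrier B\<rbrakk> \<Longrightarrow>
      x \<otimes>\<^bsub>B\<^esub> (a \<odot>\<^bsub>B\<^esub> y) = a \<odot>\<^bsub>B\<^esub> (x \<otimes>\<^bsub>B\<^esub> y)"
  shows "r_algebra R B"
  using assms by (intro r_algebra.intro r_algebra_axioms.intro) auto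

text \<open>Associativity holds because a product of three elements of the span of
  \<open>x, y, xy\<close> is zero under either bracketing, while \<open>1\<close> is a unit.\<close>

lemma r_algebra_xy:
  assumes "cring R"
  shows "r_algebra R (xy_algebra R)"
proof -
  interpret R: cring R by fact
  have ab: "abelian_group (xy_algebra R)"
  proof (rule abelian_groupI)
    fix z assume "z \<in> carrier (xy_algebra R)"
    then obtain a b c d where z: "z = (a, b, c, d)"
      "a \<in> carrier R" "b \<in> carrier R" "c \<in> carrier R" "d \<in> carrier R" by auto
    then show "\<exists>w\<in>carrier (xy_algebra R). w \<oplus>\<^bsub>xy_algebra R\<^esub> z = \<zero>\<^bsub>xy_algebra R\<^esub>"
      by (intro bexI[of _ "(\<ominus>\<^bsub>R\<^esub> a, \<ominus>\<^bsub>R\<^esub> b, \<ominus>\<^bsub>R\<^esub> c, \<ominus>\<^bsub>R\<^esub> d)"]) (auto simp: R.l_neg)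
  qed (auto simp: R.a_ac)
  have "monoid (xy_algebra R)"
    by (rule monoidI) (auto simp: R.l_distr R.r_distr R.m_ac R.a_ac)
  with ab have ring: "ring (xy_algebra R)"
    by (intro ringI) (auto simp: R.l_distr R.r_distr R.a_ac)
  have module: "module R (xy_algebra R)"
    by (intro moduleI assms ab) (auto simp: R.l_distr R.r_distr R.m_assoc)
  show ?thesis
    by (intro r_algebraI module ring) (auto simp: R.l_distr R.r_distr R.m_ac)
qed

lemma graded_algebra_xy:
  assumes "cring R" "group G" and g: "g \<in> carrier G" and h: "h \<in> carrier G"
  shows "graded_algebra R G (xy_algebra R) (xy_grading R G g h)"
  unfolding graded_algebra_def
proof (intro conjI ballI)
  interpret R: cring R by fact
  interpret G: group G by fact
  interpret A: r_algebra R "xy_algebra R" by (rule r_algebra_xy) fact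
  let ?A = "xy_algebra R"
  show "r_algebra R ?A" by (rule A.r_algebra_axioms)
  have neg: "\<ominus>\<^bsub>?A\<^esub> (a, b, c, d) = (\<ominus>\<^bsub>R\<^esub> a, \<ominus>\<^bsub>R\<^esub> b, \<ominus>\<^bsub>R\<^esub> c, \<ominus>\<^bsub>R\<^esub> d)"
    if "a \<in> carrier R" "b \<in> carrier R" "c \<in> carrier R" "d \<in> carrier R" for a b c d
    using that by (intro A.minus_equality) (auto simp: R.l_neg)
  show sub: "submodule (xy_grading R G g h k) R ?A" for k
    by (rule A.submoduleI) (clarsimp simp: xy_grading_def neg)+
  show "x \<otimes>\<^bsub>?A\<^esub> y \<in> xy_grading R G g h (k \<otimes>\<^bsub>G\<^esub> l)"
    if "k \<in> carrier G" "l \<in> carrier G" "x \<in> xy_grading R G g h k" "y \<in> xy_grading R G g h l" for k l x y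
  proof -
    obtain a b c d a' b' c' d' where xy: "x = (a, b, c, d)" "y = (a', b', c', d')"
      by (metis prod.exhaust)
    \<comment> \<open>If \<open>k l\<close> differs from \<open>u v\<close>, then \<open>k\<close>
      differs from \<open>u\<close> or \<open>l\<close> from \<open>v\<close>, so one of the two
      coordinates vanishes. Each term of the product formula is an instance, with \<open>u\<close>
      and \<open>v\<close> the degrees of the basis elements involved.\<close>
    have zero: "s \<otimes>\<^bsub>R\<^esub> t = \<zero>\<^bsub>R\<^esub>"
      if "k \<otimes>\<^bsub>G\<^esub> l \<noteq> w" "s \<in> carrier R" "t \<in> carrier R"
        "k \<noteq> u \<longrightarrow> s = \<zero>\<^bsub>R\<^esub>" "l \<noteq> v \<longrightarrow> t = \<zero>\<^bsub>R\<^esub>" "w = u \<otimes>\<^bsub>G\<^esub> v" for s t u v w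
      using that by (cases "k = u") auto
    note * = that(3,4)[unfolded xy xy_grading_def mem_Collect_eq prod.case]
    have "k \<otimes>\<^bsub>G\<^esub> l \<noteq> \<one>\<^bsub>G\<^esub> \<longrightarrow> a \<otimes>\<^bsub>R\<^esub> a' = \<zero>\<^bsub>R\<^esub>"
      using * zero[of "\<one>\<^bsub>G\<^esub>" a a' "\<one>\<^bsub>G\<^esub>" "\<one>\<^bsub>G\<^esub>"] by simp
    moreover have "k \<otimes>\<^bsub>G\<^esub> l \<noteq> g \<longrightarrow> a \<otimes>\<^bsub>R\<^esub> b' = \<zero>\<^bsub>R\<^esub> \<and> b \<otimes>\<^bsub>R\<^esub> a' = \<zero>\<^bsub>R\<^esub>"
      using * g zero[of g a b' "\<one>\<^bsub>G\<^esub>" g] zero[of g b a' g "\<one>\<^bsub>G\<^esub>"] by simp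
    moreover have "k \<otimes>\<^bsub>G\<^esub> l \<noteq> h \<longrightarrow> a \<otimes>\<^bsub>R\<^esub> c' = \<zero>\<^bsub>R\<^esub> \<and> c \<otimes>\<^bsub>R\<^esub> a' = \<zero>\<^bsub>R\<^esub>"
      using * h zero[of h a c' "\<one>\<^bsub>G\<^esub>" h] zero[of h c a' h "\<one>\<^bsub>G\<^esub>"] by simp
    moreover have "k \<otimes>\<^bsub>G\<^esub> l \<noteq> g \<otimes>\<^bsub>G\<^esub> h \<longrightarrow>
        a \<otimes>\<^bsub>R\<^esub> d' = \<zero>\<^bsub>R\<^esub> \<and> d \<otimes>\<^bsub>R\<^esub> a' = \<zero>\<^bsub>R\<^esub> \<and> b \<otimes>\<^bsub>R\<^esub> c' = \<zero>\<^bsub>R\<^esub>"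
      using * g h zero[of _ a d' "\<one>\<^bsub>G\<^esub>" "g \<otimes>\<^bsub>G\<^esub> h"] zero[of _ d a' "g \<otimes>\<^bsub>G\<^esub> h" "\<one>\<^bsub>G\<^esub>"]
        zero[of _ b c' g h] by simp
    ultimately show ?thesis
      using * by (simp add: xy xy_grading_def)
  qed
  \<comment> \<open>\<open>?p k\<close> keeps the coordinates whose basis element has degree
    \<open>k\<close>, so at most four degrees contribute.\<close>
  let ?p = "\<lambda>k (a, b, c, d). (if k = \<one>\<^bsub>G\<^esub> then a else \<zero>\<^bsub>R\<^esub>, if k = g then b else \<zero>\<^bsub>R\<^esub>,
    if k = h then c else \<zero>\<^bsub>R\<^esub>, if k = g \<otimes>\<^bsub>G\<^esub> h then d else \<zero>\<^bsub>R\<^esub>)"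
  have "direct_sum ?A (carrier G) (xy_grading R G g h) ?p"
  proof (intro direct_sum.intro direct_sum_axioms.intro)
    show "additive_subgroup (xy_grading R G g h k) ?A" for k
      using sub by (simp add: additive_subgroup_def submodule_def)
    show "finite {k \<in> carrier G. ?p k z \<noteq> \<zero>\<^bsub>?A\<^esub>}" for z
    proof (rule finite_subset)
      have "?p k z = \<zero>\<^bsub>?A\<^esub>" if "k \<notin> {\<one>\<^bsub>G\<^esub>, g, h, g \<otimes>\<^bsub>G\<^esub> h}" for k
        using that by (cases z) simp
      then show "{k \<in> carrier G. ?p k z \<noteq> \<zero>\<^bsub>?A\<^esub>} \<subseteq> {\<one>\<^bsub>G\<^esub>, g, h, g \<otimes>\<^bsub>G\<^esub> h}"
        by blast
    qed simp
    fix z assume z: "z \<in> carrier ?A" "\<And>k. k \<in> carrier G \<Longrightarrow> ?p k z = \<zero>\<^bsub>?A\<^esub>"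
    show "z = \<zero>\<^bsub>?A\<^esub>"
      using z(1) z(2)[of "\<one>\<^bsub>G\<^esub>"] z(2)[of g] z(2)[of h] z(2)[of "g \<otimes>\<^bsub>G\<^esub> h"] g h by auto
  qed (auto simp: xy_grading_def A.abelian_group_axioms)
  then show "internal_direct_sum ?A (carrier G) (xy_grading R G g h)"
    by (rule direct_sum.internal_direct_sum)
qed

section \<open>Transport of the test algebra into the type \<open>'b\<close>\<close>

definition image_algebra :: "('a \<Rightarrow> 'b) \<Rightarrow> ('r, 'a) module \<Rightarrow> ('r, 'b) module" where
  "image_algebra e A =
     (let r = inv_into (carrier A) e in
      \<lparr>carrier = e ` carrier A, mult = (\<lambda>x y. e (r x \<otimes>\<^bsub>A\<^esub> r y)), one = e \<one>\<^bsub>A\<^esub>, zero = e \<zero>\<^bsub>A\<^esub>,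
       add = (\<lambda>x y. e (r x \<oplus>\<^bsub>A\<^esub> r y)), smult = (\<lambda>a x. e (a \<odot>\<^bsub>A\<^esub> r x))\<rparr>)"

lemma image_algebra_simps:
  "carrier (image_algebra e A) = e ` carrier A" "\<one>\<^bsub>image_algebra e A\<^esub> = e \<one>\<^bsub>A\<^esub>"
  "\<zero>\<^bsub>image_algebra e A\<^esub> = e \<zero>\<^bsub>A\<^esub>"
  by (simp_all add: image_algebra_def Let_def)

lemma image_algebra_ops:
  assumes "inj_on e (carrier A)"
  shows "\<lbrakk>x \<in> carrier A; y \<in> carrier A\<rbrakk> \<Longrightarrow> e x \<otimes>\<^bsub>image_algebra e A\<^esub> e y = e (x \<otimes>\<^bsub>A\<^esub> y)"
    and "\<lbrakk>x \<in> carrier A; y \<in> carrier A\<rbrakk> \<Longrightarrow> e x \<oplus>\<^bsub>image_algebra e A\<^esub> e y = e (x \<oplus>\<^bsub>A\<^esub> y)"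
    and "x \<in> carrier A \<Longrightarrow> a \<odot>\<^bsub>image_algebra e A\<^esub> e x = e (a \<odot>\<^bsub>A\<^esub> x)"
  using assms by (simp_all add: image_algebra_def Let_def)

text \<open>Pure transport of structure; the projections are conjugated by \<open>e\<close>.\<close>

lemma graded_image_algebra:
  assumes A: "graded_algebra R G A \<A>" and inj: "inj_on e (carrier A)"
  shows "graded_algebra R G (image_algebra e A) (\<lambda>g. e ` \<A> g)"
proof -
  have A': "r_algebra R A" "\<And>g. g \<in> carrier G \<Longrightarrow> submodule (\<A> g) R A"
    "internal_direct_sum A (carrier G) \<A>"
    using A by (auto simp: graded_algebra_def)
  interpret r_algebra R A by fact
  obtain p where "direct_sum A (carrier G) \<A> p"
    using A'(3) internal_direct_sum_iff[OF abelian_group_axioms] by blast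
  then interpret p: direct_sum A "carrier G" \<A> p .
  let ?E = "image_algebra e A"
  note [simp] = image_algebra_simps image_algebra_ops[OF inj]
  have ab: "abelian_group ?E"
  proof (rule abelian_groupI)
    fix y assume "y \<in> carrier ?E"
    then obtain x where "x \<in> carrier A" "y = e x" by auto
    then show "\<exists>z\<in>carrier ?E. z \<oplus>\<^bsub>?E\<^esub> y = \<zero>\<^bsub>?E\<^esub>"
      by (intro bexI[of _ "e (\<ominus>\<^bsub>A\<^esub> x)"]) (auto simp: l_neg)
  qed (auto simp: a_ac)
  interpret E: abelian_group ?E by (rule ab)
  have "monoid ?E"
    by (rule monoidI) (auto simp: m_assoc)
  with ab have ring: "ring ?E"
    by (intro ringI) (auto simp: l_distr r_distr)
  have module: "module R ?E"
    by (intro moduleI R.is_cring ab)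
      (auto simp: smult_l_distr smult_r_distr smult_assoc1)
  interpret E: module R ?E by (rule module)
  have alg: "r_algebra R ?E"
    by (intro r_algebraI module ring) (auto simp: smult_mult_left smult_mult_right)
  have neg: "\<ominus>\<^bsub>?E\<^esub> e x = e (\<ominus>\<^bsub>A\<^esub> x)" if "x \<in> carrier A" for x
    using that by (intro E.minus_equality) (auto simp: l_neg)
  have sub: "submodule (e ` \<A> g) R ?E" if g: "g \<in> carrier G" for g
    using g submoduleE[OF A'(2)[OF g]] p.summand_zero[OF g]
    by (intro E.submoduleI) (auto simp: neg p.summand_carrier)
  have "direct_sum ?E (carrier G) (\<lambda>g. e ` \<A> g) (\<lambda>g y. e (p g (inv_into (carrier A) e y)))"
  proof (intro direct_sum.intro ab direct_sum_axioms.intro)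
    show "additive_subgroup (e ` \<A> g) ?E" if "g \<in> carrier G" for g
      using sub[OF that] by (simp add: additive_subgroup_def submodule_def)
    fix y assume "y \<in> carrier ?E"
    then obtain x where x: "x \<in> carrier A" "y = e x" by auto
    show "finite {g \<in> carrier G. e (p g (inv_into (carrier A) e y)) \<noteq> \<zero>\<^bsub>?E\<^esub>}"
      by (rule finite_subset[OF _ p.finite_proj[OF x(1)]]) (auto simp: x inj)
    assume "\<And>g. g \<in> carrier G \<Longrightarrow> e (p g (inv_into (carrier A) e y)) = \<zero>\<^bsub>?E\<^esub>"
    then have "p g x = \<zero>\<^bsub>A\<^esub>" if "g \<in> carrier G" for g
      using that x inj by (auto simp: p.proj_closed inj_on_eq_iff)
    then show "y = \<zero>\<^bsub>?E\<^esub>"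
      using p.proj_separate[OF x(1)] x(2) by simp
  qed (auto simp: inj p.proj_in p.proj_add p.proj_closed p.proj_summand p.summand_carrier)
  then have "internal_direct_sum ?E (carrier G) (\<lambda>g. e ` \<A> g)"
    by (rule direct_sum.internal_direct_sum)
  moreover have "e x \<otimes>\<^bsub>?E\<^esub> e y \<in> e ` \<A> (g \<otimes>\<^bsub>G\<^esub> h)"
    if "g \<in> carrier G" "h \<in> carrier G" "x \<in> \<A> g" "y \<in> \<A> h" for g h x y
    using that graded_algebraD(4)[OF A that] by (auto simp: p.summand_carrier)
  ultimately show ?thesis
    using alg sub by (auto simp: graded_algebra_def)
qed

text \<open>The coordinates are moved into \<open>'b\<close> by \<open>\<iota>\<close>, and the
  quadruple is coded as a pair of pairs. Since \<open>\<iota>\<close> is injective on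
  \<open>C\<close> only, so is the coding on quadruples from \<open>C\<close>.\<close>

lemma quadruple_injection:
  assumes "infinite (UNIV :: 'b set)" and "inj_on (\<iota> :: 'r \<Rightarrow> 'b) C"
  obtains e :: "'r \<times> 'r \<times> 'r \<times> 'r \<Rightarrow> 'b" where "inj_on e (C \<times> C \<times> C \<times> C)"
proof -
  obtain p :: "'b \<times> 'b \<Rightarrow> 'b" where p: "inj p"
    using card_of_Times_same_infinite[OF assms(1), THEN ordIso_imp_ordLeq, folded card_of_ordLeq]
    by auto
  show thesis
    by (rule that[of "\<lambda>(a, b, c, d). p (p (\<iota> a, \<iota> b), p (\<iota> c, \<iota> d))"])
      (use assms(2) in \<open>auto simp: inj_on_def inj_eq[OF p]\<close>)
qed

section \<open>From regradings to pseudomorphisms\<close>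

lemma pseudomorphism_if_regrading:
  fixes R :: "('r, 'k) ring_scheme" and G' :: "('h, 'm) monoid_scheme" and G :: "('g, 'n) monoid_scheme"
  assumes R: "cring R" "\<one>\<^bsub>R\<^esub> \<noteq> \<zero>\<^bsub>R\<^esub>" and G': "group G'" and G: "group G"
    and \<phi>: "\<phi> \<in> carrier G' \<rightarrow> carrier G" and one: "\<one>\<^bsub>G\<^esub> \<in> \<phi> ` carrier G'"
    and inf: "infinite (UNIV :: 'b set)" and \<iota>: "inj_on (\<iota> :: 'r \<Rightarrow> 'b) (carrier R)"
    and regrading: "\<And>(B :: ('r, 'b) module) \<B>. \<lbrakk>graded_algebra R G B \<B>; Supp G B \<B> \<subseteq> \<phi> ` carrier G'\<rbrakk> \<Longrightarrow>
      graded_algebra R G' B (\<lambda>\<sigma>. \<B> (\<phi> \<sigma>))"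
  shows "pseudomorphism G' G \<phi>"
proof -
  interpret R: cring R by fact
  interpret G': group G' by fact
  interpret G: group G by fact
  have \<phi>': "\<phi> \<sigma> \<in> carrier G" if "\<sigma> \<in> carrier G'" for \<sigma> using \<phi> that by blast
  let ?A = "xy_algebra R"
  obtain e :: "'r \<times> 'r \<times> 'r \<times> 'r \<Rightarrow> 'b" where e: "inj_on e (carrier ?A)"
    using quadruple_injection[OF inf \<iota>] by auto
  \<comment> \<open>The test algebra lives in the degrees \<open>1, g, h, gh\<close>. The first is
    in the image by \<open>one\<close>, the others by assumption, so hypothesis (b) applies.\<close>
  have grading: "graded_algebra R G' (image_algebra e ?A) (\<lambda>\<sigma>. e ` xy_grading R G g h (\<phi> \<sigma>))"
    if gh: "g \<in> \<phi> ` carrier G'" "h \<in> \<phi> ` carrier G'" "g \<otimes>\<^bsub>G\<^esub> h \<in> \<phi> ` carrier G'" for g h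
  proof (rule regrading)
    show "graded_algebra R G (image_algebra e ?A) (\<lambda>k. e ` xy_grading R G g h k)"
      using gh \<phi> by (intro graded_image_algebra[OF _ e] graded_algebra_xy[OF R(1) G]) auto
    have "xy_grading R G g h k = {\<zero>\<^bsub>?A\<^esub>}" if "k \<notin> {\<one>\<^bsub>G\<^esub>, g, h, g \<otimes>\<^bsub>G\<^esub> h}" for k
      using that by (auto simp: xy_grading_def)
    then show "Supp G (image_algebra e ?A) (\<lambda>k. e ` xy_grading R G g h k) \<subseteq> \<phi> ` carrier G'"
      using gh one by (fastforce simp: Supp_def image_algebra_simps)
  qed
  have inj: "inj_on \<phi> (carrier G')"
  proof (rule inj_onI, rule ccontr)
    fix \<sigma> \<tau> assume st: "\<sigma> \<in> carrier G'" "\<tau> \<in> carrier G'" "\<phi> \<sigma> = \<phi> \<tau>" "\<sigma> \<noteq> \<tau>"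
    let ?B = "image_algebra e ?A" and ?x = "(\<zero>\<^bsub>R\<^esub>, \<one>\<^bsub>R\<^esub>, \<zero>\<^bsub>R\<^esub>, \<zero>\<^bsub>R\<^esub>)"
    \<comment> \<open>With the degree of \<open>y\<close> taken to be \<open>1\<close>, the degree
      of \<open>xy\<close> is again \<open>\<phi> \<sigma>\<close>, so the support condition holds
      without any knowledge of products.\<close>
    let ?\<B> = "\<lambda>\<rho>. e ` xy_grading R G (\<phi> \<sigma>) \<one>\<^bsub>G\<^esub> (\<phi> \<rho>)"
    have B: "graded_algebra R G' ?B ?\<B>"
      using st one \<phi>' by (intro grading) auto
    then have "abelian_group ?B" "internal_direct_sum ?B (carrier G') ?\<B>"
      using graded_algebraD(1)[OF B] by (auto simp: graded_algebra_def ring_def)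
    then obtain p where "direct_sum ?B (carrier G') ?\<B> p"
      by (auto simp: internal_direct_sum_iff)
    then interpret p: direct_sum ?B "carrier G'" ?\<B> p .
    \<comment> \<open>A homogeneous element of two distinct degrees is zero, whereas the coordinate
      \<open>\<one>\<close> of \<open>x\<close> is nonzero in \<open>R\<close>.\<close>
    have "e ?x \<in> ?\<B> \<sigma>" "e ?x \<in> ?\<B> \<tau>"
      using st by (auto simp: xy_grading_def)
    then have "e ?x = \<zero>\<^bsub>?B\<^esub>"
      using p.proj_summand[of \<sigma> \<tau> "e ?x"] p.proj_summand[of \<tau> \<tau> "e ?x"] st by simp
    then show False
      using inj_onD[OF e, of ?x "\<zero>\<^bsub>?A\<^esub>"] R(2) by (simp add: image_algebra_simps)
  qed
  have mult: "\<phi> (\<sigma> \<otimes>\<^bsub>G'\<^esub> \<tau>) = \<phi> \<sigma> \<otimes>\<^bsub>G\<^esub> \<phi> \<tau>"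
    if st: "\<sigma> \<in> carrier G'" "\<tau> \<in> carrier G'" and im: "\<phi> \<sigma> \<otimes>\<^bsub>G\<^esub> \<phi> \<tau> \<in> \<phi> ` carrier G'" for \<sigma> \<tau>
  proof -
    let ?x = "(\<zero>\<^bsub>R\<^esub>, \<one>\<^bsub>R\<^esub>, \<zero>\<^bsub>R\<^esub>, \<zero>\<^bsub>R\<^esub>)" and ?y = "(\<zero>\<^bsub>R\<^esub>, \<zero>\<^bsub>R\<^esub>, \<one>\<^bsub>R\<^esub>, \<zero>\<^bsub>R\<^esub>)"
      and ?xy = "(\<zero>\<^bsub>R\<^esub>, \<zero>\<^bsub>R\<^esub>, \<zero>\<^bsub>R\<^esub>, \<one>\<^bsub>R\<^esub>)"
    let ?\<A> = "xy_grading R G (\<phi> \<sigma>) (\<phi> \<tau>)"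
    \<comment> \<open>The regraded algebra puts \<open>xy\<close> into the component of degree
      \<open>\<phi>(\<sigma>\<tau>)\<close>. Its last coordinate is \<open>1 \<noteq> 0\<close>,
      which the definition of the grading permits in degree
      \<open>\<phi>(\<sigma>)\<phi>(\<tau>)\<close> only.\<close>
    have "e ?x \<otimes>\<^bsub>image_algebra e ?A\<^esub> e ?y \<in> e ` ?\<A> (\<phi> (\<sigma> \<otimes>\<^bsub>G'\<^esub> \<tau>))"
      using st im by (intro graded_algebraD(4)[OF grading]) (auto simp: xy_grading_def)
    then have "e ?xy \<in> e ` ?\<A> (\<phi> (\<sigma> \<otimes>\<^bsub>G'\<^esub> \<tau>))"
      by (simp add: image_algebra_ops[OF e])
    moreover have "?\<A> (\<phi> (\<sigma> \<otimes>\<^bsub>G'\<^esub> \<tau>)) \<subseteq> carrier ?A"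
      by (auto simp: xy_grading_def)
    ultimately have "?xy \<in> ?\<A> (\<phi> (\<sigma> \<otimes>\<^bsub>G'\<^esub> \<tau>))"
      using inj_on_image_mem_iff[OF e, of ?xy] by simp
    then show ?thesis
      using R(2) by (auto simp: xy_grading_def)
  qed
  \<comment> \<open>Some \<open>\<sigma>\<close> maps to \<open>1\<close>, but it is not yet known
    to be the unit. Multiplicativity and injectivity make it idempotent, and the only idempotent of
    a group is the unit.\<close>
  obtain \<sigma> where \<sigma>: "\<sigma> \<in> carrier G'" "\<phi> \<sigma> = \<one>\<^bsub>G\<^esub>"
    using one by auto
  then have "\<phi> (\<sigma> \<otimes>\<^bsub>G'\<^esub> \<sigma>) = \<phi> \<sigma>"
    using mult[of \<sigma> \<sigma>] one by simp
  then have "\<sigma> \<otimes>\<^bsub>G'\<^esub> \<sigma> = \<sigma>"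
    using \<sigma> by (intro inj_onD[OF inj]) auto
  then have "\<phi> \<one>\<^bsub>G'\<^esub> = \<one>\<^bsub>G\<^esub>"
    using \<sigma> by simp
  then show ?thesis
    using \<phi> inj mult by (simp add: pseudomorphism_def)
qed

text \<open>The types \<open>'b\<close> and \<open>'x\<close> stand for the universe. An infinite
  \<open>'b\<close> into which \<open>R\<close> embeds has room for the test algebra, and an
  infinite \<open>'x\<close> has room for biproducts. Over the zero ring every algebra is zero, so
  (b) would only say that \<open>1\<close> is in the image of \<open>\<phi>\<close>; this is what
  \<open>\<one> \<noteq> \<zero>\<close> excludes.\<close>

theorem proposition3p1:
  fixes R :: "'r ring" and G' :: "'h monoid" and G :: "'g monoid" and \<phi> :: "'h \<Rightarrow> 'g"
  assumes "cring R" and "\<one>\<^bsub>R\<^esub> \<noteq> \<zero>\<^bsub>R\<^esub>"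
    and "group G'" and "group G"
    and "\<phi> \<in> carrier G' \<rightarrow> carrier G"
    and "infinite (UNIV :: 'b set)" and "\<exists>\<iota> :: 'r \<Rightarrow> 'b. inj_on \<iota> (carrier R)"
    and "infinite (UNIV :: 'x set)"
  shows
    "(pseudomorphism G' G \<phi> \<longleftrightarrow>
        \<one>\<^bsub>G\<^esub> \<in> \<phi> ` carrier G' \<and>
        (\<forall>(B :: ('r, 'b) module) \<B>.
           graded_algebra R G B \<B> \<and> Supp G B \<B> \<subseteq> \<phi> ` carrier G' \<longrightarrow>
           graded_algebra R G' B (\<lambda>\<sigma>. \<B> (\<phi> \<sigma>)))) \<and>
     (pseudomorphism G' G \<phi> \<longrightarrow>
        (\<forall>(B :: ('r, 'b) module) \<B>.
           graded_algebra R G B \<B> \<and> Supp G B \<B> \<subseteq> \<phi> ` carrier G' \<longrightarrow>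
           (\<forall>g\<in>carrier G.
              equivalent_abelian_categories
                (Sigma_supp G B \<B> (g <#\<^bsub>G\<^esub> (\<phi> ` carrier G'))
                   :: (('x, 'b, 'g) graded_module, 'x \<Rightarrow> 'x) precategory)
                (Sigma_tilde G' G \<phi> B \<B>
                   :: (('x, 'b, 'h) graded_module, 'x \<Rightarrow> 'x) precategory))))"
proof (intro conjI impI allI ballI iffI)
  assume p: "pseudomorphism G' G \<phi>"
  then show "\<one>\<^bsub>G\<^esub> \<in> \<phi> ` carrier G'"
    using monoid.one_closed[OF group.is_monoid[OF assms(3)]]
    by (auto simp: pseudomorphism_def intro!: image_eqI[of _ \<phi> "\<one>\<^bsub>G'\<^esub>"])
  fix B :: "('r, 'b) module" and \<B>
  assume B: "graded_algebra R G B \<B> \<and> Supp G B \<B> \<subseteq> \<phi> ` carrier G'"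
  interpret pseudomorphism_graded_algebra R G' G \<phi> B \<B>
    using assms(3,4) p B by (intro pseudomorphism_graded_algebra.intro) auto
  show "graded_algebra R G' B (\<lambda>\<sigma>. \<B> (\<phi> \<sigma>))"
    by (rule graded_tilde)
  show "equivalent_abelian_categories
      (Sigma_supp G B \<B> (g <#\<^bsub>G\<^esub> (\<phi> ` carrier G')) :: (('x, 'b, 'g) graded_module, 'x \<Rightarrow> 'x) precategory)
      (Sigma_tilde G' G \<phi> B \<B> :: (('x, 'b, 'h) graded_module, 'x \<Rightarrow> 'x) precategory)"
    if "g \<in> carrier G" for g
    using that assms(8) by (rule equivalent_tilde)
next
  assume "\<one>\<^bsub>G\<^esub> \<in> \<phi> ` carrier G' \<and>
    (\<forall>(B :: ('r, 'b) module) \<B>. graded_algebra R G B \<B> \<and> Supp G B \<B> \<subseteq> \<phi> ` carrier G' \<longrightarrow>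
      graded_algebra R G' B (\<lambda>\<sigma>. \<B> (\<phi> \<sigma>)))"
  then show "pseudomorphism G' G \<phi>"
    using assms pseudomorphism_if_regrading[of R G' G \<phi>] by blast
qed

end
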